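(* Let $\ell$ be a positive integer and let $q=p^r$ be a prime power ($p$ prime, $r\ge1$). Define the following function of $n\in\mathbb{N}_{>0}$: $$f_{q,\ell}(n)=\frac{\psi_q(n,\underbrace{0,\ldots,0}_{\ell})-q^{n-\ell}}{q^{n/2}}.$$ If either $\ell=3$ and $p\notin\{2,5\}$, or $\ell\ge4$, then the function $f_{q,\ell}(n)$ is not periodic in $n$ (i.e. there is no integer $N\ge1$ with $f_{q,\ell}(n+N)=f_{q,\ell}(n)$ for all $n\ge1$).
   Context: $\mathbb{F}_q$ is the finite field with $q$ elements; $\mathcal{M}_{n,q}$ is the set of monic polynomials of degree $n$ in $\mathbb{F}_q[T]$. The $j$-th next-to-leading coefficient of a monic polynomial $f$ of degree $n$ is the coefficient of $T^{n-j}$ in $f$ ($j\ge1$), with the convention that it is $0$ if $j>n$. The von Mangoldt function is $\Lambda_q(f)=\deg P$ if $f=P^k$ with $P$ monic irreducible and $k\ge1$, and $\Lambda_q(f)=0$ otherwise. For $n\ge1$ and $t_1,\dots,t_\ell\in\mathbb{F}_q$, $\psi_q(n,t_1,\dots,t_\ell)=\sum \Lambda_q(f)$, the sum being over all $f\in\mathcal{M}_{n,q}$ whose first $\ell$ next-to-leading coefficients are $t_1,\dots,t_\ell$ (this is defined also when $\ell>n$, using the convention). *)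

theory Defs
  imports Complex_Main "HOL-Library.Cardinality"
    "HOL-Computational_Algebra.Computational_Algebra"
begin

definition monic_polys :: "nat \<Rightarrow> 'a::{finite,field} poly set" where
  "monic_polys n = {f. degree f = n \<and> lead_coeff f = 1}"

(* The truncated subtraction "degree f - j" only occurs when j \<le> degree f. *)
definition next_to_leading :: "nat \<Rightarrow> 'a::{finite,field} poly \<Rightarrow> 'a" where
  "next_to_leading j f = (if j \<le> degree f then coeff f (degree f - j) else 0)"

(* The description picks a unique polynomial: see mangoldt_power below. *)
definition mangoldt :: "'a::{finite,field} poly \<Rightarrow> nat" where
  "mangoldt f =
     (if \<exists>P k. irreducible P \<and> lead_coeff P = 1 \<and> k \<ge> 1 \<and> f = P ^ k
      then degree (THE P. irreducible P \<and> lead_coeff P = 1 \<and> (\<exists>k\<ge>1. f = P ^ k))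
      else 0)"

(* ts lists t_1, ..., t_l, so its 0-based entry j - 1 is t_j. *)
definition psi :: "nat \<Rightarrow> 'a::{finite,field} list \<Rightarrow> nat" where
  "psi n ts =
     (\<Sum>f \<in> {f \<in> monic_polys n. \<forall>j\<in>{1..length ts}. next_to_leading j f = ts ! (j - 1)}.
        mangoldt f)"

(* The type argument is the field with q = CARD('a) elements. The exponent n - l is an
   integer, negative when n < l. *)
definition normalized_error :: "'a::{finite,field} itself \<Rightarrow> nat \<Rightarrow> nat \<Rightarrow> real" where
  "normalized_error F l n =
     (real (psi n (replicate l (0::'a))) - real (CARD('a)) powi (int n - int l))
       / real (CARD('a)) powr (real n / 2)"

lemma finite_monic_polys: "finite (monic_polys n :: 'a::{finite,field} poly set)"
proof (rule finite_subset)
  show "(monic_polys n :: 'a poly set) \<subseteq> Poly ` {xs. set xs \<subseteq> UNIV \<and> length xs = Suc n}"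
  proof
    fix f :: "'a poly" assume "f \<in> monic_polys n"
    then have "f \<noteq> 0" "degree f = n" by (auto simp: monic_polys_def)
    then have "length (coeffs f) = Suc n" by (simp add: length_coeffs)
    then show "f \<in> Poly ` {xs. set xs \<subseteq> UNIV \<and> length xs = Suc n}"
      by (intro image_eqI[of _ _ "coeffs f"]) auto
  qed
  show "finite (Poly ` {xs::'a list. set xs \<subseteq> UNIV \<and> length xs = Suc n})"
    by (intro finite_imageI finite_lists_length_eq) simp
qed

lemma irreducible_base_unique:
  fixes P Q :: "'a::{finite,field} poly"
  assumes P: "irreducible P" "lead_coeff P = 1" and Q: "irreducible Q" "lead_coeff Q = 1"
    and eq: "P ^ k = Q ^ m" and k: "k \<ge> 1"
  shows "P = Q"
proof -
  have "P dvd P ^ k" using k by (simp add: dvd_power)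
  then have "P dvd Q ^ m" using eq by simp
  moreover have "prime_elem P" using P(1) by (rule field_poly_irreducible_imp_prime)
  ultimately have PQ: "P dvd Q" by (blast intro: prime_elem_dvd_power)
  then obtain R where R: "Q = P * R" by (elim dvdE)
  have "\<not> P dvd 1" using P(1) by (auto simp: irreducible_def)
  then have "R dvd 1" using irreducibleD[OF Q(1) R] by simp
  then obtain c where c: "R = [:c:]" by (auto simp: is_unit_poly_iff)
  from R c have "lead_coeff Q = lead_coeff P * c"
    by (simp add: lead_coeff_mult)
  then have "c = 1" using P(2) Q(2) by simp
  then show ?thesis using R c by simp
qed

lemma mangoldt_power:
  fixes P :: "'a::{finite,field} poly"
  assumes P: "irreducible P" "lead_coeff P = 1" and k: "k \<ge> 1"
  shows "mangoldt (P ^ k) = degree P"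
proof -
  have "(THE Q. irreducible Q \<and> lead_coeff Q = 1 \<and> (\<exists>m\<ge>1. P ^ k = Q ^ m)) = P"
    using P k irreducible_base_unique by (intro the_equality) blast+
  then show ?thesis using P k unfolding mangoldt_def by auto
qed

end

theory Submission
  imports Defs "HOL-Algebra.Algebraic_Closure_Type" "HOL-Number_Theory.Residues"
    "Jordan_Normal_Form.Char_Poly"
begin

text \<open>
  Put \<open>q = p ^ r\<close>. Reversing the coefficients of a monic polynomial and truncating modulo
  \<open>u ^ (l + 1)\<close> gives a multiplicative map into the finite abelian group of polynomials
  \<open>1 + a\<^sub>1 u + \<dots> + a\<^sub>l u ^ l\<close> over the field with \<open>q\<close> elements, and \<open>psi n (replicate l 0)\<close>
  is the sum of the von Mangoldt function over the polynomials of degree \<open>n\<close> in the kernel of that map. Orthogonality of characters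
  writes \<open>q ^ l * psi n (replicate l 0)\<close> as the sum over all characters \<open>\<chi>\<close> of
  \<open>S\<^sub>n(\<chi>) = \<Sum> \<chi>(f) \<Lambda>(f)\<close>, where \<open>f\<close> runs over the monic polynomials of degree \<open>n\<close>.
  The trivial character contributes \<open>q ^ n\<close>. For any other character the \<open>L\<close>-function is a polynomial,
  so that \<open>S\<^sub>n(\<chi>) = - \<Sum> \<gamma> ^ n\<close> over its inverse roots \<open>\<gamma>\<close>. All multiplicities have the same
  sign, so no cancellation takes place between different characters: if the normalized error has
  period \<open>N\<close>, linear independence of the sequences \<open>\<gamma> ^ n\<close> (\<open>power_sums_eigenvalues\<close>) yields
  \<open>\<gamma> ^ N = q powr (N / 2)\<close> for every nonzero inverse root of every nontrivial character. In other words,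
  all of these \<open>L\<close>-functions are supersingular.

  Composing a character \<open>\<chi>\<^sub>0\<close> over the prime field with the norm replaces its inverse roots by their
  \<open>r\<close>-th powers (\<open>char_sum_norm\<close>), so the \<open>L\<close>-functions over the prime field are supersingular as well.
  For these, \<open>c = S\<^sub>1(\<chi>\<^sub>0) = - \<Sum> \<gamma>\<close> is \<open>sqrt p\<close> times a sum of roots of unity, and therefore \<open>c\<^sup>2 / p\<close>
  is a cyclotomic integer (\<open>square_of_sum_in_adjoin\<close>). The contradiction comes from one character for
  each \<open>p\<close> for which \<open>c\<close> is too little divisible by the prime above \<open>p\<close> (\<open>bad_character\<close>):

    \<^item> for \<open>p = 2\<close> and \<open>l \<ge> 4\<close>, the sum \<open>1 + w\<close> with a primitive eighth root of unity \<open>w\<close>;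
    \<^item> for \<open>p = 3\<close>, the sum \<open>1 + w + u / w\<close> with a primitive ninth root of unity \<open>w\<close> and \<open>u ^ 3 = 1\<close>;
    \<^item> for \<open>p = 5\<close> and \<open>l \<ge> 4\<close>, the sum \<open>1 + 4 * \<zeta>\<close> of the values \<open>\<zeta> ^ (a ^ 4)\<close> with \<open>\<zeta> ^ 5 = 1\<close>;
    \<^item> for \<open>p \<ge> 7\<close>, the cubic exponential sum of the values \<open>\<zeta> ^ (a ^ 3 + a)\<close> with \<open>\<zeta> ^ p = 1\<close>.

  In the last case the valuation with respect to \<open>\<zeta> - 1\<close> is the least \<open>j\<close> for which the binomial sum
  \<open>\<Sum> (a ^ 3 + a) choose j\<close> is nonzero modulo \<open>p\<close>. This is \<open>(p - 1) / 3\<close> or \<open>(p + 1) / 3\<close>, which is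
  less than the valuation \<open>(p - 1) / 2\<close> of \<open>sqrt p\<close>.

  Everything is carried out inside an algebraic closure, where the field with \<open>Q\<close> elements is the
  fixed set of \<open>x \<mapsto> x ^ Q\<close>. There \<open>\<Lambda>(f)\<close> counts the elements of the field with \<open>q ^ n\<close> elements whose
  characteristic polynomial over the field with \<open>q\<close> elements is \<open>f\<close>
  (\<open>card_conj_fibre_eq_mangoldt\<close>). With this description the passage between \<open>q\<close> and \<open>p\<close> is transitivity
  of the norm, and the logarithmic derivative of the \<open>L\<close>-function is a count of roots
  (\<open>newton_recurrence\<close>).
\<close>

(* In the following, degree, coeff, monom, order, prime and irreducible always refer to the
   polynomials of type 'a poly and to the type classes of commutative rings. *)
hide_const (open) module.smult Polynomials.degree Polynomials.lead_coeff up_ring.coeff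
  up_ring.monom Coset.order Divisibility.prime Divisibility.irreducible

section \<open>Power sums of complex numbers\<close>

text \<open>Linear independence of the sequences \<open>\<lambda>n. z ^ n\<close> for distinct nonzero \<open>z\<close>. In the
  difference of the two sides of the assumption, the coefficient of \<open>z ^ n\<close> is \<open>z ^ N - R\<close> times the
  multiplicity of \<open>z\<close> in the family, which is positive.\<close>

lemma power_sums_eigenvalues:
  fixes \<gamma> :: "'i \<Rightarrow> complex"
  assumes fin: "finite I" and i: "i \<in> I" "\<gamma> i \<noteq> 0"
    and eq: "\<And>n. n \<ge> 1 \<Longrightarrow> (\<Sum>i\<in>I. \<gamma> i ^ (n + N)) = R * (\<Sum>i\<in>I. \<gamma> i ^ n)"
  shows "\<gamma> i ^ N = R"
proof -
  define z where "z = \<gamma> i"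
  \<comment> \<open>\<open>P\<close> vanishes at all members of the family except \<open>z\<close>; its factor \<open>X\<close> avoids the exponent \<open>0\<close>\<close>
  define P where "P = [:0, 1:] * (\<Prod>w\<in>\<gamma> ` I - {z}. [:-w, 1:])"
  have P0: "coeff P 0 = 0"
    by (simp add: P_def)
  have lin: "(\<Sum>i\<in>I. (\<gamma> i ^ N - R) * \<gamma> i ^ n) = 0" if "n \<ge> 1" for n
    using eq[OF that] by (simp add: algebra_simps power_add sum_subtractf sum_distrib_left)
  have "(\<Sum>i\<in>I. (\<gamma> i ^ N - R) * poly P (\<gamma> i))
      = (\<Sum>n\<le>degree P. coeff P n * (\<Sum>i\<in>I. (\<gamma> i ^ N - R) * \<gamma> i ^ n))"
    unfolding poly_altdef sum_distrib_left
    by (subst sum.swap) (simp add: mult_ac)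
  also have "\<dots> = 0"
  proof (rule sum.neutral, safe)
    fix n
    show "coeff P n * (\<Sum>i\<in>I. (\<gamma> i ^ N - R) * \<gamma> i ^ n) = 0"
      using lin[of n] P0 by (cases "n = 0") auto
  qed
  also have "(\<Sum>i\<in>I. (\<gamma> i ^ N - R) * poly P (\<gamma> i)) = (\<Sum>i\<in>{i\<in>I. \<gamma> i = z}. (z ^ N - R) * poly P z)"
  proof (rule sum.mono_neutral_cong_right)
    show "\<forall>i\<in>I - {i \<in> I. \<gamma> i = z}. (\<gamma> i ^ N - R) * poly P (\<gamma> i) = 0"
    proof
      fix k assume k: "k \<in> I - {i \<in> I. \<gamma> i = z}"
      have "(\<Prod>w\<in>\<gamma> ` I - {z}. poly [:-w, 1:] (\<gamma> k)) = 0"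
        by (rule prod_zero) (use fin k in auto)
      then show "(\<gamma> k ^ N - R) * poly P (\<gamma> k) = 0"
        by (simp add: P_def poly_prod)
    qed
  qed (use fin in auto)
  also have "\<dots> = of_nat (card {i\<in>I. \<gamma> i = z}) * ((z ^ N - R) * poly P z)"
    by simp
  finally have "of_nat (card {i\<in>I. \<gamma> i = z}) * ((z ^ N - R) * poly P z) = 0" .
  moreover have "card {i\<in>I. \<gamma> i = z} \<noteq> 0"
    using fin i by (auto simp: z_def)
  moreover have "poly P z \<noteq> 0"
    using fin i by (auto simp: P_def poly_prod z_def)
  ultimately show ?thesis
    by (simp add: z_def)
qed

lemma fps_log_deriv_prod:
  fixes xs :: "complex list"
  defines "F \<equiv> fps_of_poly (\<Prod>x\<leftarrow>xs. [:1, -x:])"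
  shows "fps_X * fps_deriv F = - F * Abs_fps (\<lambda>n. if n = 0 then 0 else (\<Sum>x\<leftarrow>xs. x ^ n))"
  unfolding F_def
proof (induction xs)
  case Nil
  show ?case by (simp add: fps_eq_iff)
next
  case (Cons a xs)
  let ?F = "fps_of_poly (\<Prod>x\<leftarrow>xs. [:1, -x:])"
  let ?T = "\<lambda>xs. Abs_fps (\<lambda>n. if n = 0 then 0 else (\<Sum>x\<leftarrow>xs. x ^ n)) :: complex fps"
  let ?G = "Abs_fps (\<lambda>n. if n = 0 then 0 else a ^ n)"
  let ?u = "1 - fps_const a * fps_X"
  have u: "fps_of_poly [:1, -a:] = ?u"
    by (simp add: fps_of_poly_pCons fps_eq_iff fps_X_def)
  have G: "?u * ?G = fps_const a * fps_X"
  proof (rule fps_ext)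
    fix n
    have "fps_nth (?u * ?G) n = fps_nth ?G n - a * fps_nth (fps_X * ?G) n"
      by (simp add: algebra_simps)
    then show "fps_nth (?u * ?G) n = fps_nth (fps_const a * fps_X) n"
      by (cases n) auto
  qed
  have T: "?T (a # xs) = ?G + ?T xs"
    by (simp add: fps_eq_iff)
  have "fps_X * fps_deriv (?u * ?F) = ?u * (fps_X * fps_deriv ?F) - ?F * (fps_const a * fps_X)"
    by (simp add: algebra_simps)
  also have "\<dots> = - (?u * ?F) * ?T xs - ?F * (?u * ?G)"
    unfolding Cons.IH G by (simp add: algebra_simps)
  also have "\<dots> = - (?u * ?F) * ?T (a # xs)"
    unfolding T by (simp add: algebra_simps)
  finally have "fps_X * fps_deriv (?u * ?F) = - (?u * ?F) * ?T (a # xs)" .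
  moreover have "fps_of_poly (\<Prod>x\<leftarrow>a # xs. [:1, -x:]) = ?u * ?F"
    by (simp only: list.map prod_list.Cons fps_of_poly_mult u)
  ultimately show ?case by (simp only:)
qed

text \<open>The recurrence says that \<open>\<Sum> S n * u ^ n\<close> is \<open>u\<close> times the logarithmic derivative of the polynomial
  \<open>\<Sum> A n * u ^ n\<close>. The recurrence determines \<open>S\<close>, and the negated power sums of the inverse roots of
  that polynomial satisfy it. Since \<open>P\<close> below is padded to degree \<open>l\<close>, some of the \<open>\<gamma> i\<close> may be \<open>0\<close>.\<close>

lemma power_sums_of_newton_recurrence:
  fixes A S :: "nat \<Rightarrow> complex"
  assumes A0: "A 0 = 1" and A_large: "\<And>n. n \<ge> l \<Longrightarrow> A n = 0"
    and rec: "\<And>n. n \<ge> 1 \<Longrightarrow> of_nat n * A n = (\<Sum>k=1..n. S k * A (n - k))"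
  obtains d \<gamma> where "\<And>n. n \<ge> 1 \<Longrightarrow> S n = - (\<Sum>i<(d::nat). \<gamma> i ^ n)"
proof -
  define P where "P = (\<Sum>n\<le>l. monom (A n) (l - n))"
  have coeff_P: "coeff P m = (if m \<le> l then A (l - m) else 0)" for m
  proof -
    have "coeff P m = (\<Sum>n\<le>l. if n = l - m \<and> m \<le> l then A n else 0)"
      unfolding P_def coeff_sum by (intro sum.cong) auto
    also have "\<dots> = (if m \<le> l then A (l - m) else 0)"
      by (cases "m \<le> l") (simp_all add: sum.delta)
    finally show ?thesis .
  qed
  have degP: "degree P = l"
  proof (rule antisym)
    show "degree P \<le> l" by (rule degree_le) (simp add: coeff_P)
    show "l \<le> degree P" by (rule le_degree) (simp add: coeff_P A0)
  qed
  have "P \<noteq> 0" using coeff_P[of l] A0 by auto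
  then obtain B where B: "P = smult (lead_coeff P) (\<Prod>x\<in>#B. [:-x, 1:])"
    using alg_closed_imp_factorization by blast
  obtain xs where xs: "mset xs = B" using ex_mset by blast
  have P: "P = (\<Prod>x\<leftarrow>xs. [:-x, 1:])"
    using B unfolding xs[symmetric] by (simp add: degP coeff_P A0 prod_mset_prod_list[symmetric] flip: mset_map)
  define L where "L = (\<Prod>x\<leftarrow>xs. [:1, -x:])"
  have refl: "reflect_poly [:-x, 1:] = [:1, -x:]" for x :: complex
    by (simp add: reflect_poly_def Poly_append)
  have "reflect_poly P = L"
    unfolding P L_def by (simp add: reflect_poly_prod_list refl o_def)
  then have coeff_L: "coeff L n = A n" for n
    using A_large[of n] by (auto simp: coeff_reflect_poly degP coeff_P simp flip: \<open>reflect_poly P = L\<close>)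
  define T where "T = (\<lambda>n. \<Sum>x\<leftarrow>xs. x ^ n)"
  have recT: "of_nat n * A n = - (\<Sum>k=1..n. T k * A (n - k))" if n: "n \<ge> 1" for n
  proof -
    have "of_nat n * A n = fps_nth (fps_X * fps_deriv (fps_of_poly L)) n"
      using n by (cases n) (auto simp: coeff_L)
    also have "\<dots> = - (\<Sum>k=0..n. A k * (if n - k = 0 then 0 else T (n - k)))"
      unfolding L_def fps_log_deriv_prod
      by (simp add: fps_mult_nth sum_negf L_def[symmetric] coeff_L T_def cong: if_cong)
    also have "(\<Sum>k=0..n. A k * (if n - k = 0 then 0 else T (n - k)))
        = (\<Sum>k=0..n. A (n - k) * (if k = 0 then 0 else T k))"
      by (rule sum.reindex_bij_witness[of _ "\<lambda>k. n - k" "\<lambda>k. n - k"]) auto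
    also have "\<dots> = (\<Sum>k=1..n. T k * A (n - k))"
      by (rule sum.mono_neutral_cong_right) auto
    finally show ?thesis .
  qed
  have "S n = - T n" if "n \<ge> 1" for n
    using that
  proof (induction n rule: less_induct)
    case (less n)
    have split: "(\<Sum>k=1..n. f k * A (n - k)) = f n + (\<Sum>k=1..<n. f k * A (n - k))" for f
    proof -
      have "{1..n} = insert n {1..<n}" using less.prems by auto
      then show ?thesis by (simp add: A0)
    qed
    have "(\<Sum>k=1..<n. S k * A (n - k)) = - (\<Sum>k=1..<n. T k * A (n - k))"
      unfolding sum_negf[symmetric] by (rule sum.cong) (auto simp: less.IH)
    moreover have "(\<Sum>k=1..n. S k * A (n - k)) = - (\<Sum>k=1..n. T k * A (n - k))"
      using rec[OF less.prems] recT[OF less.prems] by simp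
    ultimately show ?case
      unfolding split by simp
  qed
  then have "S n = - (\<Sum>i<length xs. (xs ! i) ^ n)" if "n \<ge> 1" for n
    using that by (simp add: T_def sum_list_sum_nth atLeast0LessThan)
  then show thesis by (rule that)
qed

section \<open>Characters of finite abelian groups\<close>

lemma nontrivial_root_of_unity:
  assumes "k > 1"
  obtains w :: complex where "w ^ k = 1" "w \<noteq> 1"
proof (rule that[of "cis (2 * pi / real k)"])
  show "cis (2 * pi / real k) ^ k = 1" using assms by (simp add: DeMoivre)
  show "cis (2 * pi / real k) \<noteq> 1"
  proof
    assume "cis (2 * pi / real k) = 1"
    then have "cos (2 * pi / real k) = 1" by (simp add: complex_eq_iff)
    then obtain x :: int where "2 * pi / real k = of_int x * 2 * pi"
      by (auto simp: cos_one_2pi_int)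
    then have "1 = of_int x * real k" using assms by (simp add: field_simps)
    then have "1 = x * int k" by (metis of_int_1 of_int_eq_iff of_int_mult of_int_of_nat_eq)
    then have "int k dvd 1" by (metis dvd_triv_right)
    then show False using assms by simp
  qed
qed

text \<open>The restriction of \<open>\<chi>\<close> to the subgroup \<open>H\<close> is a homomorphism to the multiplicative group of the
  complex numbers. Nothing is assumed about the values of \<open>\<chi>\<close> outside of \<open>H\<close>.\<close>

definition group_character :: "('a, 'b) monoid_scheme \<Rightarrow> 'a set \<Rightarrow> ('a \<Rightarrow> complex) \<Rightarrow> bool" where
  "group_character G H \<chi> \<longleftrightarrow>
     (\<forall>x\<in>H. \<forall>y\<in>H. \<chi> (x \<otimes>\<^bsub>G\<^esub> y) = \<chi> x * \<chi> y) \<and> \<chi> \<one>\<^bsub>G\<^esub> = 1"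

lemma group_character_mult:
  "group_character G H \<chi> \<Longrightarrow> x \<in> H \<Longrightarrow> y \<in> H \<Longrightarrow> \<chi> (x \<otimes>\<^bsub>G\<^esub> y) = \<chi> x * \<chi> y"
  by (simp add: group_character_def)

lemma group_character_one: "group_character G H \<chi> \<Longrightarrow> \<chi> \<one>\<^bsub>G\<^esub> = 1"
  by (simp add: group_character_def)

lemma (in comm_group) subgroup_pow_closed:
  assumes "subgroup H G" "x \<in> H"
  shows "x [^] (n::nat) \<in> H"
  using assms by (induction n) (auto simp: subgroup.one_closed subgroup.m_closed)

lemma (in comm_group) group_character_pow:
  assumes "group_character G H \<chi>" "subgroup H G" "x \<in> H"
  shows "\<chi> (x [^] (n::nat)) = \<chi> x ^ n"
  using assms
  by (induction n) (auto simp: group_character_one group_character_mult subgroup_pow_closed)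

lemma (in comm_group) group_character_nonzero:
  assumes "group_character G H \<chi>" "subgroup H G" "x \<in> H"
  shows "\<chi> x \<noteq> 0"
proof
  assume "\<chi> x = 0"
  moreover have "\<chi> (x \<otimes> inv x) = \<chi> x * \<chi> (inv x)"
    using assms by (intro group_character_mult) (auto intro: subgroup.m_inv_closed)
  ultimately show False
    using assms group_character_one[OF assms(1)] subgroup.mem_carrier[OF assms(2,3)] by simp
qed

text \<open>A character extends from \<open>H\<close> to the subgroup generated by \<open>H\<close> and \<open>g\<close>, with any value \<open>w\<close> at \<open>g\<close>
  whose \<open>k\<close>-th power is as prescribed, where \<open>k\<close> is the order of \<open>g\<close> modulo \<open>H\<close>.\<close>

lemma (in comm_group) character_extend_step:
  assumes H: "subgroup H G" and \<chi>: "group_character G H \<chi>"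
    and g: "g \<in> carrier G" and k: "k > 0" "g [^] (k::nat) \<in> H"
    and kmin: "\<And>i. 0 < i \<Longrightarrow> i < k \<Longrightarrow> g [^] i \<notin> H"
    and w: "w ^ k = \<chi> (g [^] k)"
  obtains H' \<chi>' where "subgroup H' G" "group_character G H' \<chi>'" "H \<subseteq> H'" "g \<in> H'" "\<chi>' g = w"
    "\<And>x. x \<in> H \<Longrightarrow> \<chi>' x = \<chi> x"
proof -
  have HG: "x \<in> carrier G" if "x \<in> H" for x
    using subgroup.mem_carrier[OF H that] .
  note Hm = subgroup.m_closed[OF H] and Hi = subgroup.m_inv_closed[OF H]
    and H1 = subgroup.one_closed[OF H]
  have pow: "\<exists>t. i = k * t \<and> \<chi> (g [^] i) = w ^ i" if i: "g [^] i \<in> H" for i :: nat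
  proof -
    define t where "t = i div k"
    have "g [^] i = (g [^] k) [^] t \<otimes> g [^] (i mod k)"
      using g by (simp add: nat_pow_pow nat_pow_mult t_def)
    then have "g [^] (i mod k) = inv ((g [^] k) [^] t) \<otimes> g [^] i"
      using g by (simp add: m_assoc[symmetric] l_inv)
    also have "\<dots> \<in> H"
      by (rule Hm[OF Hi[OF subgroup_pow_closed[OF H k(2)]] i])
    finally have "i mod k = 0"
      using kmin[of "i mod k"] k(1) by (cases "i mod k = 0") auto
    then have it: "i = k * t"
      by (auto simp: t_def)
    have "\<chi> (g [^] i) = \<chi> ((g [^] k) [^] t)"
      using g by (simp add: it nat_pow_pow)
    also have "\<dots> = \<chi> (g [^] k) ^ t"
      by (rule group_character_pow[OF \<chi> H k(2)])
    also have "\<dots> = w ^ i"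
      by (simp add: w[symmetric] it power_mult)
    finally show ?thesis using it by blast
  qed
  have w0: "w \<noteq> 0"
    using w k group_character_nonzero[OF \<chi> H k(2)] by (auto simp: power_0_left)
  have wd_le: "\<chi> x * w ^ i = \<chi> y * w ^ j"
    if x: "x \<in> H" and y: "y \<in> H" and eq: "x \<otimes> g [^] i = y \<otimes> g [^] j" and ij: "i \<le> j"
    for x y and i j :: nat
  proof -
    have "x \<otimes> g [^] i = (y \<otimes> g [^] (j - i)) \<otimes> g [^] i"
      using eq ij g HG[OF y] by (simp add: m_assoc nat_pow_mult)
    then have xy: "x = y \<otimes> g [^] (j - i)"
      using g HG[OF x] HG[OF y] by (simp add: r_cancel)
    then have "g [^] (j - i) = inv y \<otimes> x"
      using g HG[OF y] by (simp add: m_assoc[symmetric] l_inv)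
    then have gH: "g [^] (j - i) \<in> H"
      using Hm Hi x y by simp
    have "\<chi> x = \<chi> y * w ^ (j - i)"
      using pow[OF gH] group_character_mult[OF \<chi> y gH] xy by auto
    then show ?thesis
      using ij by (simp add: mult.assoc flip: power_add)
  qed
  have wd: "\<chi> x * w ^ i = \<chi> y * w ^ j"
    if "x \<in> H" "y \<in> H" "x \<otimes> g [^] i = y \<otimes> g [^] j"
    for x y and i j :: nat
    using wd_le[of x y i j] wd_le[of y x j i] that by (cases "i \<le> j") auto
  define H' where "H' = {x \<otimes> g [^] i | x i. x \<in> H \<and> i \<in> (UNIV :: nat set)}"
  define \<chi>' where "\<chi>' = (\<lambda>z. SOME c. \<exists>x i. x \<in> H \<and> z = x \<otimes> g [^] (i::nat) \<and> c = \<chi> x * w ^ i)"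
  have \<chi>': "\<chi>' (x \<otimes> g [^] i) = \<chi> x * w ^ i" if x: "x \<in> H" for x and i :: nat
  proof -
    let ?Q = "\<lambda>c. \<exists>y j. y \<in> H \<and> x \<otimes> g [^] i = y \<otimes> g [^] (j::nat) \<and> c = \<chi> y * w ^ j"
    have "?Q (\<chi> x * w ^ i)" using x by blast
    then have "?Q (\<chi>' (x \<otimes> g [^] i))"
      unfolding \<chi>'_def by (rule someI)
    then obtain y and j :: nat where y: "y \<in> H" "x \<otimes> g [^] i = y \<otimes> g [^] j"
      "\<chi>' (x \<otimes> g [^] i) = \<chi> y * w ^ j" by blast
    show ?thesis unfolding y(3) by (rule wd[OF x y(1,2), symmetric])
  qed
  have mult: "(x \<otimes> g [^] i) \<otimes> (y \<otimes> g [^] j) = (x \<otimes> y) \<otimes> g [^] (i + j)"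
    if "x \<in> H" "y \<in> H" for x y and i j :: nat
    using that HG g by (simp add: nat_pow_mult[symmetric] m_ac)
  have sub: "x \<in> H \<Longrightarrow> x \<in> H'" for x
    unfolding H'_def using HG[of x] by (auto intro!: exI[of _ x] exI[of _ 0])
  have gH': "g \<in> H'"
    unfolding H'_def using g H1 by (auto intro!: exI[of _ \<one>] exI[of _ 1])
  show thesis
  proof (rule that[of H' \<chi>'])
    show "subgroup H' G"
    proof
      show "H' \<subseteq> carrier G" using HG g by (auto simp: H'_def)
      show "x \<otimes> y \<in> H'" if xy: "x \<in> H'" "y \<in> H'" for x y
      proof -
        from xy obtain a b and i j :: nat where
          ab: "x = a \<otimes> g [^] i" "y = b \<otimes> g [^] j" "a \<in> H" "b \<in> H"
          by (auto simp: H'_def)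
        then have "x \<otimes> y = (a \<otimes> b) \<otimes> g [^] (i + j)" by (simp add: mult)
        then show ?thesis using Hm[OF ab(3,4)] by (auto simp: H'_def)
      qed
      show "\<one> \<in> H'" using sub H1 by blast
      show "inv z \<in> H'" if "z \<in> H'" for z
      proof -
        from that obtain x i where z: "z = x \<otimes> g [^] (i::nat)" "x \<in> H"
          by (auto simp: H'_def)
        \<comment> \<open>the inverse of \<open>g [^] i\<close> is \<open>inv (g [^] (k * i)) \<otimes> g [^] ((k - 1) * i)\<close>\<close>
        define y where "y = inv x \<otimes> inv ((g [^] k) [^] i)"
        have y: "y \<in> H" unfolding y_def
          by (intro Hm Hi subgroup_pow_closed H z k)
        have "z \<otimes> (y \<otimes> g [^] ((k - 1) * i)) = (x \<otimes> y) \<otimes> g [^] (i + (k - 1) * i)"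
          unfolding z(1) by (rule mult[OF z(2) y])
        also have "i + (k - 1) * i = k * i"
          using k(1) by (cases k) auto
        also have "(x \<otimes> y) \<otimes> g [^] (k * i) = \<one>"
          unfolding y_def using HG[OF z(2)] g by (simp add: nat_pow_pow m_assoc[symmetric])
        finally have "inv z = y \<otimes> g [^] ((k - 1) * i)"
          using z HG y g by (intro inv_equality) (auto simp: m_comm)
        then show ?thesis using y by (auto simp: H'_def)
      qed
    qed
    have "\<chi>' (a \<otimes> b) = \<chi>' a * \<chi>' b" if "a \<in> H'" "b \<in> H'" for a b
      using that unfolding H'_def
      by (auto simp: mult \<chi>' Hm group_character_mult[OF \<chi>] power_add)
    moreover have "\<chi>' \<one> = 1"
      using \<chi>'[of \<one> 0] H1 group_character_one[OF \<chi>] by simp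
    ultimately show "group_character G H' \<chi>'"
      by (simp add: group_character_def)
    show "\<chi>' g = w"
      using \<chi>'[of \<one> 1] H1 group_character_one[OF \<chi>] g by simp
    show "\<chi>' x = \<chi> x" if "x \<in> H" for x
      using \<chi>'[of x 0] that HG[OF that] by simp
  qed (use sub gH' in auto)
qed

lemma (in comm_group) character_extend:
  assumes "finite (carrier G)" "subgroup H G" "group_character G H \<chi>"
  shows "\<exists>\<chi>'. group_character G (carrier G) \<chi>' \<and> (\<forall>x\<in>H. \<chi>' x = \<chi> x)"
  using assms(2,3)
proof (induction "card (carrier G) - card H" arbitrary: H \<chi> rule: less_induct)
  case less
  show ?case
  proof (cases "H = carrier G")
    case True
    then show ?thesis using less.prems by auto
  next
    case False
    have Hsub: "H \<subseteq> carrier G" using less.prems(1) by (rule subgroup.subset)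
    then obtain g where g: "g \<in> carrier G" "g \<notin> H" using False by blast
    define k where "k = (LEAST k. 0 < k \<and> g [^] (k::nat) \<in> H)"
    have ex: "0 < Coset.order G \<and> g [^] Coset.order G \<in> H"
      using g assms(1) less.prems(1) order_gt_0_iff_finite
      by (simp add: pow_order_eq_1 subgroup.one_closed)
    have k: "0 < k \<and> g [^] k \<in> H"
      unfolding k_def by (rule LeastI[of _ "Coset.order G"]) (rule ex)
    have kmin: "g [^] i \<notin> H" if "0 < i" "i < k" for i
      using not_less_Least[OF that(2)[unfolded k_def]] that(1) by blast
    obtain w where "w ^ k = \<chi> (g [^] k)"
      using nth_root_exists k by blast
    with g k kmin less.prems obtain H' \<chi>' where H': "subgroup H' G" "group_character G H' \<chi>'"
      "H \<subseteq> H'" "g \<in> H'" "\<And>x. x \<in> H \<Longrightarrow> \<chi>' x = \<chi> x"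
      using character_extend_step[of H \<chi> g k w] by metis
    have H'sub: "H' \<subseteq> carrier G" using H'(1) by (rule subgroup.subset)
    have "card H < card H'"
      using H'(3,4) g(2) finite_subset[OF H'sub assms(1)] by (intro psubset_card_mono) auto
    moreover have "card H' \<le> card (carrier G)"
      using H'sub assms(1) by (rule card_mono[rotated])
    ultimately have "card (carrier G) - card H' < card (carrier G) - card H" by linarith
    from less.hyps[OF this H'(1,2)] obtain \<chi>'' where
      "group_character G (carrier G) \<chi>''" "\<forall>x\<in>H'. \<chi>'' x = \<chi>' x" by blast
    then show ?thesis using H'(3,5) by (intro exI[of _ \<chi>'']) auto
  qed
qed

lemma (in comm_group) character_with_value:
  assumes fin: "finite (carrier G)" and g: "g \<in> carrier G" and k: "k > 0" "g [^] (k::nat) = \<one>"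
    and kmin: "\<And>i. 0 < i \<Longrightarrow> i < k \<Longrightarrow> g [^] i \<noteq> \<one>"
    and w: "w ^ k = 1"
  obtains \<chi> where "group_character G (carrier G) \<chi>" "\<chi> g = w"
proof -
  have 1: "subgroup {\<one>} G" by (rule triv_subgroup)
  have 2: "group_character G {\<one>} (\<lambda>_. 1)" by (simp add: group_character_def)
  have 3: "g [^] k \<in> {\<one>}" "\<And>i. 0 < i \<Longrightarrow> i < k \<Longrightarrow> g [^] i \<notin> {\<one>}"
    using k kmin by auto
  obtain H' \<chi>' where H': "subgroup H' G" "group_character G H' \<chi>'" "g \<in> H'" "\<chi>' g = w"
    using character_extend_step[OF 1 2 g k(1) 3 w] by metis
  from character_extend[OF fin H'(1,2)] H'(3,4) show thesis
    using that by auto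
qed

text \<open>The dual group. Characters take the value \<open>undefined\<close> outside of the carrier, so that this set is
  finite for a finite group.\<close>

definition characters :: "('a, 'b) monoid_scheme \<Rightarrow> ('a \<Rightarrow> complex) set" where
  "characters G = {\<chi> \<in> extensional (carrier G). group_character G (carrier G) \<chi>}"

lemma (in comm_group) restrict_character:
  "group_character G (carrier G) \<chi> \<Longrightarrow> restrict \<chi> (carrier G) \<in> characters G"
  by (auto simp: characters_def group_character_def)

lemma (in comm_group) finite_characters:
  assumes "finite (carrier G)"
  shows "finite (characters G)"
proof (rule finite_subset)
  show "characters G \<subseteq> (carrier G \<rightarrow>\<^sub>E {z. z ^ Coset.order G = 1})"
  proof
    fix \<chi> assume "\<chi> \<in> characters G"
    then have \<chi>: "\<chi> \<in> extensional (carrier G)" "group_character G (carrier G) \<chi>"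
      by (auto simp: characters_def)
    have "\<chi> x ^ Coset.order G = 1" if "x \<in> carrier G" for x
      using group_character_pow[OF \<chi>(2) subgroup_self that, of "Coset.order G"]
        group_character_one[OF \<chi>(2)] that by (simp add: pow_order_eq_1)
    then show "\<chi> \<in> (carrier G \<rightarrow>\<^sub>E {z. z ^ Coset.order G = 1})"
      using \<chi>(1) by (auto simp: PiE_def)
  qed
  have "Coset.order G > 0" using assms order_gt_0_iff_finite by blast
  then show "finite (carrier G \<rightarrow>\<^sub>E {z::complex. z ^ Coset.order G = 1})"
    using assms by (intro finite_PiE) (auto intro: finite_roots_unity)
qed

lemma (in comm_group) sum_character_eq_0:
  assumes fin: "finite (carrier G)" and \<chi>: "group_character G (carrier G) \<chi>"
    and g: "g \<in> carrier G" "\<chi> g \<noteq> 1"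
  shows "(\<Sum>x\<in>carrier G. \<chi> x) = 0"
proof -
  have "(\<Sum>x\<in>carrier G. \<chi> x) = (\<Sum>x\<in>carrier G. \<chi> (g \<otimes> x))"
    by (rule sum.reindex_bij_witness[of _ "\<lambda>x. g \<otimes> x" "\<lambda>x. inv g \<otimes> x"])
       (use g in \<open>auto simp: m_assoc[symmetric]\<close>)
  also have "\<dots> = \<chi> g * (\<Sum>x\<in>carrier G. \<chi> x)"
    using g \<chi> by (simp add: sum_distrib_left group_character_mult)
  finally show ?thesis using g(2) by simp
qed

lemma (in comm_group) sum_characters_eq_0:
  assumes fin: "finite (carrier G)" and g: "g \<in> carrier G" "g \<noteq> \<one>"
  shows "(\<Sum>\<chi>\<in>characters G. \<chi> g) = 0"
proof -
  define k where "k = (LEAST k. 0 < k \<and> g [^] (k::nat) = \<one>)"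
  have ex: "0 < Coset.order G \<and> g [^] Coset.order G = \<one>"
    using g fin order_gt_0_iff_finite by (simp add: pow_order_eq_1)
  have k: "0 < k \<and> g [^] k = \<one>"
    unfolding k_def by (rule LeastI[of _ "Coset.order G"]) (rule ex)
  have kmin: "g [^] i \<noteq> \<one>" if "0 < i" "i < k" for i
    using not_less_Least[OF that(2)[unfolded k_def]] that(1) by blast
  have "k \<noteq> 1" using k g by auto
  then have k1: "k > 1" using k by simp
  obtain w :: complex where wk: "w ^ k = 1" and w1: "w \<noteq> 1"
    using nontrivial_root_of_unity[OF k1] .
  obtain \<psi> where \<psi>: "group_character G (carrier G) \<psi>" "\<psi> g = w"
    using character_with_value[OF fin g(1), of k w] k kmin wk by blast
  define mul where "mul = (\<lambda>\<theta> \<chi>. restrict (\<lambda>x. \<theta> x * \<chi> x :: complex) (carrier G))"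
  have nz: "\<psi> x \<noteq> 0" if "x \<in> carrier G" for x
    using group_character_nonzero[OF \<psi>(1) subgroup_self that] .
  have "(\<Sum>\<chi>\<in>characters G. \<chi> g) = (\<Sum>\<chi>\<in>characters G. mul \<psi> \<chi> g)"
  proof (rule sum.reindex_bij_witness[of _ "mul \<psi>" "mul (\<lambda>x. inverse (\<psi> x))"])
    fix \<chi> assume \<chi>: "\<chi> \<in> characters G"
    show "mul \<psi> (mul (\<lambda>x. inverse (\<psi> x)) \<chi>) = \<chi>" "mul (\<lambda>x. inverse (\<psi> x)) (mul \<psi> \<chi>) = \<chi>"
      using \<chi> nz by (auto simp: mul_def characters_def fun_eq_iff restrict_def extensional_def)
    show "mul \<psi> \<chi> \<in> characters G" "mul (\<lambda>x. inverse (\<psi> x)) \<chi> \<in> characters G"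
      using \<chi> \<psi>(1) by (auto simp: mul_def characters_def group_character_def)
    show "mul \<psi> (mul (\<lambda>x. inverse (\<psi> x)) \<chi>) g = \<chi> g"
      using g nz by (auto simp: mul_def)
  qed
  also have "\<dots> = w * (\<Sum>\<chi>\<in>characters G. \<chi> g)"
    using g \<psi>(2) by (simp add: mul_def sum_distrib_left)
  finally show ?thesis using w1 by simp
qed

text \<open>Orthogonality. Summing over \<open>g\<close> as well shows that there are as many characters as group elements.\<close>

lemma (in comm_group) sum_characters:
  assumes fin: "finite (carrier G)" and g: "g \<in> carrier G"
  shows "(\<Sum>\<chi>\<in>characters G. \<chi> g) = (if g = \<one> then of_nat (Coset.order G) else 0)"
proof -
  define \<epsilon> where "\<epsilon> = restrict (\<lambda>_. 1 :: complex) (carrier G)"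
  have \<epsilon>: "\<epsilon> \<in> characters G"
    by (auto simp: \<epsilon>_def characters_def group_character_def)
  have one: "\<chi> \<one> = 1" if "\<chi> \<in> characters G" for \<chi>
    using that by (auto simp: characters_def group_character_def)
  have sum_one: "(\<Sum>\<chi>\<in>characters G. \<chi> \<one>) = of_nat (card (characters G))"
    using sum.cong[OF refl one, of "characters G"] by simp
  have "of_nat (card (characters G)) = (\<Sum>g\<in>carrier G. \<Sum>\<chi>\<in>characters G. \<chi> g)"
  proof -
    have "(\<Sum>g\<in>carrier G. \<Sum>\<chi>\<in>characters G. \<chi> g)
        = (\<Sum>g\<in>carrier G. if g = \<one> then of_nat (card (characters G)) else 0)"
      using sum_characters_eq_0[OF fin] sum_one by (intro sum.cong) auto
    then show ?thesis using fin by simp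
  qed
  also have "\<dots> = (\<Sum>\<chi>\<in>characters G. \<Sum>g\<in>carrier G. \<chi> g)"
    by (rule sum.swap)
  also have "\<dots> = (\<Sum>\<chi>\<in>characters G. if \<chi> = \<epsilon> then of_nat (Coset.order G) else 0)"
  proof (rule sum.cong[OF refl])
    fix \<chi> assume \<chi>: "\<chi> \<in> characters G"
    show "(\<Sum>g\<in>carrier G. \<chi> g) = (if \<chi> = \<epsilon> then of_nat (Coset.order G) else 0)"
    proof (cases "\<chi> = \<epsilon>")
      case True
      then show ?thesis by (simp add: \<epsilon>_def Coset.order_def)
    next
      case False
      then obtain x where "x \<in> carrier G" "\<chi> x \<noteq> 1"
        using \<chi> by (auto simp: \<epsilon>_def characters_def fun_eq_iff restrict_def extensional_def split: if_splits)
      then show ?thesis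
        using sum_character_eq_0[OF fin, of \<chi> x] \<chi> False by (simp add: characters_def)
    qed
  qed
  also have "\<dots> = of_nat (Coset.order G)"
    using \<epsilon> finite_characters[OF fin] by simp
  finally have card: "(of_nat (card (characters G)) :: complex) = of_nat (Coset.order G)" .
  show ?thesis
    using sum_characters_eq_0[OF fin g] card sum_one by auto
qed

lemma (in comm_group) character_of_prime_power_order:
  assumes fin: "finite (carrier G)" and g: "g \<in> carrier G" and p: "prime (p::nat)"
    and ord: "g [^] (p ^ Suc k) = \<one>" "g [^] (p ^ k) \<noteq> \<one>" and w: "w ^ (p ^ Suc k) = 1"
  obtains \<chi> where "group_character G (carrier G) \<chi>" "\<chi> g = w"
proof -
  have kmin: "g [^] i \<noteq> \<one>" if i: "0 < i" "i < p ^ Suc k" for i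
  proof
    assume "g [^] i = \<one>"
    then have oi: "ord g dvd i" using g by (simp add: pow_eq_id)
    have "ord g dvd p ^ Suc k" using ord(1) g by (simp only: pow_eq_id)
    then obtain j where j: "j \<le> Suc k" "ord g = p ^ j" using divides_primepow_nat[OF p] by blast
    have "j \<noteq> Suc k" using oi i j(2) by (auto dest: dvd_imp_le)
    then have "ord g dvd p ^ k" unfolding j(2) using j(1) by (intro le_imp_power_dvd) auto
    then show False using ord(2) g by (simp add: pow_eq_id)
  qed
  show thesis
    using character_with_value[OF fin g _ ord(1) kmin w] prime_gt_0_nat[OF p] that by auto
qed

section \<open>Divisibility in rings of cyclotomic integers\<close>

text \<open>The ring generated by \<open>z\<close> over the integers, as the set of values at \<open>z\<close> of integer polynomials.\<close>

definition int_adjoin :: "complex \<Rightarrow> complex set" where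
  "int_adjoin z = range (\<lambda>P :: int poly. poly (map_poly of_int P) z)"

lemma map_poly_of_int_add: "map_poly of_int (P + Q) = (map_poly of_int P + map_poly of_int Q :: complex poly)"
  by (rule poly_eqI) (simp add: coeff_map_poly)

lemma map_poly_of_int_mult: "map_poly of_int (P * Q) = (map_poly of_int P * map_poly of_int Q :: complex poly)"
  by (rule poly_eqI) (simp add: coeff_map_poly coeff_mult)

lemma int_adjoin_of_int [intro, simp]: "of_int a \<in> int_adjoin z"
  unfolding int_adjoin_def by (rule image_eqI[of _ _ "[:a:]"]) (simp_all add: poly_altdef coeff_map_poly degree_map_poly)

lemma int_adjoin_simps [intro, simp]: "0 \<in> int_adjoin z" "1 \<in> int_adjoin z"
  "of_nat n \<in> int_adjoin z" "numeral w \<in> int_adjoin z"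
  using int_adjoin_of_int[of 0 z] int_adjoin_of_int[of 1 z] int_adjoin_of_int[of "int n" z]
    int_adjoin_of_int[of "numeral w" z] by simp_all

lemma int_adjoin_self [intro, simp]: "z \<in> int_adjoin z"
  unfolding int_adjoin_def by (rule image_eqI[of _ _ "[:0,1:]"]) (auto simp: map_poly_pCons)

lemma int_adjoin_add [intro]: "x \<in> int_adjoin z \<Longrightarrow> y \<in> int_adjoin z \<Longrightarrow> x + y \<in> int_adjoin z"
  unfolding int_adjoin_def by (auto simp flip: poly_add map_poly_of_int_add)

lemma int_adjoin_mult [intro]: "x \<in> int_adjoin z \<Longrightarrow> y \<in> int_adjoin z \<Longrightarrow> x * y \<in> int_adjoin z"
  unfolding int_adjoin_def by (auto simp flip: poly_mult map_poly_of_int_mult)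

lemma int_adjoin_minus [intro]: "x \<in> int_adjoin z \<Longrightarrow> - x \<in> int_adjoin z"
  using int_adjoin_mult[of "-1" z x] int_adjoin_of_int[of "-1" z] by simp

lemma int_adjoin_diff [intro]: "x \<in> int_adjoin z \<Longrightarrow> y \<in> int_adjoin z \<Longrightarrow> x - y \<in> int_adjoin z"
  using int_adjoin_add[of x z "- y"] int_adjoin_minus[of y z] by simp

lemma int_adjoin_power [intro]: "x \<in> int_adjoin z \<Longrightarrow> x ^ n \<in> int_adjoin z"
  by (induction n) auto

lemma int_adjoin_sum [intro]: "(\<And>i. i \<in> I \<Longrightarrow> f i \<in> int_adjoin z) \<Longrightarrow> sum f I \<in> int_adjoin z"
  by (induction I rule: infinite_finite_induct) auto

text \<open>Multiplication by \<open>x\<close> acts on the vector of the powers \<open>z ^ 0, \<dots>, z ^ (M - 1)\<close> by an integer matrix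
  \<open>A\<close>, so \<open>x\<close> is a root of the characteristic polynomial of \<open>A\<close>.\<close>

lemma algebraic_int_int_adjoin:
  assumes z: "z ^ M = 1" and M: "M > 0" and x: "x \<in> int_adjoin z"
  shows "algebraic_int x"
proof -
  from x obtain P :: "int poly" where P: "x = poly (map_poly of_int P) z"
    by (auto simp: int_adjoin_def)
  define A :: "int mat" where
    "A = mat M M (\<lambda>(i, j). \<Sum>n | n \<le> degree P \<and> (n + i) mod M = j. coeff P n)"
  define v where "v = vec M (\<lambda>j. z ^ j)"
  have A: "A \<in> carrier_mat M M" by (simp add: A_def)
  have zmod: "z ^ n = z ^ (n mod M)" for n
  proof -
    have "z ^ n = z ^ (M * (n div M) + n mod M)" by simp
    also have "\<dots> = z ^ (n mod M)" by (simp only: power_add power_mult z power_one mult_1)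
    finally show ?thesis .
  qed
  let ?A = "map_mat of_int A :: complex mat"
  have "?A *\<^sub>v v = x \<cdot>\<^sub>v v"
  proof (rule eq_vecI)
    fix i assume i: "i < dim_vec (x \<cdot>\<^sub>v v)"
    then have iM: "i < M" by (simp add: v_def)
    have "(?A *\<^sub>v v) $ i = (\<Sum>j<M. of_int (\<Sum>n | n \<le> degree P \<and> (n + i) mod M = j. coeff P n) * z ^ j)"
      using iM by (simp add: A_def v_def scalar_prod_def atLeast0LessThan)
    also have "\<dots> = (\<Sum>j<M. \<Sum>n | n \<in> {..degree P} \<and> (n + i) mod M = j. of_int (coeff P n) * z ^ (n + i))"
      unfolding of_int_sum sum_distrib_right
      by (intro sum.cong) (auto simp: zmod[of "_ + i"])
    also have "\<dots> = (\<Sum>n\<le>degree P. of_int (coeff P n) * z ^ (n + i))"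
      by (rule sum.group) (use M in auto)
    also have "\<dots> = x * z ^ i"
      unfolding P poly_altdef by (simp add: degree_map_poly coeff_map_poly sum_distrib_right power_add mult.assoc)
    also have "\<dots> = (x \<cdot>\<^sub>v v) $ i" using iM by (simp add: v_def)
    finally show "(?A *\<^sub>v v) $ i = (x \<cdot>\<^sub>v v) $ i" .
  qed (auto simp: A_def v_def)
  moreover have "v \<noteq> 0\<^sub>v M"
  proof
    assume "v = 0\<^sub>v M"
    then have "v $ 0 = 0" using M by simp
    then show False using M by (simp add: v_def)
  qed
  ultimately have "eigenvalue ?A x"
    unfolding eigenvalue_def eigenvector_def using A by (intro exI[of _ v]) (auto simp: v_def)
  then have "poly (char_poly ?A) x = 0"
    using eigenvalue_root_char_poly[of ?A M x] A by simp
  moreover have "char_poly ?A = map_poly of_int (char_poly A)"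
    by (rule comm_ring_hom.char_poly_hom[OF _ A]) unfold_locales
  moreover have "coeff (char_poly A) (degree (char_poly A)) = 1"
    using degree_monic_char_poly[OF A] by simp
  ultimately show ?thesis
    unfolding algebraic_int_altdef_ipoly by auto
qed

lemma int_adjoin_dvd:
  assumes z: "z ^ M = 1" "M > 0" and x: "x \<in> int_adjoin z" and p: "p > 0"
    and eq: "of_int a = of_nat p * x"
  shows "int p dvd a"
proof -
  have x_eq: "x = of_int a / of_nat p" using eq p by (simp add: field_simps)
  have "x \<in> \<rat>" unfolding x_eq by auto
  with algebraic_int_int_adjoin[OF z x] have "x \<in> \<int>" by (rule rational_algebraic_int_is_int)
  then obtain b where "x = of_int b" by (auto elim: Ints_cases)
  with eq have "(of_int a :: complex) = of_int (int p * b)" by simp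
  then have "a = int p * b" by (simp only: of_int_eq_iff)
  then show ?thesis by simp
qed

text \<open>Think of \<open>\<pi>\<close> as a uniformizer with \<open>\<pi> ^ e\<close> associated to \<open>p\<close>, where \<open>1 + \<pi> * u\<close> plays the role of a
  unit. The assumptions on \<open>c\<close> and \<open>m\<close> mean that \<open>c\<close> has valuation \<open>j\<close>, and \<open>2 * j < e\<close> prevents \<open>p\<close> from
  dividing \<open>c\<^sup>2\<close>. To stay within the ring, \<open>c\<close> is multiplied by \<open>1 + \<pi> * u\<close> instead of dividing by it.\<close>

lemma valuation_obstruction:
  fixes \<pi> :: complex and m :: int
  assumes z: "z ^ M = 1" "M > 0" and p: "prime (p::nat)" and pm: "\<not> int p dvd m"
    and mem: "\<pi> \<in> int_adjoin z" "u \<in> int_adjoin z"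
      "x \<in> int_adjoin z" "y \<in> int_adjoin z" "\<beta> \<in> int_adjoin z"
    and \<pi>: "\<pi> \<noteq> 0" and j: "2 * j < e"
    and ram: "\<pi> ^ e = - of_nat p * (1 + \<pi> * u)"
    and c: "c = \<pi> ^ j * (of_int m + \<pi> * y) + of_nat p * x"
  shows "c\<^sup>2 \<noteq> of_nat p * \<beta>"
proof
  assume c2: "c\<^sup>2 = of_nat p * \<beta>"
  define i where "i = e - 2 * j - 1"
  have e: "e = 2 * j + Suc i" using j by (simp add: i_def)
  define Y where "Y = y * (1 + \<pi> * u) + of_int m * u - \<pi> ^ (j + i) * x"
  have Y: "Y \<in> int_adjoin z" unfolding Y_def using mem by (intro int_adjoin_diff int_adjoin_add int_adjoin_minus int_adjoin_mult int_adjoin_power) auto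
  have pu: "of_nat p * (1 + \<pi> * u) = - (\<pi> ^ e)" using ram by simp
  have "c * (1 + \<pi> * u) = \<pi> ^ j * (of_int m + \<pi> * y) * (1 + \<pi> * u) + (of_nat p * (1 + \<pi> * u)) * x"
    by (simp add: c algebra_simps)
  also have "\<dots> = \<pi> ^ j * (of_int m + \<pi> * Y)"
    unfolding pu by (simp add: e Y_def algebra_simps power_add mult_2_right)
  finally have c': "c * (1 + \<pi> * u) = \<pi> ^ j * (of_int m + \<pi> * Y)" .
  have "\<pi> ^ (2 * j) * (of_int m + \<pi> * Y)\<^sup>2 = (c * (1 + \<pi> * u))\<^sup>2"
    unfolding c' by (simp add: power_mult_distrib power_mult[symmetric] mult.commute)
  also have "\<dots> = (of_nat p * (1 + \<pi> * u)) * (\<beta> * (1 + \<pi> * u))"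
    unfolding power_mult_distrib c2 by (simp add: power2_eq_square)
  also have "\<dots> = \<pi> ^ (2 * j) * (\<pi> * (- (\<pi> ^ i) * \<beta> * (1 + \<pi> * u)))"
    unfolding pu by (simp add: e power_add)
  finally have sq: "(of_int m + \<pi> * Y)\<^sup>2 = \<pi> * (- (\<pi> ^ i) * \<beta> * (1 + \<pi> * u))"
    using mult_left_cancel[of "\<pi> ^ (2 * j)"] \<pi> by (metis power_not_zero)
  define V where "V = - (\<pi> ^ i) * \<beta> * (1 + \<pi> * u) - 2 * of_int m * Y - \<pi> * Y\<^sup>2"
  have V: "V \<in> int_adjoin z" unfolding V_def using mem Y
    by (intro int_adjoin_diff int_adjoin_add int_adjoin_minus int_adjoin_mult int_adjoin_power) auto
  have "(of_int m)\<^sup>2 = \<pi> * V"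
    using sq unfolding V_def by (simp add: power2_eq_square algebra_simps)
  then have "(of_int m)\<^sup>2 ^ e = (\<pi> * V) ^ e" by simp
  then have "of_int (m\<^sup>2 ^ e) = of_nat p * (- ((1 + \<pi> * u) * V ^ e))"
    by (simp add: power_mult_distrib ram mult.assoc)
  moreover have "- ((1 + \<pi> * u) * V ^ e) \<in> int_adjoin z"
    using mem V by (intro int_adjoin_mult int_adjoin_power int_adjoin_minus int_adjoin_add) auto
  ultimately have "int p dvd m\<^sup>2 ^ e"
    using int_adjoin_dvd[OF z _ prime_gt_0_nat[OF p]] by blast
  moreover have "prime (int p)" using p by simp
  ultimately show False using pm by (meson prime_dvd_power)
qed

text \<open>The relation \<open>(1 + \<pi>) ^ p = 1\<close>, expanded and divided by \<open>\<pi>\<close>. All the binomial coefficients strictly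
  between the extreme ones are divisible by \<open>p\<close>.\<close>

lemma ramified_prime_root:
  fixes \<zeta> :: complex
  assumes p: "prime p" and \<zeta>: "\<zeta> ^ p = 1" "\<zeta> \<noteq> 1" "\<zeta> \<in> int_adjoin z"
  defines "\<pi> \<equiv> \<zeta> - 1"
  obtains u where "u \<in> int_adjoin z" "\<pi> ^ (p - 1) = - of_nat p * (1 + \<pi> * u)"
proof -
  have \<pi>: "\<pi> \<in> int_adjoin z" "\<pi> \<noteq> 0" unfolding \<pi>_def using \<zeta> by auto
  define b where "b = (\<lambda>i. of_nat ((p choose i) div p) :: complex)"
  have b: "of_nat (p choose i) = of_nat p * b i" if "0 < i" "i < p" for i
  proof -
    have "p dvd (p choose i)" using that p by (intro dvd_choose_prime) auto
    then have "p choose i = p * ((p choose i) div p)" by simp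
    then show ?thesis unfolding b_def by (metis of_nat_mult)
  qed
  have p2: "p \<ge> 2" using p by (rule prime_ge_2_nat)
  define u where "u = (\<Sum>i\<in>{2..<p}. b i * \<pi> ^ (i - 2))"
  have u: "u \<in> int_adjoin z" unfolding u_def b_def using \<pi>
    by (intro int_adjoin_sum int_adjoin_mult int_adjoin_power) auto
  have "1 = (\<pi> + 1) ^ p" using \<zeta> by (simp add: \<pi>_def)
  also have "\<dots> = (\<Sum>i\<le>p. of_nat (p choose i) * \<pi> ^ i)"
    by (subst binomial_ring) simp
  also have "{..p} = insert 0 (insert 1 (insert p {2..<p}))"
    using p2 by auto
  also have "(\<Sum>i\<in>\<dots>. of_nat (p choose i) * \<pi> ^ i)
      = 1 + of_nat p * \<pi> + \<pi> ^ p + (\<Sum>i\<in>{2..<p}. of_nat (p choose i) * \<pi> ^ i)"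
    using p2 by (simp add: add.assoc)
  also have "(\<Sum>i\<in>{2..<p}. of_nat (p choose i) * \<pi> ^ i)
      = (\<Sum>i\<in>{2..<p}. of_nat p * (\<pi> * \<pi>) * (b i * \<pi> ^ (i - 2)))"
  proof (rule sum.cong[OF refl])
    fix i assume i: "i \<in> {2..<p}"
    then have "2 \<le> i" by simp
    then have "i = Suc (Suc (i - 2))" by arith
    then have "\<pi> ^ i = (\<pi> * \<pi>) * \<pi> ^ (i - 2)"
      by (metis mult.assoc power_Suc)
    then show "of_nat (p choose i) * \<pi> ^ i = of_nat p * (\<pi> * \<pi>) * (b i * \<pi> ^ (i - 2))"
      using b[of i] i by simp
  qed
  also have "\<dots> = of_nat p * (\<pi> * \<pi>) * u"
    by (simp add: u_def sum_distrib_left)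
  also have "\<pi> ^ p = \<pi> * \<pi> ^ (p - 1)"
    using p2 by (cases p) auto
  finally have "\<pi> * (of_nat p * (1 + \<pi> * u) + \<pi> ^ (p - 1)) = 0"
    by (simp add: algebra_simps)
  then have "of_nat p * (1 + \<pi> * u) + \<pi> ^ (p - 1) = 0"
    using \<pi> by simp
  then have "\<pi> ^ (p - 1) = - of_nat p * (1 + \<pi> * u)"
    by (simp add: add_eq_0_iff)
  with u show thesis by (rule that)
qed

section \<open>Exponential sums that are not divisible by the square root of the prime\<close>

text \<open>Telescoping \<open>(a + 1) ^ (i + 1) - a ^ (i + 1)\<close> expresses \<open>i + 1\<close> times the sum through sums of lower powers.\<close>

lemma sum_powers_mod_prime:
  assumes p: "prime p" and i: "i < p - 1"
  shows "int p dvd (\<Sum>a<p. int a ^ i)"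
  using i
proof (induction i rule: less_induct)
  case (less i)
  have p2: "p \<ge> 2" using p by (rule prime_ge_2_nat)
  have "(\<Sum>a<p. int (Suc a) ^ Suc i - int a ^ Suc i) = int p ^ Suc i - int 0 ^ Suc i"
    by (rule sum_lessThan_telescope)
  moreover have "int (Suc a) ^ Suc i - int a ^ Suc i
      = of_nat (Suc i) * int a ^ i + (\<Sum>t<i. of_nat (Suc i choose t) * int a ^ t)" for a
  proof -
    have "int (Suc a) ^ Suc i = (int a + 1) ^ Suc i" by (simp add: add.commute)
    also have "\<dots> = (\<Sum>t\<le>Suc i. of_nat (Suc i choose t) * int a ^ t)"
      by (subst binomial_ring) simp
    also have "{..Suc i} = insert (Suc i) (insert i {..<i})" by auto
    finally show ?thesis by simp
  qed
  ultimately have eq: "int p ^ Suc i = of_nat (Suc i) * (\<Sum>a<p. int a ^ i)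
      + (\<Sum>t<i. of_nat (Suc i choose t) * (\<Sum>a<p. int a ^ t))"
    by (simp add: sum.distrib sum_distrib_left sum.swap[of _ "{..<i}"])
  have dvd: "int p dvd (\<Sum>t<i. of_nat (Suc i choose t) * (\<Sum>a<p. int a ^ t))"
  proof (rule dvd_sum)
    fix t assume "t \<in> {..<i}"
    then show "int p dvd of_nat (Suc i choose t) * (\<Sum>a<p. int a ^ t)"
      using less by (intro dvd_mult less.IH) auto
  qed
  have "int p dvd int p ^ Suc i" by simp
  then have "int p dvd of_nat (Suc i) * (\<Sum>a<p. int a ^ i)"
    unfolding eq using dvd by (simp only: dvd_add_left_iff)
  moreover have "\<not> int p dvd int (Suc i)"
    using less.prems by (auto dest!: zdvd_imp_le)
  moreover have "prime (int p)" using p by simp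
  ultimately show ?case using prime_dvd_mult_iff by blast
qed

lemma sum_poly_mod_prime:
  fixes Q :: "int poly"
  assumes p: "prime p" and Q: "degree Q < p - 1"
  shows "int p dvd (\<Sum>a<p. poly Q (int a))"
proof -
  have "(\<Sum>a<p. poly Q (int a)) = (\<Sum>i\<le>degree Q. coeff Q i * (\<Sum>a<p. int a ^ i))"
    unfolding poly_altdef sum_distrib_left by (rule sum.swap)
  also have "int p dvd \<dots>"
    using Q by (intro dvd_sum dvd_mult sum_powers_mod_prime p) auto
  finally show ?thesis .
qed

lemma sum_powers_p_minus_1:
  assumes p: "prime p"
  shows "[(\<Sum>a<p. int a ^ (p - 1)) = -1] (mod int p)"
proof -
  have p2: "p \<ge> 2" using p by (rule prime_ge_2_nat)
  have "[int a ^ (p - 1) = 1] (mod int p)" if "a \<in> {1..<p}" for a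
  proof -
    have "\<not> p dvd a" using that by (auto dest: dvd_imp_le)
    then have "[a ^ (p - 1) = 1] (mod p)" by (rule fermat_theorem[OF p])
    then show ?thesis by (metis cong_int_iff of_nat_1 of_nat_power)
  qed
  then have "[(\<Sum>a\<in>{1..<p}. int a ^ (p - 1)) = (\<Sum>a\<in>{1..<p}. 1)] (mod int p)"
    by (intro cong_sum) auto
  moreover have "(\<Sum>a<p. int a ^ (p - 1)) = (\<Sum>a\<in>{1..<p}. int a ^ (p - 1))"
    using p2 by (intro sum.mono_neutral_right) (auto simp: not_le)
  moreover have "[(\<Sum>a\<in>{1..<p}. 1::int) = -1] (mod int p)"
    using p2 by (simp add: of_nat_diff cong_iff_dvd_diff)
  ultimately show ?thesis by (metis cong_trans)
qed

text \<open>The falling factorial of length \<open>k\<close> of \<open>X ^ 3 + X\<close>; its value at \<open>a\<close> is \<open>k!\<close> times the binomial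
  coefficient of \<open>a ^ 3 + a\<close> over \<open>k\<close>.\<close>

definition cubic_falling :: "nat \<Rightarrow> int poly" where
  "cubic_falling k = (\<Prod>i<k. [:- int i, 1, 0, 1:])"

lemma poly_cubic_falling: "poly (cubic_falling k) (int a) = fact k * int ((a ^ 3 + a) choose k)"
proof -
  have "fact k * int ((a ^ 3 + a) choose k) = (\<Prod>i=0..<k. int (a ^ 3 + a) - of_nat i)"
    unfolding int_binomial by (rule gbinomial_int_mult_fact)
  also have "\<dots> = poly (cubic_falling k) (int a)"
    unfolding cubic_falling_def poly_prod atLeast0LessThan
    by (intro prod.cong refl) (simp add: power3_eq_cube algebra_simps)
  finally show ?thesis by simp
qed

lemma cubic_falling_expand:
  assumes "k \<ge> 1"
  shows "\<exists>R. cubic_falling k = monom 1 (3 * k) + monom (int k) (3 * k - 2) + R \<and> degree R \<le> 3 * k - 3"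
  using assms
proof (induction k rule: dec_induct)
  case base
  have "[:- int 0, 1, 0, 1:] = monom 1 3 + monom 1 1 + (0::int poly)"
    by (rule poly_eqI) (auto simp: coeff_pCons split: nat.splits)
  then show ?case
    by (intro exI[of _ 0]) (simp add: cubic_falling_def)
next
  case (step k)
  then obtain R where R: "cubic_falling k = monom 1 (3 * k) + monom (int k) (3 * k - 2) + R"
    "degree R \<le> 3 * k - 3" by blast
  define R' where "R' = monom (int k) (3 * k - 1) + [:- int k:] * cubic_falling k + [:0, 1, 0, 1:] * R"
  have f: "[:- int k, 1, 0, 1:] = monom 1 3 + monom 1 1 + [:- int k:]"
    by (rule poly_eqI) (auto simp: coeff_pCons split: nat.splits)
  have g: "[:0, 1, 0, 1:] = monom 1 3 + (monom 1 1 :: int poly)"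
    by (rule poly_eqI) (auto simp: coeff_pCons split: nat.splits)
  have e: "3 + 3 * k = 3 * Suc k" "Suc (3 * k) = 3 * Suc k - 2" "3 + (3 * k - 2) = 3 * Suc k - 2"
    "Suc (3 * k - 2) = 3 * k - 1"
    using step(1) by auto
  have "cubic_falling (Suc k) = [:- int k, 1, 0, 1:] * cubic_falling k"
    by (simp add: cubic_falling_def mult.commute)
  also have "\<dots> = (monom 1 3 + monom 1 1) * (monom 1 (3 * k) + monom (int k) (3 * k - 2) + R)
      + [:- int k:] * cubic_falling k"
    unfolding f by (simp only: distrib_right R(1)[symmetric])
  also have "\<dots> = monom 1 (3 * Suc k) + (monom 1 (3 * Suc k - 2) + monom (int k) (3 * Suc k - 2)) + R'"
    unfolding R'_def g by (simp add: distrib_left distrib_right mult_monom e del: mult_Suc_right)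
  also have "monom 1 (3 * Suc k - 2) + monom (int k) (3 * Suc k - 2) = monom (int (Suc k)) (3 * Suc k - 2)"
    by (simp add: add_monom del: mult_Suc_right)
  finally have "cubic_falling (Suc k) = monom 1 (3 * Suc k) + monom (int (Suc k)) (3 * Suc k - 2) + R'" .
  moreover have "degree R' \<le> 3 * k"
  proof -
    have "degree (cubic_falling k) \<le> 3 * k"
      unfolding R(1) using R(2)
      by (intro degree_add_le order.trans[OF degree_monom_le]) auto
    then have 1: "degree ([:- int k:] * cubic_falling k) \<le> 3 * k"
      using degree_mult_le[of "[:- int k:]" "cubic_falling k"] by simp
    have 2: "degree ([:0, 1, 0, 1:] * R) \<le> 3 * k"
      using degree_mult_le[of "[:0, 1, 0, 1:]" R] R(2) step(1) by simp
    show ?thesis unfolding R'_def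
      by (intro degree_add_le 1 2 order.trans[OF degree_monom_le]) auto
  qed
  ultimately show ?case by (intro exI[of _ R']) auto
qed

text \<open>Modulo \<open>p\<close>, only the coefficients of \<open>cubic_falling j\<close> in degree \<open>p - 1\<close> and above matter. For
  \<open>p \<equiv> 1\<close> modulo 3 take \<open>3 * j = p - 1\<close>: the sum is that of the leading term, which is \<open>-1\<close>. For
  \<open>p \<equiv> 2\<close> modulo 3 take \<open>3 * j = p + 1\<close>: the leading term \<open>a ^ (p + 1)\<close> is congruent to \<open>a ^ 2\<close> and its sum
  vanishes, while \<open>j * a ^ (p - 1)\<close> contributes \<open>- j\<close>.\<close>

lemma sum_binomial_cubic:
  assumes p: "prime p" "p \<ge> 7"
  defines "T \<equiv> (\<lambda>k. \<Sum>a<p. (a ^ 3 + a) choose k)"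
  obtains j where "2 * j < p - 1" "\<And>k. k < j \<Longrightarrow> p dvd T k" "\<not> p dvd T j"
proof -
  have fT: "fact k * int (T k) = (\<Sum>a<p. poly (cubic_falling k) (int a))" for k
    unfolding poly_cubic_falling by (simp add: T_def sum_distrib_left)
  have pi: "prime (int p)" using p by simp
  have ndvd_fact: "\<not> int p dvd fact k" if "k < p" for k
  proof -
    have "\<not> p dvd fact k" using prime_dvd_fact_iff[OF p(1)] that by simp
    then show ?thesis by (metis of_nat_dvd_iff of_nat_fact)
  qed
  have small: "p dvd T k" if k: "3 * k < p - 1" for k
  proof -
    have "degree (cubic_falling k) < p - 1"
    proof (cases "k = 0")
      case True
      then show ?thesis using k by (simp add: cubic_falling_def)
    next
      case False
      then obtain R where R: "cubic_falling k = monom 1 (3 * k) + monom (int k) (3 * k - 2) + R"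
        "degree R \<le> 3 * k - 3" using cubic_falling_expand[of k] by auto
      have "degree (cubic_falling k) \<le> 3 * k"
        unfolding R(1) using R(2) by (intro degree_add_le order.trans[OF degree_monom_le]) auto
      then show ?thesis using k by simp
    qed
    then have "int p dvd fact k * int (T k)"
      unfolding fT by (rule sum_poly_mod_prime[OF p(1)])
    moreover have "\<not> int p dvd fact k" using k by (intro ndvd_fact) auto
    ultimately have "int p dvd int (T k)" using pi prime_dvd_mult_iff by blast
    then show ?thesis by simp
  qed
  have "\<not> 3 dvd p" using p by (auto simp: prime_nat_iff)
  then have "p mod 3 = 1 \<or> p mod 3 = 2" by presburger
  then consider (one) "p mod 3 = 1" | (two) "p mod 3 = 2" by blast
  then show thesis
  proof cases
    case one
    define j where "j = (p - 1) div 3"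
    have j3: "3 * j = p - 1" using one p(2) unfolding j_def by presburger
    have j1: "j \<ge> 1" using j3 p(2) by linarith
    obtain R where R: "cubic_falling j = monom 1 (3 * j) + monom (int j) (3 * j - 2) + R"
      "degree R \<le> 3 * j - 3" using cubic_falling_expand[OF j1] by auto
    have "degree (monom (int j) (3 * j - 2) + R) < p - 1"
      using R(2) j3 p(2) by (intro degree_add_less order.strict_trans1[OF degree_monom_le]) auto
    from sum_poly_mod_prime[OF p(1) this]
    have "[(\<Sum>a<p. poly (monom (int j) (3 * j - 2) + R) (int a)) = 0] (mod int p)"
      by (simp add: cong_0_iff)
    from cong_add[OF sum_powers_p_minus_1[OF p(1)] this]
    have "[fact j * int (T j) = -1] (mod int p)"
      unfolding fT R(1) by (simp add: sum.distrib poly_monom j3 add.assoc)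
    then have "\<not> int p dvd fact j * int (T j)"
      using pi by (metis cong_dvd_iff dvd_minus_iff not_prime_unit)
    then have "\<not> p dvd T j" by auto
    then show thesis using j3 p(2) by (intro that[of j] small) auto
  next
    case two
    define j where "j = (p + 1) div 3"
    have j3: "3 * j = p + 1" using two p(2) unfolding j_def by presburger
    have j1: "j \<ge> 1" using j3 p(2) by linarith
    obtain R where R: "cubic_falling j = monom 1 (3 * j) + monom (int j) (3 * j - 2) + R"
      "degree R \<le> 3 * j - 3" using cubic_falling_expand[OF j1] by auto
    have "degree R < p - 1" using R(2) j3 p(2) by simp
    from sum_poly_mod_prime[OF p(1) this]
    have c1: "[(\<Sum>a<p. poly R (int a)) = 0] (mod int p)"
      by (simp add: cong_0_iff)
    have c2: "[int j * (\<Sum>a<p. int a ^ (p - 1)) = int j * -1] (mod int p)"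
      by (intro cong_mult sum_powers_p_minus_1 p cong_refl)
    have "[int a ^ (p + 1) = int a ^ 2] (mod int p)" for a
    proof (cases "p dvd a")
      case True
      then have "int p dvd int a ^ (p + 1)" "int p dvd int a ^ 2"
        by (simp_all add: power2_eq_square dvd_mult2)
      then show ?thesis by (metis cong_0_iff cong_sym cong_trans)
    next
      case False
      then have "[a ^ (p - 1) = 1] (mod p)" by (rule fermat_theorem[OF p(1)])
      then have "[int a ^ (p - 1) = 1] (mod int p)" by (metis cong_int_iff of_nat_1 of_nat_power)
      then have "[int a ^ 2 * int a ^ (p - 1) = int a ^ 2 * 1] (mod int p)"
        by (intro cong_mult cong_refl)
      moreover have "2 + (p - 1) = p + 1" using p(2) by simp
      ultimately show ?thesis by (simp flip: power_add)
    qed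
    then have "[(\<Sum>a<p. int a ^ (p + 1)) = (\<Sum>a<p. int a ^ 2)] (mod int p)"
      by (intro cong_sum)
    moreover have "[(\<Sum>a<p. int a ^ 2) = 0] (mod int p)"
      using sum_powers_mod_prime[OF p(1), of 2] p(2) by (simp add: cong_0_iff)
    ultimately have c3: "[(\<Sum>a<p. int a ^ (p + 1)) = 0] (mod int p)" by (rule cong_trans)
    have j32: "3 * j - 2 = p - 1" using j3 by simp
    from cong_add[OF cong_add[OF c3 c2] c1]
    have "[fact j * int (T j) = - int j] (mod int p)"
      unfolding fT R(1) j32 j3 by (simp add: sum.distrib poly_monom sum_distrib_left)
    moreover have "\<not> int p dvd - int j"
      using j3 j1 p(2) by (auto dest!: dvd_imp_le)
    ultimately have "\<not> int p dvd fact j * int (T j)"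
      using cong_dvd_iff by blast
    then have "\<not> p dvd T j" by auto
    then show thesis using j3 p(2) by (intro that[of j] small) auto
  qed
qed

lemma power_one_plus_expand:
  assumes "\<rho> \<in> int_adjoin z"
  shows "\<exists>r\<in>int_adjoin z. (1 + \<rho>) ^ m = (\<Sum>k\<le>j. of_nat (m choose k) * \<rho> ^ k) + \<rho> ^ Suc j * r"
proof
  define r where "r = (\<Sum>i\<le>m. of_nat (m choose (Suc j + i)) * \<rho> ^ i)"
  show "r \<in> int_adjoin z" unfolding r_def using assms
    by (intro int_adjoin_sum int_adjoin_mult int_adjoin_power) auto
  have "(1 + \<rho>) ^ m = (\<Sum>k\<le>m. of_nat (m choose k) * \<rho> ^ k)"
    using binomial_ring[of \<rho> 1 m] by (simp add: add.commute)
  also have "\<dots> = (\<Sum>k\<le>j + Suc m. of_nat (m choose k) * \<rho> ^ k)"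
    by (rule sum.mono_neutral_left) (auto simp: binomial_eq_0)
  also have "{..j + Suc m} = {..j} \<union> {Suc j..j + Suc m}" by auto
  also have "(\<Sum>k\<in>\<dots>. of_nat (m choose k) * \<rho> ^ k) = (\<Sum>k\<le>j. of_nat (m choose k) * \<rho> ^ k)
      + (\<Sum>k\<in>{Suc j..j + Suc m}. of_nat (m choose k) * \<rho> ^ k)"
    by (rule sum.union_disjoint) auto
  also have "(\<Sum>k\<in>{Suc j..j + Suc m}. of_nat (m choose k) * \<rho> ^ k)
      = (\<Sum>i\<le>m. of_nat (m choose (Suc j + i)) * \<rho> ^ (Suc j + i))"
    by (rule sum.reindex_bij_witness[of _ "\<lambda>i. Suc j + i" "\<lambda>k. k - Suc j"]) auto
  also have "\<dots> = \<rho> ^ Suc j * r"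
    unfolding r_def sum_distrib_left by (intro sum.cong) (auto simp: power_add mult_ac)
  finally show "(1 + \<rho>) ^ m = (\<Sum>k\<le>j. of_nat (m choose k) * \<rho> ^ k) + \<rho> ^ Suc j * r" .
qed

text \<open>Expanding \<open>\<zeta> ^ m = (1 + \<pi>) ^ m\<close> in powers of \<open>\<pi> = \<zeta> - 1\<close>, the sum has the coefficients
  \<open>\<Sum> (a ^ 3 + a) choose k\<close>, and its valuation is the \<open>j\<close> of \<open>sum_binomial_cubic\<close>.\<close>

lemma cubic_exponential_sum:
  assumes z: "z ^ M = 1" "M > 0" and p: "prime p" "p \<ge> 7"
    and \<zeta>: "\<zeta> ^ p = 1" "\<zeta> \<noteq> 1" "\<zeta> \<in> int_adjoin z" and \<beta>: "\<beta> \<in> int_adjoin z"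
  shows "(\<Sum>a<p. \<zeta> ^ (a ^ 3 + a))\<^sup>2 \<noteq> of_nat p * \<beta>"
proof -
  define \<pi> where "\<pi> = \<zeta> - 1"
  have \<pi>: "\<pi> \<in> int_adjoin z" "\<pi> \<noteq> 0" "\<zeta> = 1 + \<pi>" unfolding \<pi>_def using \<zeta> by auto
  define T where "T = (\<lambda>k. \<Sum>a<p. (a ^ 3 + a) choose k)"
  obtain j where j: "2 * j < p - 1" "\<And>k. k < j \<Longrightarrow> p dvd T k" "\<not> p dvd T j"
    using sum_binomial_cubic[OF p] unfolding T_def by blast
  obtain u where u: "u \<in> int_adjoin z" "\<pi> ^ (p - 1) = - of_nat p * (1 + \<pi> * u)"
    using ramified_prime_root[OF p(1) \<zeta>] unfolding \<pi>_def by blast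
  have "\<forall>a. \<exists>r\<in>int_adjoin z. \<zeta> ^ (a ^ 3 + a) =
      (\<Sum>k\<le>j. of_nat ((a ^ 3 + a) choose k) * \<pi> ^ k) + \<pi> ^ Suc j * r"
    unfolding \<pi>(3) by (intro allI power_one_plus_expand \<pi>(1))
  then obtain r where r: "\<And>a. r a \<in> int_adjoin z" "\<And>a. \<zeta> ^ (a ^ 3 + a) =
      (\<Sum>k\<le>j. of_nat ((a ^ 3 + a) choose k) * \<pi> ^ k) + \<pi> ^ Suc j * r a"
    by metis
  have "(\<Sum>a<p. \<zeta> ^ (a ^ 3 + a)) = (\<Sum>k\<le>j. of_nat (T k) * \<pi> ^ k) + \<pi> ^ Suc j * (\<Sum>a<p. r a)"
    unfolding r(2) sum.distrib
    by (subst sum.swap) (simp add: T_def sum_distrib_left sum_distrib_right)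
  also have "{..j} = insert j {..<j}" by auto
  also have "(\<Sum>k\<in>\<dots>. of_nat (T k) * \<pi> ^ k) = of_nat (T j) * \<pi> ^ j + (\<Sum>k<j. of_nat (T k) * \<pi> ^ k)"
    by simp
  also have "(\<Sum>k<j. of_nat (T k) * \<pi> ^ k) = of_nat p * (\<Sum>k<j. of_nat (T k div p) * \<pi> ^ k)"
    unfolding sum_distrib_left
  proof (rule sum.cong[OF refl])
    fix k assume "k \<in> {..<j}"
    then have "T k = p * (T k div p)" using j(2) by simp
    then show "of_nat (T k) * \<pi> ^ k = of_nat p * (of_nat (T k div p) * \<pi> ^ k)"
      by (metis mult.assoc of_nat_mult)
  qed
  finally have c: "(\<Sum>a<p. \<zeta> ^ (a ^ 3 + a)) = \<pi> ^ j * (of_int (int (T j)) + \<pi> * (\<Sum>a<p. r a))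
      + of_nat p * (\<Sum>k<j. of_nat (T k div p) * \<pi> ^ k)"
    by (simp add: algebra_simps)
  show ?thesis
  proof (rule valuation_obstruction[OF z p(1) _ \<pi>(1) u(1) _ _ \<beta> \<pi>(2) j(1) u(2) c])
    show "\<not> int p dvd int (T j)" using j(3) by simp
  qed (use r \<pi> in \<open>auto intro!: int_adjoin_sum int_adjoin_mult int_adjoin_power\<close>)
qed

lemma quartic_exponential_sum_5:
  assumes z: "z ^ M = 1" "M > 0"
    and \<zeta>: "\<zeta> ^ 5 = 1" "\<zeta> \<noteq> 1" "\<zeta> \<in> int_adjoin z" and \<beta>: "\<beta> \<in> int_adjoin z"
  shows "(1 + 4 * \<zeta>)\<^sup>2 \<noteq> 5 * \<beta>"
proof -
  have 5: "prime (5::nat)" by simp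
  obtain u where u: "u \<in> int_adjoin z" "(\<zeta> - 1) ^ (5 - 1) = - of_nat 5 * (1 + (\<zeta> - 1) * u)"
    using ramified_prime_root[OF 5 \<zeta>] by blast
  have c: "1 + 4 * \<zeta> = (\<zeta> - 1) ^ 1 * (of_int 4 + (\<zeta> - 1) * 0) + of_nat 5 * 1"
    by simp
  have "(1 + 4 * \<zeta>)\<^sup>2 \<noteq> of_nat 5 * \<beta>"
    by (rule valuation_obstruction[OF z 5 _ _ u(1) _ _ \<beta> _ _ u(2) c]) (use \<zeta> in auto)
  then show ?thesis by simp
qed

lemma eighth_root_sum:
  assumes z: "z ^ M = 1" "M > 0"
    and \<zeta>: "\<zeta> ^ 4 = - 1" "\<zeta> \<in> int_adjoin z" and \<beta>: "\<beta> \<in> int_adjoin z"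
  shows "(1 + \<zeta>)\<^sup>2 \<noteq> 2 * \<beta>"
proof -
  define \<pi> where "\<pi> = \<zeta> - 1"
  have \<pi>: "\<pi> \<in> int_adjoin z" "\<zeta> = 1 + \<pi>" unfolding \<pi>_def using \<zeta> by auto
  have "\<zeta> \<noteq> 1" using \<zeta> by auto
  then have \<pi>0: "\<pi> \<noteq> 0" by (simp add: \<pi>_def)
  define u where "u = 2 + 3 * \<pi> + 2 * \<pi>\<^sup>2"
  have u: "u \<in> int_adjoin z" unfolding u_def using \<pi> by (intro int_adjoin_add int_adjoin_mult int_adjoin_power) auto
  have "\<pi> ^ 4 + 2 * (1 + \<pi> * u) = \<zeta> ^ 4 + 1"
    unfolding \<pi>(2) u_def by (simp add: power_numeral_reduce algebra_simps)
  then have ram: "\<pi> ^ 4 = - of_nat 2 * (1 + \<pi> * u)"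
    using \<zeta> by (simp add: add_eq_0_iff2)
  have c: "1 + \<zeta> = \<pi> ^ 1 * (of_int 1 + \<pi> * 0) + of_nat 2 * 1"
    by (simp add: \<pi>)
  have "(1 + \<zeta>)\<^sup>2 \<noteq> of_nat 2 * \<beta>"
    by (rule valuation_obstruction[OF z _ _ \<pi>(1) u _ _ \<beta> \<pi>0 _ ram c]) auto
  then show ?thesis by simp
qed

text \<open>Here \<open>w\<close> is one of \<open>1\<close>, \<open>\<zeta> ^ 3\<close> and \<open>\<zeta> ^ 6\<close>, and in each case the sum is congruent to \<open>\<pi>\<^sup>2\<close> modulo \<open>\<pi> ^ 3\<close>
  and \<open>3\<close>, where \<open>\<pi> = \<zeta> - 1\<close> has ramification index 6.\<close>

lemma ninth_root_sum:
  assumes z: "z ^ M = 1" "M > 0"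
    and \<zeta>: "\<zeta> ^ 6 + \<zeta> ^ 3 + 1 = 0" "\<zeta> \<in> int_adjoin z" and w: "w ^ 3 = 1" and \<beta>: "\<beta> \<in> int_adjoin z"
  shows "(\<zeta> + \<zeta>\<^sup>2 + w)\<^sup>2 \<noteq> 3 * \<beta>"
proof -
  define \<pi> where "\<pi> = \<zeta> - 1"
  have \<pi>: "\<pi> \<in> int_adjoin z" "\<zeta> = 1 + \<pi>" unfolding \<pi>_def using \<zeta> by auto
  have "\<zeta> \<noteq> 1" using \<zeta> by auto
  then have \<pi>0: "\<pi> \<noteq> 0" by (simp add: \<pi>_def)
  define u where "u = 3 + 6 * \<pi> + 7 * \<pi>\<^sup>2 + 5 * \<pi> ^ 3 + 2 * \<pi> ^ 4"
  have u: "u \<in> int_adjoin z" unfolding u_def using \<pi> by (intro int_adjoin_add int_adjoin_mult int_adjoin_power) auto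
  have "\<pi> ^ 6 + 3 * (1 + \<pi> * u) = \<zeta> ^ 6 + \<zeta> ^ 3 + 1"
    unfolding \<pi>(2) u_def by (simp add: power_numeral_reduce algebra_simps)
  then have ram: "\<pi> ^ 6 = - of_nat 3 * (1 + \<pi> * u)"
    using \<zeta> by (simp add: add_eq_0_iff2)
  have "(w - 1) * (w - \<zeta> ^ 3) * (w - \<zeta> ^ 6) = 0"
  proof -
    have s6: "\<zeta> ^ 6 = - (\<zeta> ^ 3) - 1" using \<zeta>(1) by (simp add: algebra_simps add_eq_0_iff2)
    have s9: "\<zeta> ^ 3 * \<zeta> ^ 6 = 1"
    proof -
      have "\<zeta> ^ 3 * \<zeta> ^ 6 - 1 = (\<zeta> ^ 3 - 1) * (\<zeta> ^ 6 + \<zeta> ^ 3 + 1)"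
        by (simp add: algebra_simps flip: power_add)
      then show ?thesis using \<zeta>(1) by simp
    qed
    have "(w - 1) * (w - \<zeta> ^ 3) * (w - \<zeta> ^ 6)
        = w ^ 3 - (\<zeta> ^ 6 + \<zeta> ^ 3 + 1) * w\<^sup>2 + (\<zeta> ^ 6 + \<zeta> ^ 3 + \<zeta> ^ 3 * \<zeta> ^ 6) * w - \<zeta> ^ 3 * \<zeta> ^ 6"
      by (simp add: power2_eq_square power3_eq_cube algebra_simps)
    then show ?thesis unfolding s9 using \<zeta>(1) w by simp
  qed
  then consider "w = 1" | "w = \<zeta> ^ 3" | "w = \<zeta> ^ 6" by auto
  then obtain x y where xy: "x \<in> int_adjoin z" "y \<in> int_adjoin z"
    "\<zeta> + \<zeta>\<^sup>2 + w = \<pi> ^ 2 * (of_int 1 + \<pi> * y) + of_nat 3 * x"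
  proof cases
    case 1
    show thesis
      by (rule that[of "1 + \<pi>" 0]) (use \<pi>(1) in \<open>auto simp: 1 \<pi>(2) power_numeral_reduce algebra_simps\<close>)
  next
    case 2
    show thesis
      by (rule that[of "1 + 2 * \<pi> + \<pi>\<^sup>2" 1])
        (use \<pi>(1) in \<open>auto simp: 2 \<pi>(2) power_numeral_reduce algebra_simps intro!: int_adjoin_add int_adjoin_mult\<close>)
  next
    case 3
    have "w - (- 1 - \<zeta> ^ 3) = \<zeta> ^ 6 + \<zeta> ^ 3 + 1" using 3 by simp
    then have w: "w = - 1 - \<zeta> ^ 3" unfolding \<zeta>(1) by (simp only: right_minus_eq)
    show thesis
      by (intro that[of "- \<pi>\<^sup>2" "- 1"])
        (use \<pi>(1) int_adjoin_of_int[of "-1" z] in \<open>auto simp: w \<pi>(2) power_numeral_reduce algebra_simps\<close>)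
  qed
  have "(\<zeta> + \<zeta>\<^sup>2 + w)\<^sup>2 \<noteq> of_nat 3 * \<beta>"
    by (rule valuation_obstruction[OF z _ _ \<pi>(1) u xy(1,2) \<beta> \<pi>0 _ ram xy(3)]) auto
  then show ?thesis by simp
qed

section \<open>Frobenius orbits in an algebraically closed field\<close>

text \<open>The \<open>Q\<close>-power Frobenius on the coefficients of a polynomial.\<close>

definition frob_poly :: "nat \<Rightarrow> 'k::field poly \<Rightarrow> 'k poly" where
  "frob_poly Q = map_poly (\<lambda>x. x ^ Q)"

text \<open>The field with \<open>Q\<close> elements, as a subset of a field that contains it.\<close>

definition frob_field :: "nat \<Rightarrow> 'k::field set" where
  "frob_field Q = {x. x ^ Q = x}"

text \<open>The monic polynomials of degree \<open>n\<close> over the field with \<open>Q\<close> elements.\<close>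

definition frob_monics :: "nat \<Rightarrow> nat \<Rightarrow> 'k::field poly set" where
  "frob_monics Q n = {f. degree f = n \<and> lead_coeff f = 1 \<and> frob_poly Q f = f}"

text \<open>For \<open>\<alpha>\<close> in the field with \<open>Q ^ n\<close> elements, the characteristic polynomial of \<open>\<alpha>\<close> over the field
  with \<open>Q\<close> elements. The parameter \<open>n\<close> is needed because \<open>\<alpha>\<close> may lie in a smaller field, in which case
  the product is a proper power of the minimal polynomial.\<close>

definition conj_poly :: "nat \<Rightarrow> nat \<Rightarrow> 'k::field \<Rightarrow> 'k poly" where
  "conj_poly Q n \<alpha> = (\<Prod>i<n. [:- (\<alpha> ^ (Q ^ i)), 1:])"

lemma degree_conj_poly [simp]: "degree (conj_poly Q n \<alpha>) = n"
  unfolding conj_poly_def by (subst degree_prod_eq_sum_degree) auto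

lemma lead_coeff_conj_poly [simp]: "coeff (conj_poly Q n \<alpha>) n = 1"
proof -
  have "lead_coeff (conj_poly Q n \<alpha>) = 1"
    unfolding conj_poly_def by (subst lead_coeff_prod) simp
  then show ?thesis by simp
qed

lemma conj_poly_nonzero [simp]: "conj_poly Q n \<alpha> \<noteq> 0"
  using lead_coeff_conj_poly[of Q n \<alpha>] by (metis coeff_0 zero_neq_one)

lemma conj_poly_root: "n > 0 \<Longrightarrow> poly (conj_poly Q n \<alpha>) \<alpha> = 0"
  unfolding conj_poly_def poly_prod by (intro prod_zero bexI[of _ 0]) auto

text \<open>
  An algebraically closed field of characteristic \<open>p\<close> together with a power \<open>Q = p ^ s\<close>. The facts about
  \<open>frob_poly\<close> are stated for all powers \<open>Q ^ i\<close>, which includes \<open>i = 0\<close>.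
\<close>

locale frobenius =
  fixes p s Q :: nat and K :: "'k::alg_closed_field itself"
  assumes p: "prime p" and char: "CHAR('k) = p" and Q: "Q = p ^ s" and s: "s \<ge> 1"
begin

lemma Q_gt_1: "Q > 1"
  using one_less_power[of p s] prime_gt_1_nat[OF p] s by (simp add: Q)

lemma Q_pos [simp]: "0 < Q"
  using Q_gt_1 by simp

lemma Qi_pos: "Q ^ i > 0"
  using Q_gt_1 by simp

lemma pow_add: "(x + y :: 'k) ^ (Q ^ i) = x ^ (Q ^ i) + y ^ (Q ^ i)"
  by (rule freshmans_dream'[of _ "s * i"]) (use p char in \<open>auto simp: Q power_mult\<close>)

lemma pow_sum: "(\<Sum>x\<in>A. f x :: 'k) ^ (Q ^ i) = (\<Sum>x\<in>A. f x ^ (Q ^ i))"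
  by (rule freshmans_dream_sum'[of _ "s * i"]) (use p char in \<open>auto simp: Q power_mult\<close>)

lemma pow_minus: "(- x :: 'k) ^ (Q ^ i) = - (x ^ (Q ^ i))"
  using pow_add[of x "- x" i] Qi_pos[of i] by (simp add: eq_neg_iff_add_eq_0 add.commute zero_power)

lemma pow_diff: "(x - y :: 'k) ^ (Q ^ i) = x ^ (Q ^ i) - y ^ (Q ^ i)"
  using pow_add[of x "- y" i] by (simp add: pow_minus)

lemma pow_inj: "(x :: 'k) ^ (Q ^ i) = y ^ (Q ^ i) \<longleftrightarrow> x = y"
  using pow_diff[of x y i] Qi_pos[of i] by auto

lemma coeff_frob: "coeff (frob_poly (Q ^ i) f) n = (coeff f n :: 'k) ^ (Q ^ i)"
  unfolding frob_poly_def using Qi_pos[of i] by (subst coeff_map_poly) (auto simp: zero_power)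

lemma frob_fixed_iff: "frob_poly (Q ^ i) f = f \<longleftrightarrow> (\<forall>n. (coeff f n :: 'k) \<in> frob_field (Q ^ i))"
  by (simp add: poly_eq_iff coeff_frob frob_field_def)

lemma frob_mult: "frob_poly (Q ^ i) (f * g :: 'k poly) = frob_poly (Q ^ i) f * frob_poly (Q ^ i) g"
  by (rule poly_eqI) (simp add: coeff_frob coeff_mult pow_sum power_mult_distrib)

lemma frob_1 [simp]: "frob_poly (Q ^ i) (1 :: 'k poly) = 1"
  by (simp add: frob_poly_def map_poly_1)

lemma frob_power: "frob_poly (Q ^ i) (f ^ n :: 'k poly) = frob_poly (Q ^ i) f ^ n"
  by (induction n) (simp_all add: frob_mult)

lemma frob_prod: "frob_poly (Q ^ i) (\<Prod>x\<in>A. f x :: 'k poly) = (\<Prod>x\<in>A. frob_poly (Q ^ i) (f x))"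
  by (induction A rule: infinite_finite_induct) (simp_all add: frob_mult)

lemma frob_linear: "frob_poly (Q ^ i) [:- \<alpha>, 1:] = [:- ((\<alpha> :: 'k) ^ (Q ^ i)), 1:]"
  by (rule poly_eqI) (auto simp: coeff_frob coeff_pCons pow_minus zero_power Qi_pos split: nat.split)

lemma frob_frob: "frob_poly (Q ^ i) (frob_poly (Q ^ j) f) = frob_poly (Q ^ (i + j)) (f :: 'k poly)"
  by (rule poly_eqI) (simp add: coeff_frob flip: power_mult power_add add: mult.commute add.commute)

lemma degree_frob: "degree (frob_poly (Q ^ i) f) = degree (f :: 'k poly)"
  unfolding frob_poly_def by (rule degree_map_poly) auto

lemma frob_reflect: "frob_poly (Q ^ i) (reflect_poly f) = reflect_poly (frob_poly (Q ^ i) (f :: 'k poly))"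
  by (rule poly_eqI) (auto simp: coeff_frob coeff_reflect_poly degree_frob zero_power Qi_pos)

lemma frob_fixed_pow:
  assumes "frob_poly Q f = (f :: 'k poly)"
  shows "frob_poly (Q ^ i) f = f"
proof (induction i)
  case 0
  show ?case by (simp add: frob_poly_def)
next
  case (Suc i)
  have "frob_poly (Q ^ Suc i) f = frob_poly (Q ^ i) (frob_poly (Q ^ 1) f)"
    by (simp only: frob_frob) simp
  then show ?case using Suc assms by simp
qed

lemma frob_conj_poly:
  assumes "\<alpha> ^ (Q ^ n) = (\<alpha> :: 'k)"
  shows "frob_poly Q (conj_poly Q n \<alpha>) = conj_poly Q n \<alpha>"
proof -
  define g where "g = (\<lambda>i. [:- (\<alpha> ^ (Q ^ i)), 1:])"
  have "frob_poly (Q ^ 1) (conj_poly Q n \<alpha>) = (\<Prod>i<n. g (Suc i))"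
    unfolding conj_poly_def frob_prod
    unfolding frob_linear g_def by (simp add: mult.commute flip: power_mult)
  also have "g 0 * \<dots> = (\<Prod>i<Suc n. g i)"
    by (simp only: prod.lessThan_Suc_shift)
  also have "\<dots> = g 0 * (\<Prod>i<n. g i)"
    using assms by (simp add: g_def mult.commute)
  finally have "g 0 * frob_poly (Q ^ 1) (conj_poly Q n \<alpha>) = g 0 * conj_poly Q n \<alpha>"
    by (simp add: conj_poly_def g_def)
  moreover have "g 0 \<noteq> 0" by (simp add: g_def)
  ultimately show ?thesis by (metis mult_left_cancel power_one_right)
qed

lemma conj_poly_in_frob_monics:
  assumes "\<alpha> \<in> frob_field (Q ^ n)"
  shows "(conj_poly Q n \<alpha> :: 'k poly) \<in> frob_monics Q n"
  using assms frob_conj_poly[of \<alpha> n] by (auto simp: frob_monics_def frob_field_def)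

lemma frob_linear_power_dvd:
  assumes "[:- \<alpha>, 1:] ^ j dvd f" "frob_poly Q f = (f :: 'k poly)"
  shows "[:- (\<alpha> ^ (Q ^ i)), 1:] ^ j dvd f"
proof -
  from assms(1) obtain g where "f = [:- \<alpha>, 1:] ^ j * g" by (elim dvdE)
  then have "frob_poly (Q ^ i) f = [:- (\<alpha> ^ (Q ^ i)), 1:] ^ j * frob_poly (Q ^ i) g"
    by (simp add: frob_mult frob_power frob_linear)
  then show ?thesis using frob_fixed_pow[OF assms(2)] by (metis dvd_triv_left)
qed

lemma prod_linear_powers_dvd:
  assumes "finite I" "inj_on a I" "\<And>i. i \<in> I \<Longrightarrow> [:- a i, 1:] ^ j dvd f" "f \<noteq> 0"
  shows "(\<Prod>i\<in>I. [:- a i, 1:] ^ j) dvd (f :: 'k poly)"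
  using assms
proof (induction I arbitrary: f rule: finite_induct)
  case empty
  then show ?case by simp
next
  case (insert i I)
  have "[:- a i, 1:] ^ j dvd f" using insert.prems by auto
  then obtain g where g: "f = [:- a i, 1:] ^ j * g" by (elim dvdE)
  have g0: "g \<noteq> 0" using insert.prems g by auto
  have "[:- a k, 1:] ^ j dvd g" if k: "k \<in> I" for k
  proof -
    have ne: "a k \<noteq> a i" using insert.prems(1) k insert.hyps(2) by (auto simp: inj_on_def)
    have "j \<le> order (a k) f"
      using insert.prems(2)[of k] k insert.prems(3) by (simp add: order_divides)
    also have "order (a k) f = order (a k) ([:- a i, 1:] ^ j) + order (a k) g"
      unfolding g by (rule order_mult) (use g insert.prems(3) in auto)
    also have "order (a k) ([:- a i, 1:] ^ j) = 0"
      by (rule order_0I) (use ne in auto)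
    finally show ?thesis by (simp add: order_divides)
  qed
  then have "(\<Prod>i\<in>I. [:- a i, 1:] ^ j) dvd g"
    using insert.prems(1) g0 by (intro insert.IH) auto
  then show ?case unfolding g using insert.hyps by (simp add: mult_dvd_mono)
qed

text \<open>
  The Frobenius orbit of \<open>\<alpha>\<close> is finite because it consists of roots of \<open>f\<close>; \<open>d\<close> is its length, that is,
  the degree of \<open>\<alpha>\<close> over the field with \<open>Q\<close> elements.
\<close>

lemma orbit:
  assumes f: "frob_poly Q f = (f :: 'k poly)" "f \<noteq> 0" and root: "poly f \<alpha> = 0"
  obtains d where "d \<ge> 1" "\<And>k. \<alpha> \<in> frob_field (Q ^ k) \<longleftrightarrow> d dvd k"
    "inj_on (\<lambda>i. \<alpha> ^ (Q ^ i)) {..<d}"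
    "\<And>j. conj_poly Q (d * j) \<alpha> = conj_poly Q d \<alpha> ^ j"
proof -
  define a where "a = (\<lambda>i. \<alpha> ^ (Q ^ i))"
  have a_add: "a (i + j) = a i ^ (Q ^ j)" for i j
    by (simp add: a_def power_add power_mult)
  have a0: "a 0 = \<alpha>" by (simp add: a_def)
  have a_diff: "a (j - i) = \<alpha>" if "i \<le> j" "a i = a j" for i j
  proof -
    have "a (j - i) ^ (Q ^ i) = a 0 ^ (Q ^ i)"
      using that by (simp flip: a_add)
    then show ?thesis by (simp add: pow_inj a0)
  qed
  have "[:- \<alpha>, 1:] ^ 1 dvd f" using root by (simp add: poly_eq_0_iff_dvd)
  then have "[:- a i, 1:] dvd f" for i
    using frob_linear_power_dvd[OF _ f(1), of \<alpha> 1 i] by (simp add: a_def)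
  then have "range a \<subseteq> {x. poly f x = 0}" by (auto simp: poly_eq_0_iff_dvd)
  then have "finite (range a)" using poly_roots_finite[OF f(2)] by (rule finite_subset)
  then have "\<not> inj a" using finite_imageD infinite_UNIV_nat by blast
  then obtain i j where "i < j" "a i = a j"
    by (metis injI linorder_neq_iff)
  then have ex: "j - i \<ge> 1 \<and> a (j - i) = \<alpha>" using a_diff[of i j] by auto
  define d where "d = (LEAST d. d \<ge> 1 \<and> a d = \<alpha>)"
  have d: "d \<ge> 1" "a d = \<alpha>"
    unfolding d_def using LeastI[of "\<lambda>d. d \<ge> 1 \<and> a d = \<alpha>", OF ex] by auto
  have dmin: "a k \<noteq> \<alpha>" if "k \<ge> 1" "k < d" for k
    using not_less_Least[OF that(2)[unfolded d_def]] that(1) by auto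
  have per: "a (d + i) = a i" for i
    unfolding a_add d(2) by (simp add: a_def)
  have per': "a (d * k + i) = a i" for k i
    using per by (induction k) (simp_all add: add.assoc)
  show thesis
  proof (rule that[of d])
    show "\<alpha> \<in> frob_field (Q ^ k) \<longleftrightarrow> d dvd k" for k
    proof -
      have "\<alpha> \<in> frob_field (Q ^ k) \<longleftrightarrow> a k = \<alpha>" by (simp add: frob_field_def a_def)
      also have "a k = a (k mod d)" using per'[of "k div d" "k mod d"] by simp
      also have "a (k mod d) = \<alpha> \<longleftrightarrow> k mod d = 0"
        using dmin[of "k mod d"] d(1) a0 by (cases "k mod d = 0") auto
      finally show ?thesis by (simp add: dvd_eq_mod_eq_0)
    qed
    show "inj_on (\<lambda>i. \<alpha> ^ (Q ^ i)) {..<d}"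
    proof (rule linorder_inj_onI)
      fix i j assume ij: "i < j" "i \<in> {..<d}" "j \<in> {..<d}"
      show "\<alpha> ^ (Q ^ i) \<noteq> \<alpha> ^ (Q ^ j)"
        using a_diff[of i j] dmin[of "j - i"] ij by (auto simp: a_def)
    qed auto
    show "conj_poly Q (d * j) \<alpha> = conj_poly Q d \<alpha> ^ j" for j
    proof (induction j)
      case 0
      then show ?case by (simp add: conj_poly_def)
    next
      case (Suc j)
      have "conj_poly Q (d * Suc j) \<alpha> = (\<Prod>i<d * j + d. [:- a i, 1:])"
        by (simp add: conj_poly_def a_def add.commute)
      also have "{..<d * j + d} = {..<d * j} \<union> {d * j..<d * j + d}" by auto
      also have "(\<Prod>i\<in>\<dots>. [:- a i, 1:]) = (\<Prod>i<d * j. [:- a i, 1:]) * (\<Prod>i\<in>{d * j..<d * j + d}. [:- a i, 1:])"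
        by (rule prod.union_disjoint) auto
      also have "(\<Prod>i\<in>{d * j..<d * j + d}. [:- a i, 1:]) = (\<Prod>i<d. [:- a (d * j + i), 1:])"
        by (rule prod.reindex_bij_witness[of _ "\<lambda>i. d * j + i" "\<lambda>i. i - d * j"]) auto
      also have "\<dots> = conj_poly Q d \<alpha>" unfolding per' by (simp add: conj_poly_def a_def)
      finally show ?case using Suc by (simp add: conj_poly_def a_def mult.commute)
    qed
  qed (use d in auto)
qed

text \<open>A root of multiplicity \<open>m\<close> and degree \<open>d\<close> is counted by \<open>k = d, 2 * d, \<dots>, m * d\<close>.\<close>

lemma card_periods:
  assumes f: "f \<in> frob_monics Q n" and root: "poly f \<alpha> = (0 :: 'k)"
  shows "card {k \<in> {1..n}. \<alpha> \<in> frob_field (Q ^ k) \<and> conj_poly Q k \<alpha> dvd f} = order \<alpha> f"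
proof -
  have f': "frob_poly Q f = f" "f \<noteq> 0" "degree f = n"
    using f by (auto simp: frob_monics_def)
  obtain d where d: "d \<ge> 1" "\<And>k. \<alpha> \<in> frob_field (Q ^ k) \<longleftrightarrow> d dvd k"
    "inj_on (\<lambda>i. \<alpha> ^ (Q ^ i)) {..<d}" "\<And>j. conj_poly Q (d * j) \<alpha> = conj_poly Q d \<alpha> ^ j"
    using orbit[OF f'(1,2) root] by metis
  have iff: "conj_poly Q (d * j) \<alpha> dvd f \<longleftrightarrow> j \<le> order \<alpha> f" for j
  proof
    assume "conj_poly Q (d * j) \<alpha> dvd f"
    moreover have "[:- \<alpha>, 1:] ^ j dvd conj_poly Q d \<alpha> ^ j"
      using conj_poly_root[of d Q \<alpha>] d(1) by (intro dvd_power_same) (simp add: poly_eq_0_iff_dvd)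
    ultimately have "[:- \<alpha>, 1:] ^ j dvd f" unfolding d(4) by (rule dvd_trans[rotated])
    then show "j \<le> order \<alpha> f" using f'(2) by (simp add: order_divides)
  next
    assume "j \<le> order \<alpha> f"
    then have "[:- \<alpha>, 1:] ^ j dvd f" by (simp add: order_divides)
    then have "[:- (\<alpha> ^ (Q ^ i)), 1:] ^ j dvd f" for i by (rule frob_linear_power_dvd[OF _ f'(1)])
    then have "(\<Prod>i<d. [:- (\<alpha> ^ (Q ^ i)), 1:] ^ j) dvd f"
      by (intro prod_linear_powers_dvd d(3) f'(2)) auto
    then show "conj_poly Q (d * j) \<alpha> dvd f"
      unfolding d(4) by (simp add: conj_poly_def prod_power_distrib)
  qed
  have "{k \<in> {1..n}. \<alpha> \<in> frob_field (Q ^ k) \<and> conj_poly Q k \<alpha> dvd f} = (\<lambda>j. d * j) ` {1..order \<alpha> f}"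
  proof (intro equalityI subsetI)
    fix k assume k: "k \<in> {k \<in> {1..n}. \<alpha> \<in> frob_field (Q ^ k) \<and> conj_poly Q k \<alpha> dvd f}"
    then obtain j where j: "k = d * j" using d(2) by auto
    then show "k \<in> (\<lambda>j. d * j) ` {1..order \<alpha> f}" using k iff[of j] by (auto intro!: image_eqI[of _ _ j])
  next
    fix k assume "k \<in> (\<lambda>j. d * j) ` {1..order \<alpha> f}"
    then obtain j where "k = d * j" "j \<in> {1..order \<alpha> f}" by blast
    then have j: "k = d * j" "1 \<le> j" "j \<le> order \<alpha> f" by auto
    have dv: "conj_poly Q k \<alpha> dvd f" using iff[of j] j by simp
    then have "k \<le> n" using dvd_imp_degree_le[OF dv f'(2)] f'(3) by simp
    then show "k \<in> {k \<in> {1..n}. \<alpha> \<in> frob_field (Q ^ k) \<and> conj_poly Q k \<alpha> dvd f}"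
      using dv d(1,2) j by auto
  qed
  then show ?thesis using d(1) by (simp add: card_image inj_on_def)
qed

lemma sum_order_roots:
  assumes "(f :: 'k poly) \<noteq> 0"
  shows "(\<Sum>\<alpha> | poly f \<alpha> = 0. order \<alpha> f) = degree f"
proof -
  obtain A where A: "size A = degree f" "f = Polynomial.smult (lead_coeff f) (\<Prod>x\<in>#A. [:-x, 1:])"
    using alg_closed_imp_factorization[OF assms] by blast
  have "proots f = proots (\<Prod>x\<in>#A. [:-x, 1:])"
    by (subst A(2), rule proots_smult) (use assms in simp)
  also have "\<dots> = A"
  proof (induction A)
    case (add x A)
    have "(\<Prod>x\<in>#A. [:- x, 1:]) \<noteq> 0" by (auto simp: prod_mset_zero_iff)
    then show ?case using add by (simp add: proots_mult del: mult_pCons_left)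
  qed simp
  finally have "size (proots f) = degree f" using A(1) by simp
  then show ?thesis
    using assms by (simp add: size_multiset_overloaded_eq)
qed

text \<open>The polynomial \<open>X ^ N - X\<close> has derivative \<open>-1\<close> and hence only simple roots.\<close>

lemma card_frob_field:
  assumes "n \<ge> 1"
  shows "card (frob_field (Q ^ n) :: 'k set) = Q ^ n" and "finite (frob_field (Q ^ n) :: 'k set)"
proof -
  define N where "N = Q ^ n"
  have N1: "N > 1" unfolding N_def using one_less_power[OF Q_gt_1, of n] assms by simp
  define f :: "'k poly" where "f = monom 1 N - monom 1 1"
  have f: "poly f x = x ^ N - x" for x by (simp add: f_def poly_monom)
  have "coeff f N = 1" using N1 by (simp add: f_def)
  moreover have "degree f \<le> N" unfolding f_def
    using N1 by (intro degree_diff_le order.trans[OF degree_monom_le]) auto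
  ultimately have deg: "degree f = N" "f \<noteq> 0"
    using le_degree[of f N] by auto
  have "CHAR('k) dvd N" unfolding N_def Q char using s assms
    by (metis One_nat_def dvd_power le_simps(3) less_or_eq_imp_le nat_0_less_mult_iff power_mult)
  then have "(of_nat N :: 'k) = 0" by (simp add: of_nat_eq_0_iff_char_dvd)
  then have pd: "pderiv f = - 1"
    unfolding f_def pderiv_diff pderiv_monom by (simp add: monom_0 one_pCons)
  have ord: "order x f = 1" if "poly f x = 0" for x
  proof -
    have "order x f \<noteq> 0" using that deg by (simp add: order_root)
    moreover have "\<not> 2 \<le> order x f"
    proof
      assume "2 \<le> order x f"
      then have "[:- x, 1:] ^ 2 dvd f" by (simp add: order_divides)
      then obtain g where "f = [:- x, 1:] ^ 2 * g" by (elim dvdE)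
      moreover define L where "L = [:- x, 1:]"
      ultimately have "pderiv f = L * pderiv (L * g) + L * g * pderiv L"
        by (simp only: power2_eq_square mult.assoc pderiv_mult)
      moreover have "poly L x = 0" by (simp add: L_def)
      ultimately have "poly (pderiv f) x = 0" by (simp only: poly_add poly_mult)  simp
      then show False by (simp add: pd)
    qed
    ultimately show ?thesis by simp
  qed
  have set_eq: "frob_field (Q ^ n) = {x. poly f x = 0}"
    by (auto simp: frob_field_def f N_def)
  have "(\<Sum>\<alpha> | poly f \<alpha> = 0. order \<alpha> f) = (\<Sum>\<alpha> | poly f \<alpha> = 0. 1)"
    by (intro sum.cong refl) (simp add: ord)
  then show "card (frob_field (Q ^ n) :: 'k set) = Q ^ n"
    unfolding set_eq using sum_order_roots[OF deg(2)] deg(1) by (simp add: N_def)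
  show "finite (frob_field (Q ^ n) :: 'k set)"
    unfolding set_eq using deg by (simp add: poly_roots_finite)
qed

end

section \<open>Short interval characters and their L-functions\<close>

text \<open>The group of polynomials with constant coefficient \<open>1\<close> over the field with \<open>Q\<close> elements, modulo
  \<open>u ^ (l + 1)\<close>. A class is represented by its unique member of degree at most \<open>l\<close>.\<close>

definition trunc_group :: "nat \<Rightarrow> nat \<Rightarrow> 'k::field poly monoid" where
  "trunc_group Q l = \<lparr>carrier = {g. coeff g 0 = 1 \<and> degree g \<le> l \<and> frob_poly Q g = g},
     mult = (\<lambda>g h. poly_cutoff (Suc l) (g * h)), one = 1\<rparr>"

text \<open>The class of a monic polynomial: the coefficient of \<open>u ^ j\<close> is the \<open>j\<close>-th next-to-leading coefficient
  of \<open>f\<close>, with \<open>0\<close> for \<open>j\<close> larger than the degree.\<close>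

definition short_class :: "nat \<Rightarrow> 'k::field poly \<Rightarrow> 'k poly" where
  "short_class l f = poly_cutoff (Suc l) (reflect_poly f)"

text \<open>The sum of \<open>\<chi>(f) * \<Lambda>(f)\<close> over the monic polynomials \<open>f\<close> of degree \<open>n\<close> over the field with \<open>Q\<close> elements,
  written as a sum over the elements of the field with \<open>Q ^ n\<close> elements.\<close>

definition char_sum :: "nat \<Rightarrow> nat \<Rightarrow> ('k::field poly \<Rightarrow> complex) \<Rightarrow> nat \<Rightarrow> complex" where
  "char_sum Q l \<chi> n = (\<Sum>\<alpha>\<in>frob_field (Q ^ n). \<chi> (short_class l (conj_poly Q n \<alpha>)))"

lemma poly_cutoff_mult: "poly_cutoff n (poly_cutoff n f * g) = poly_cutoff n (f * g)"
  "poly_cutoff n (f * poly_cutoff n g) = poly_cutoff n (f * g)"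
  by (rule poly_eqI; auto simp: coeff_poly_cutoff coeff_mult intro!: sum.cong)+

lemma degree_poly_cutoff: "degree (poly_cutoff (Suc n) f) \<le> n"
  by (rule degree_le) (simp add: coeff_poly_cutoff)

lemma poly_cutoff_id: "degree f \<le> n \<Longrightarrow> poly_cutoff (Suc n) f = f"
  by (rule poly_eqI) (auto simp: coeff_poly_cutoff coeff_eq_0)

lemma poly_cutoff_cutoff: "m \<le> n \<Longrightarrow> poly_cutoff m (poly_cutoff n f) = poly_cutoff m f"
  by (rule poly_eqI) (auto simp: coeff_poly_cutoff)

lemma short_class_mult:
  "short_class l (f * g) = poly_cutoff (Suc l) (short_class l f * short_class l g)"
  by (simp add: short_class_def reflect_poly_mult poly_cutoff_mult)

lemma coeff_short_class:
  "degree f = n \<Longrightarrow> coeff (short_class l f) k = (if k \<le> l \<and> k \<le> n then coeff f (n - k) else 0)"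
  by (auto simp: short_class_def coeff_poly_cutoff coeff_reflect_poly)

context frobenius
begin

lemma frob_cutoff: "frob_poly (Q ^ i) (poly_cutoff n f) = poly_cutoff n (frob_poly (Q ^ i) (f :: 'k poly))"
  by (rule poly_eqI) (auto simp: coeff_frob coeff_poly_cutoff)

lemma frob_mult1: "frob_poly Q (f * g :: 'k poly) = frob_poly Q f * frob_poly Q g"
  using frob_mult[of 1 f g] by simp

lemma frob_cutoff1: "frob_poly Q (poly_cutoff n f) = poly_cutoff n (frob_poly Q (f :: 'k poly))"
  using frob_cutoff[of 1 n f] by simp

text \<open>Inverses exist because the \<open>P\<close>-th power of \<open>1 + u * k\<close> is \<open>1 + u ^ P * k ^ P\<close> for a power \<open>P\<close> of \<open>p\<close>, which is
  trivial as soon as \<open>P > l\<close>.\<close>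

lemma trunc_group: "comm_group (trunc_group Q l :: 'k poly monoid)"
proof (rule comm_groupI)
  let ?G = "trunc_group Q l :: 'k poly monoid"
  fix x y z :: "'k poly"
  show "\<one>\<^bsub>?G\<^esub> \<in> carrier ?G" using frob_1[of 1] by (simp add: trunc_group_def)
  show "x \<otimes>\<^bsub>?G\<^esub> y \<in> carrier ?G" if "x \<in> carrier ?G" "y \<in> carrier ?G"
    using that
    by (simp add: trunc_group_def coeff_poly_cutoff coeff_mult_0 degree_poly_cutoff frob_cutoff1 frob_mult1)
  show "x \<otimes>\<^bsub>?G\<^esub> y \<otimes>\<^bsub>?G\<^esub> z = x \<otimes>\<^bsub>?G\<^esub> (y \<otimes>\<^bsub>?G\<^esub> z)"
    by (simp add: trunc_group_def poly_cutoff_mult mult.assoc)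
  show "x \<otimes>\<^bsub>?G\<^esub> y = y \<otimes>\<^bsub>?G\<^esub> x"
    by (simp add: trunc_group_def mult.commute)
  show "\<one>\<^bsub>?G\<^esub> \<otimes>\<^bsub>?G\<^esub> x = x" if "x \<in> carrier ?G"
    using that by (simp add: trunc_group_def poly_cutoff_id)
  assume x: "x \<in> carrier ?G"
  define P where "P = p ^ Suc l"
  have "l < 2 ^ Suc l" using less_exp[of "Suc l"] by simp
  also have "\<dots> \<le> P" unfolding P_def using prime_ge_2_nat[OF p] by (rule power_mono) simp
  finally have "l < P" .
  then have P: "P > l" "P > 0" by auto
  obtain a k where "x = pCons a k" by (rule pCons_cases)
  with x have xk: "x = 1 + [:0, 1:] * k" by (simp add: trunc_group_def one_pCons)
  have "x ^ P = 1 ^ P + ([:0, 1:] * k) ^ P"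
    unfolding xk by (rule freshmans_dream'[of _ "Suc l"]) (use p char in \<open>auto simp: P_def\<close>)
  also have "\<dots> = 1 + monom 1 P * k ^ P"
    by (simp only: power_mult_distrib power_one monom_altdef) simp
  finally have "poly_cutoff (Suc l) (x ^ P) = 1"
    using P by (auto simp: poly_eq_iff coeff_poly_cutoff coeff_monom_mult)
  moreover have "x ^ (P - 1) * x = x ^ P" using P(2) by (cases P) (auto simp: mult.commute)
  ultimately have "poly_cutoff (Suc l) (x ^ (P - 1)) \<otimes>\<^bsub>?G\<^esub> x = \<one>\<^bsub>?G\<^esub>"
    by (simp add: trunc_group_def poly_cutoff_mult)
  moreover have "frob_poly Q (x ^ (P - 1)) = x ^ (P - 1)"
    using frob_power[of 1 x "P - 1"] x by (simp add: trunc_group_def)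
  then have "poly_cutoff (Suc l) (x ^ (P - 1)) \<in> carrier ?G"
    using x by (simp add: trunc_group_def coeff_poly_cutoff degree_poly_cutoff frob_cutoff1 coeff_0_power)
  ultimately show "\<exists>y\<in>carrier ?G. y \<otimes>\<^bsub>?G\<^esub> x = \<one>\<^bsub>?G\<^esub>" by blast
qed

lemma short_class_in_carrier:
  assumes "f \<in> frob_monics Q n"
  shows "(short_class l f :: 'k poly) \<in> carrier (trunc_group Q l)"
proof -
  have "frob_poly Q (reflect_poly f) = reflect_poly f"
    using assms frob_reflect[of 1 f] by (simp add: frob_monics_def)
  then show ?thesis using assms
    by (auto simp: trunc_group_def short_class_def frob_monics_def coeff_poly_cutoff degree_poly_cutoff frob_cutoff1)
qed

lemma finite_card_trunc_group:
  "finite (carrier (trunc_group Q l :: 'k poly monoid))"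
  "card (carrier (trunc_group Q l :: 'k poly monoid)) = Q ^ l"
proof -
  let ?C = "carrier (trunc_group Q l :: 'k poly monoid)" and ?F = "frob_field Q :: 'k set"
  have F: "finite ?F" "card ?F = Q" using card_frob_field[of 1] by simp_all
  define to where "to = (\<lambda>g :: 'k poly. restrict (coeff g) {1..l})"
  define ofc where "ofc = (\<lambda>h :: nat \<Rightarrow> 'k. 1 + (\<Sum>k=1..l. monom (h k) k))"
  have coeff_from: "coeff (ofc h) n = (if n = 0 then 1 else if n \<le> l then h n else 0)" for h n
    unfolding ofc_def by (auto simp: coeff_sum sum.delta)
  have C: "g \<in> ?C \<longleftrightarrow> coeff g 0 = 1 \<and> degree g \<le> l \<and> (\<forall>n. coeff g n \<in> ?F)" for g
    using frob_fixed_iff[of 1 g] by (simp add: trunc_group_def)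
  have FF: "(0 :: 'k) \<in> ?F" "(1 :: 'k) \<in> ?F"
    by (simp_all add: frob_field_def zero_power)
  have bij: "bij_betw to ?C ({1..l} \<rightarrow>\<^sub>E ?F)"
  proof (rule bij_betw_byWitness[where f' = ofc])
    show "\<forall>g\<in>?C. ofc (to g) = g"
      by (auto simp: C poly_eq_iff coeff_from to_def coeff_eq_0)
    show "\<forall>h\<in>{1..l} \<rightarrow>\<^sub>E ?F. to (ofc h) = h"
      by (auto simp: to_def coeff_from fun_eq_iff PiE_def extensional_def)
    show "to ` ?C \<subseteq> {1..l} \<rightarrow>\<^sub>E ?F" by (auto simp: C to_def)
    show "ofc ` ({1..l} \<rightarrow>\<^sub>E ?F) \<subseteq> ?C"
      using FF by (auto simp: C coeff_from PiE_def Pi_def intro!: degree_le)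
  qed
  show "finite ?C" using bij_betw_finite[OF bij] F by (simp add: finite_PiE)
  show "card ?C = Q ^ l" using bij_betw_same_card[OF bij] F by (simp add: card_PiE)
qed

lemma finite_frob_monics: "finite (frob_monics Q n :: 'k poly set)"
proof (rule inj_on_finite)
  show "short_class n ` frob_monics Q n \<subseteq> carrier (trunc_group Q n :: 'k poly monoid)"
    using short_class_in_carrier by blast
  show "inj_on (short_class n) (frob_monics Q n :: 'k poly set)"
  proof (rule inj_onI, rule poly_eqI)
    fix f g :: "'k poly" and i
    assume fg: "f \<in> frob_monics Q n" "g \<in> frob_monics Q n" "short_class n f = short_class n g"
    from fg(3) have "coeff (short_class n f) (n - i) = coeff (short_class n g) (n - i)" by simp
    then show "coeff f i = coeff g i" using fg(1,2)
      by (cases "i \<le> n") (auto simp: coeff_short_class frob_monics_def coeff_eq_0)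
  qed
qed (rule finite_card_trunc_group)

lemma frob_field_diff: "(x :: 'k) \<in> frob_field Q \<Longrightarrow> y \<in> frob_field Q \<Longrightarrow> x - y \<in> frob_field Q"
  using pow_diff[of x y 1] by (simp add: frob_field_def)

lemma frob_field_add: "(x :: 'k) \<in> frob_field Q \<Longrightarrow> y \<in> frob_field Q \<Longrightarrow> x + y \<in> frob_field Q"
  using pow_add[of x y 1] by (simp add: frob_field_def)

lemma frob_field_0: "(0 :: 'k) \<in> frob_field Q"
  by (simp add: frob_field_def zero_power)

text \<open>
  Adding the polynomial \<open>D\<close> that carries the difference of the classes maps one fibre of \<open>short_class\<close>
  injectively to the other. This needs \<open>n \<ge> l\<close>, so that all \<open>l\<close> coefficients can be changed freely.
\<close>

lemma card_short_class_fibre_le: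
  assumes n: "n \<ge> l" and g: "(g :: 'k poly) \<in> carrier (trunc_group Q l)" and h: "(h :: 'k poly) \<in> carrier (trunc_group Q l)"
  shows "card {f \<in> frob_monics Q n. short_class l f = g} \<le> card {f \<in> frob_monics Q n. short_class l f = h}"
proof (rule card_inj_on_le)
  define D where "D = (\<Sum>k\<le>l. monom (coeff h k - coeff g k) (n - k))"
  have D: "coeff D m = (if n - l \<le> m \<and> m \<le> n then coeff h (n - m) - coeff g (n - m) else 0)" for m
  proof -
    have "coeff D m = (\<Sum>k\<le>l. if k = n - m \<and> m \<le> n then coeff h k - coeff g k else 0)"
      unfolding D_def coeff_sum using n by (intro sum.cong) auto
    also have "\<dots> = (if n - l \<le> m \<and> m \<le> n then coeff h (n - m) - coeff g (n - m) else 0)"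
      using n by (cases "m \<le> n") (auto simp: sum.delta)
    finally show ?thesis .
  qed
  have C: "x \<in> carrier (trunc_group Q l) \<longleftrightarrow>
      coeff x 0 = 1 \<and> degree x \<le> l \<and> (\<forall>n. coeff x n \<in> frob_field Q)" for x :: "'k poly"
    using frob_fixed_iff[of 1 x] by (simp add: trunc_group_def)
  have M: "x \<in> frob_monics Q n \<longleftrightarrow> degree x = n \<and> coeff x n = 1 \<and> (\<forall>n. coeff x n \<in> frob_field Q)" for x :: "'k poly"
    using frob_fixed_iff[of 1 x] by (auto simp: frob_monics_def)
  show "inj_on (\<lambda>f. f + D) {f \<in> frob_monics Q n. short_class l f = g}"
    by (simp add: inj_on_def)
  show "(\<lambda>f. f + D) ` {f \<in> frob_monics Q n. short_class l f = g} \<subseteq> {f \<in> frob_monics Q n. short_class l f = h}"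
  proof safe
    fix f :: "'k poly" assume f: "f \<in> frob_monics Q n" "g = short_class l f"
    have top: "coeff (f + D) n = 1" using f g h by (simp add: D M C)
    have degfD: "degree (f + D) = n"
    proof (rule antisym)
      show "degree (f + D) \<le> n" using f by (intro degree_le) (auto simp: D M coeff_eq_0)
      show "n \<le> degree (f + D)" using top by (intro le_degree) simp
    qed
    have "coeff D m \<in> frob_field Q" for m
      using g h by (auto simp: D C frob_field_diff frob_field_0)
    then show "f + D \<in> frob_monics Q n"
      using f top degfD by (auto simp: M frob_field_add)
    show "short_class l (f + D) = h"
    proof (rule poly_eqI)
      fix k
      have "coeff (short_class l f) k = coeff g k" using f by simp
      then show "coeff (short_class l (f + D)) k = coeff h k"
        using f h n unfolding coeff_short_class[OF degfD] coeff_short_class[of f n l k]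
        by (auto simp: D M C coeff_eq_0 coeff_short_class)
    qed
  qed
  show "finite {f \<in> frob_monics Q n. short_class l f = h}"
    using finite_frob_monics by simp
qed

lemma sum_character_frob_monics:
  assumes n: "n \<ge> l" and \<chi>: "group_character (trunc_group Q l) (carrier (trunc_group Q l)) \<chi>"
    and g0: "(g0 :: 'k poly) \<in> carrier (trunc_group Q l)" "\<chi> g0 \<noteq> 1"
  shows "(\<Sum>f\<in>frob_monics Q n. \<chi> (short_class l f)) = 0"
proof -
  let ?C = "carrier (trunc_group Q l :: 'k poly monoid)"
  interpret G: comm_group "trunc_group Q l :: 'k poly monoid" by (rule trunc_group)
  let ?c = "\<lambda>g. card {f \<in> frob_monics Q n. short_class l f = g}"
  have "(\<Sum>f\<in>frob_monics Q n. \<chi> (short_class l f))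
      = (\<Sum>g\<in>?C. \<Sum>f | f \<in> frob_monics Q n \<and> short_class l f = g. \<chi> (short_class l f))"
    by (rule sum.group[symmetric])
       (use finite_frob_monics finite_card_trunc_group short_class_in_carrier in auto)
  also have "\<dots> = (\<Sum>g\<in>?C. of_nat (?c g0) * \<chi> g)"
  proof (rule sum.cong[OF refl])
    fix g assume g: "g \<in> ?C"
    have "?c g = ?c g0"
      using card_short_class_fibre_le[OF n g g0(1)] card_short_class_fibre_le[OF n g0(1) g] by simp
    then show "(\<Sum>f | f \<in> frob_monics Q n \<and> short_class l f = g. \<chi> (short_class l f)) = of_nat (?c g0) * \<chi> g"
      by simp
  qed
  also have "\<dots> = 0"
    using G.sum_character_eq_0[OF finite_card_trunc_group(1) \<chi> g0] by (simp flip: sum_distrib_left)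
  finally show ?thesis .
qed

lemma frob_monics_mult:
  assumes "f \<in> frob_monics Q m" "g \<in> frob_monics Q n"
  shows "(f * g :: 'k poly) \<in> frob_monics Q (m + n)"
proof -
  have "f \<noteq> 0" "g \<noteq> 0" using assms by (auto simp: frob_monics_def)
  then show ?thesis
    using assms lead_coeff_mult[of f g] by (auto simp: frob_monics_def frob_mult1 degree_mult_eq)
qed

lemma frob_monics_divide:
  assumes "f \<in> frob_monics Q n" "(N :: 'k poly) \<in> frob_monics Q k" "N dvd f"
  obtains g where "g \<in> frob_monics Q (n - k)" "f = N * g"
proof -
  obtain g where g: "f = N * g" using assms(3) by (elim dvdE)
  have nz: "N \<noteq> 0" "g \<noteq> 0" using assms g by (auto simp: frob_monics_def)
  have "N * frob_poly Q g = N * g"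
    using assms(1,2) unfolding g by (simp add: frob_monics_def frob_mult1)
  then have "frob_poly Q g = g" using nz by simp
  moreover have "degree g = n - k"
    using assms(1,2) nz unfolding g frob_monics_def by (auto simp: degree_mult_eq)
  moreover have "lead_coeff g = 1"
    using assms(1,2) lead_coeff_mult[of N g] unfolding g frob_monics_def by auto
  ultimately show thesis using g by (intro that[of g]) (auto simp: frob_monics_def)
qed

text \<open>Both sides count the roots of the monic polynomials \<open>f\<close> of degree \<open>n\<close>, with multiplicity and weighted by
  \<open>\<chi>\<close>: by \<open>card_periods\<close>, each root \<open>\<alpha>\<close> of \<open>f\<close> has as many \<open>k\<close> for which the characteristic polynomial of \<open>\<alpha>\<close>
  of degree \<open>k\<close> divides \<open>f\<close> as its multiplicity says.\<close>

lemma newton_recurrence: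
  assumes \<chi>: "group_character (trunc_group Q l) (carrier (trunc_group Q l)) \<chi>"
  defines "A \<equiv> (\<lambda>n. \<Sum>f\<in>frob_monics Q n. \<chi> (short_class l (f :: 'k poly)))"
  shows "of_nat n * A n = (\<Sum>k=1..n. char_sum Q l \<chi> k * A (n - k))"
proof -
  let ?M = "\<lambda>n. frob_monics Q n :: 'k poly set" and ?F = "\<lambda>k. frob_field (Q ^ k) :: 'k set"
  let ?X = "\<lambda>f. \<chi> (short_class l f)"
  have X_mult: "?X (f * g) = ?X f * ?X g" if "f \<in> ?M m" "g \<in> ?M m'" for f g m m'
    using group_character_mult[OF \<chi> short_class_in_carrier[OF that(1)] short_class_in_carrier[OF that(2)]]
    by (simp add: short_class_mult trunc_group_def)
  have 1: "char_sum Q l \<chi> k * A (n - k) = (\<Sum>\<alpha>\<in>?F k. \<Sum>f | f \<in> ?M n \<and> conj_poly Q k \<alpha> dvd f. ?X f)"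
    if k: "k \<in> {1..n}" for k
    unfolding char_sum_def A_def sum_product
  proof (rule sum.cong[OF refl])
    fix \<alpha> assume \<alpha>: "\<alpha> \<in> ?F k"
    have N: "conj_poly Q k \<alpha> \<in> ?M k" using \<alpha> by (rule conj_poly_in_frob_monics)
    show "(\<Sum>g\<in>?M (n - k). ?X (conj_poly Q k \<alpha>) * ?X g) = (\<Sum>f | f \<in> ?M n \<and> conj_poly Q k \<alpha> dvd f. ?X f)"
    proof (rule sum.reindex_bij_betw[of "\<lambda>g. conj_poly Q k \<alpha> * g", THEN trans[rotated]])
      show "bij_betw (\<lambda>g. conj_poly Q k \<alpha> * g) (?M (n - k)) {f \<in> ?M n. conj_poly Q k \<alpha> dvd f}"
        unfolding bij_betw_def
      proof (intro conjI equalityI subsetI)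
        show "inj_on (\<lambda>g. conj_poly Q k \<alpha> * g) (?M (n - k))" by (auto simp: inj_on_def)
        show "f \<in> {f \<in> ?M n. conj_poly Q k \<alpha> dvd f}" if "f \<in> (\<lambda>g. conj_poly Q k \<alpha> * g) ` ?M (n - k)" for f
          using that frob_monics_mult[OF N, of _ "n - k"] k by auto
        show "f \<in> (\<lambda>g. conj_poly Q k \<alpha> * g) ` ?M (n - k)" if "f \<in> {f \<in> ?M n. conj_poly Q k \<alpha> dvd f}" for f
          using that frob_monics_divide[OF _ N, of f n] by blast
      qed
      show "(\<Sum>g\<in>?M (n - k). ?X (conj_poly Q k \<alpha>) * ?X g) = (\<Sum>g\<in>?M (n - k). ?X (conj_poly Q k \<alpha> * g))"
        by (intro sum.cong refl) (simp add: X_mult[OF N])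
    qed
  qed
  have Mfin: "finite (?M n)" and Ffin: "finite (?F k)" if "k \<ge> 1" for k
    using that finite_frob_monics card_frob_field(2) by auto
  have fM: "finite (?M n)" by (rule finite_frob_monics)
  have "(\<Sum>k=1..n. char_sum Q l \<chi> k * A (n - k))
      = (\<Sum>k=1..n. \<Sum>\<alpha>\<in>?F k. \<Sum>f | f \<in> ?M n \<and> conj_poly Q k \<alpha> dvd f. ?X f)"
    using 1 by (rule sum.cong[OF refl])
  also have "\<dots> = (\<Sum>k=1..n. \<Sum>f\<in>?M n. of_nat (card {\<alpha> \<in> ?F k. conj_poly Q k \<alpha> dvd f}) * ?X f)"
  proof (rule sum.cong[OF refl])
    fix k assume k: "k \<in> {1..n}"
    have "(\<Sum>\<alpha>\<in>?F k. \<Sum>f | f \<in> ?M n \<and> conj_poly Q k \<alpha> dvd f. ?X f)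
        = (\<Sum>f\<in>?M n. \<Sum>\<alpha> | \<alpha> \<in> ?F k \<and> conj_poly Q k \<alpha> dvd f. ?X f)"
      by (rule sum.swap_restrict) (use k fM Ffin in auto)
    then show "(\<Sum>\<alpha>\<in>?F k. \<Sum>f | f \<in> ?M n \<and> conj_poly Q k \<alpha> dvd f. ?X f)
        = (\<Sum>f\<in>?M n. of_nat (card {\<alpha> \<in> ?F k. conj_poly Q k \<alpha> dvd f}) * ?X f)"
      by simp
  qed
  also have "\<dots> = (\<Sum>f\<in>?M n. of_nat (\<Sum>k=1..n. card {\<alpha> \<in> ?F k. conj_poly Q k \<alpha> dvd f}) * ?X f)"
    by (subst sum.swap) (simp add: sum_distrib_right)
  also have "\<dots> = (\<Sum>f\<in>?M n. of_nat n * ?X f)"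
  proof (rule sum.cong[OF refl])
    fix f assume f: "f \<in> ?M n"
    then have f0: "f \<noteq> 0" "degree f = n" by (auto simp: frob_monics_def)
    let ?R = "{\<alpha>. poly f \<alpha> = 0}"
    have finR: "finite ?R" using f0 by (simp add: poly_roots_finite)
    have "card {\<alpha> \<in> ?F k. conj_poly Q k \<alpha> dvd f}
        = (\<Sum>\<alpha>\<in>?R. if \<alpha> \<in> ?F k \<and> conj_poly Q k \<alpha> dvd f then 1 else 0)" if k: "k \<in> {1..n}" for k
    proof -
      have "\<alpha> \<in> ?R" if dv: "conj_poly Q k \<alpha> dvd f" for \<alpha>
      proof -
        have "poly (conj_poly Q k \<alpha>) \<alpha> = 0" using k by (intro conj_poly_root) auto
        then show ?thesis using dv by (auto elim!: dvdE)
      qed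
      then have "{\<alpha> \<in> ?F k. conj_poly Q k \<alpha> dvd f} = {\<alpha> \<in> ?R. \<alpha> \<in> ?F k \<and> conj_poly Q k \<alpha> dvd f}"
        by blast
      then show ?thesis using finR by (simp add: sum.If_cases Int_def)
    qed
    then have "(\<Sum>k=1..n. card {\<alpha> \<in> ?F k. conj_poly Q k \<alpha> dvd f})
        = (\<Sum>\<alpha>\<in>?R. \<Sum>k=1..n. if \<alpha> \<in> ?F k \<and> conj_poly Q k \<alpha> dvd f then 1 else 0)"
      by (simp add: sum.swap[of _ ?R])
    also have "\<dots> = (\<Sum>\<alpha>\<in>?R. card {k \<in> {1..n}. \<alpha> \<in> ?F k \<and> conj_poly Q k \<alpha> dvd f})"
      by (simp add: sum.If_cases Int_def)
    also have "\<dots> = (\<Sum>\<alpha>\<in>?R. order \<alpha> f)"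
      using card_periods[OF f] by (intro sum.cong refl) simp
    also have "\<dots> = n" using sum_order_roots[OF f0(1)] f0(2) by simp
    finally show "of_nat (\<Sum>k=1..n. card {\<alpha> \<in> ?F k. conj_poly Q k \<alpha> dvd f}) * ?X f = of_nat n * ?X f"
      by simp
  qed
  finally show ?thesis by (simp add: A_def sum_distrib_left)
qed

text \<open>The \<open>L\<close>-function of a nontrivial character is a polynomial, because its coefficients in degrees
  \<open>n \<ge> l\<close> vanish by \<open>sum_character_frob_monics\<close>.\<close>

lemma char_sum_roots:
  assumes \<chi>: "group_character (trunc_group Q l) (carrier (trunc_group Q l)) \<chi>"
    and g0: "(g0 :: 'k poly) \<in> carrier (trunc_group Q l)" "\<chi> g0 \<noteq> 1"
  obtains d \<gamma> where "\<And>n. n \<ge> 1 \<Longrightarrow> char_sum Q l \<chi> n = - (\<Sum>i<(d::nat). \<gamma> i ^ n)"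
proof -
  define A where "A = (\<lambda>n. \<Sum>f\<in>frob_monics Q n. \<chi> (short_class l (f :: 'k poly)))"
  have "frob_monics Q 0 = {1 :: 'k poly}"
    using frob_1[of 1] by (auto simp: frob_monics_def one_pCons elim!: degree_eq_zeroE)
  moreover have "\<chi> 1 = 1"
    using group_character_one[OF \<chi>] by (simp add: trunc_group_def)
  ultimately have "A 0 = 1"
    by (simp add: A_def short_class_def)
  moreover have "A n = 0" if "n \<ge> l" for n
    unfolding A_def using that \<chi> g0 by (rule sum_character_frob_monics)
  moreover have "of_nat n * A n = (\<Sum>k=1..n. char_sum Q l \<chi> k * A (n - k))" for n
    unfolding A_def by (rule newton_recurrence[OF \<chi>])
  ultimately show thesis
    using power_sums_of_newton_recurrence[of A l "char_sum Q l \<chi>"] that by metis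
qed

lemma char_sum_trivial:
  assumes "n \<ge> 1" "\<And>g. (g :: 'k poly) \<in> carrier (trunc_group Q l) \<Longrightarrow> \<chi> g = 1"
  shows "char_sum Q l \<chi> n = of_nat Q ^ n"
proof -
  have "char_sum Q l \<chi> n = (\<Sum>\<alpha>\<in>(frob_field (Q ^ n) :: 'k set). 1)"
    unfolding char_sum_def
    by (intro sum.cong refl assms(2) short_class_in_carrier[OF conj_poly_in_frob_monics])
  then show ?thesis using card_frob_field(1)[OF assms(1)] by simp
qed

lemma char_sum_cong:
  assumes "\<And>g. (g :: 'k poly) \<in> carrier (trunc_group Q l) \<Longrightarrow> \<chi> g = \<chi>' g"
  shows "char_sum Q l \<chi> n = char_sum Q l \<chi>' n"
  unfolding char_sum_def
  by (intro sum.cong refl assms short_class_in_carrier[OF conj_poly_in_frob_monics])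

end

lemma poly_cutoff_mult_cong:
  fixes f g f' g' :: "'a::field poly"
  assumes "poly_cutoff n f = poly_cutoff n f'" "poly_cutoff n g = poly_cutoff n g'"
  shows "poly_cutoff n (f * g) = poly_cutoff n (f' * g')"
proof -
  have *: "poly_cutoff n (a * b) = poly_cutoff n (poly_cutoff n a * poly_cutoff n b)" for a b :: "'a poly"
    by (simp only: poly_cutoff_mult)
  have "poly_cutoff n (f * g) = poly_cutoff n (poly_cutoff n f * poly_cutoff n g)" by (rule *)
  also have "\<dots> = poly_cutoff n (poly_cutoff n f' * poly_cutoff n g')" by (simp only: assms)
  also have "\<dots> = poly_cutoff n (f' * g')" by (rule *[symmetric])
  finally show ?thesis .
qed

lemma poly_cutoff_prod_cong:
  fixes f g :: "'i \<Rightarrow> 'a::field poly"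
  assumes "\<And>i. i \<in> I \<Longrightarrow> poly_cutoff n (f i) = poly_cutoff n (g i)"
  shows "poly_cutoff n (\<Prod>i\<in>I. f i) = poly_cutoff n (\<Prod>i\<in>I. g i)"
  using assms
  by (induction I rule: infinite_finite_induct) (auto intro: poly_cutoff_mult_cong)

lemma poly_cutoff_power: "poly_cutoff n (poly_cutoff n f ^ k) = poly_cutoff n (f ^ k :: 'a::field poly)"
proof (induction k)
  case (Suc k)
  have "poly_cutoff n (poly_cutoff n f * poly_cutoff n f ^ k) = poly_cutoff n (f * f ^ k)"
    by (rule poly_cutoff_mult_cong[OF _ Suc]) (simp add: poly_cutoff_cutoff)
  then show ?case by simp
qed simp

section \<open>Characters over the prime field\<close>

lemma trunc_group_pow:
  assumes "x \<in> carrier (trunc_group Q l)"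
  shows "x [^]\<^bsub>trunc_group Q l\<^esub> (n :: nat) = poly_cutoff (Suc l) (x ^ n)"
proof (induction n)
  case 0
  then show ?case by (simp add: trunc_group_def)
next
  case (Suc n)
  then show ?case
    by (simp add: nat_pow_def) (simp add: trunc_group_def poly_cutoff_mult mult.commute)
qed

locale prime_frobenius = frobenius p 1 p K for p :: nat and K :: "'k::alg_closed_field itself"
begin

lemma of_nat_eq_iff: "(of_nat a :: 'k) = of_nat b \<longleftrightarrow> [a = b] (mod p)"
  using char by (simp add: of_nat_eq_iff_cong_CHAR)

lemma of_nat_in_frob_field: "(of_nat a :: 'k) \<in> frob_field p"
proof (induction a)
  case 0
  show ?case using frob_field_0 by simp
next
  case (Suc a)
  have "(1 :: 'k) \<in> frob_field p" by (simp add: frob_field_def)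
  with Suc show ?case using frob_field_add[of 1 "of_nat a"] by simp
qed

lemma frob_field_eq: "frob_field p = (of_nat ` {..<p} :: 'k set)"
proof (rule card_subset_eq[symmetric])
  have inj: "inj_on (of_nat :: nat \<Rightarrow> 'k) {..<p}"
    by (auto simp: inj_on_def of_nat_eq_iff cong_less_modulus_unique_nat)
  show "card (of_nat ` {..<p} :: 'k set) = card (frob_field p :: 'k set)"
    using card_frob_field(1)[of 1] inj by (simp add: card_image)
  show "finite (frob_field p :: 'k set)" using card_frob_field(2)[of 1] by simp
qed (use of_nat_in_frob_field in auto)

lemma frob_field_mult: "(x :: 'k) \<in> frob_field p \<Longrightarrow> y \<in> frob_field p \<Longrightarrow> x * y \<in> frob_field p"
  by (simp add: frob_field_def power_mult_distrib)

lemma frob_field_power: "(x :: 'k) \<in> frob_field p \<Longrightarrow> x ^ n \<in> frob_field p"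
  by (simp add: frob_field_def mult.commute[of n] power_mult flip: power_mult[of x n p])

lemma frob_field_numeral: "(numeral w :: 'k) \<in> frob_field p"
  using of_nat_in_frob_field[of "numeral w"] by simp

lemma linear_in_trunc_group:
  assumes "l \<ge> 1" "a \<in> frob_field p"
  shows "[:1, a :: 'k:] \<in> carrier (trunc_group p l)"
  using assms frob_fixed_iff[of 1 "[:1, a:]"] frob_field_0 of_nat_in_frob_field[of 1]
  by (auto simp: trunc_group_def coeff_pCons split: nat.split intro: order.trans[OF degree_pCons_le])

lemma char_sum_1:
  assumes "l \<ge> 1"
  shows "char_sum p l (\<chi> :: 'k poly \<Rightarrow> complex) 1 = (\<Sum>a<p. \<chi> [:1, of_nat a:])"
proof -
  have "short_class l (conj_poly p 1 \<alpha>) = [:1, - \<alpha>:]" for \<alpha> :: 'k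
  proof -
    have "reflect_poly [:- \<alpha>, 1:] = [:1, - \<alpha>:]"
      by (simp add: reflect_poly_def Poly_append)
    moreover have "degree [:1, - \<alpha>:] \<le> l" using assms by simp
    ultimately show ?thesis
      by (simp add: short_class_def conj_poly_def poly_cutoff_id)
  qed
  then have "char_sum p l \<chi> 1 = (\<Sum>\<alpha>\<in>frob_field p. \<chi> [:1, - \<alpha>:])"
    by (simp add: char_sum_def)
  also have "\<dots> = (\<Sum>\<alpha>\<in>frob_field p. \<chi> [:1, \<alpha>:])"
    using frob_field_diff[of 0] frob_field_0
    by (intro sum.reindex_bij_witness[of _ uminus uminus]) auto
  also have "\<dots> = (\<Sum>a<p. \<chi> [:1, of_nat a:])"
    unfolding frob_field_eq
    by (subst sum.reindex) (auto simp: inj_on_def of_nat_eq_iff cong_less_modulus_unique_nat)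
  finally show ?thesis .
qed

text \<open>
  The additive character of the prime field that sends \<open>1\<close> to \<open>\<zeta>\<close>. The choice of \<open>a\<close> does not matter
  when \<open>\<zeta> ^ p = 1\<close>.
\<close>

definition add_char :: "complex \<Rightarrow> 'k \<Rightarrow> complex" where
  "add_char \<zeta> x = \<zeta> ^ (SOME a. x = of_nat a)"

lemma add_char_of_nat:
  assumes "\<zeta> ^ p = 1"
  shows "add_char \<zeta> (of_nat a) = \<zeta> ^ a"
proof -
  have \<zeta>: "\<zeta> ^ a = \<zeta> ^ (a mod p)" for a
  proof -
    have "\<zeta> ^ a = \<zeta> ^ (p * (a div p) + a mod p)" by simp
    also have "\<dots> = \<zeta> ^ (a mod p)" by (simp only: power_add power_mult assms power_one mult_1)
    finally show ?thesis .
  qed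
  define b where "b = (SOME b. (of_nat a :: 'k) = of_nat b)"
  have "(of_nat a :: 'k) = of_nat b" unfolding b_def by (rule someI[of _ a]) simp
  then have "a mod p = b mod p" by (simp add: of_nat_eq_iff cong_def)
  then have "\<zeta> ^ b = \<zeta> ^ a" using \<zeta>[of a] \<zeta>[of b] by simp
  then show ?thesis by (simp add: add_char_def b_def)
qed

lemma add_char_add:
  assumes "\<zeta> ^ p = 1" "x \<in> frob_field p" "y \<in> frob_field p"
  shows "add_char \<zeta> (x + y) = add_char \<zeta> x * add_char \<zeta> y"
proof -
  obtain a b where "x = of_nat a" "y = of_nat b" using assms(2,3) by (auto simp: frob_field_eq)
  then show ?thesis
    using add_char_of_nat[OF assms(1)] by (metis of_nat_add power_add)
qed

lemma additive_character:
  fixes \<phi> :: "'k poly \<Rightarrow> 'k"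
  assumes \<zeta>: "\<zeta> ^ p = 1"
    and mem: "\<And>g. (\<And>n. coeff g n \<in> frob_field p) \<Longrightarrow> \<phi> g \<in> frob_field p"
    and add: "\<And>g h. coeff g 0 = 1 \<Longrightarrow> coeff h 0 = 1 \<Longrightarrow>
      \<phi> (poly_cutoff (Suc l) (g * h)) = \<phi> g + \<phi> h"
  shows "group_character (trunc_group p l) (carrier (trunc_group p l)) (\<lambda>g. add_char \<zeta> (\<phi> g))"
proof -
  have "\<phi> (poly_cutoff (Suc l) (1 * 1)) = \<phi> 1 + \<phi> 1" by (rule add) simp_all
  moreover have "poly_cutoff (Suc l) (1 * 1) = (1 :: 'k poly)" by simp
  ultimately have "\<phi> 1 = 0" by (metis add_cancel_right_right)
  then have 1: "add_char \<zeta> (\<phi> 1) = 1" using add_char_of_nat[OF \<zeta>, of 0] by simp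
  have "\<phi> g \<in> frob_field p" if "g \<in> carrier (trunc_group p l)" for g
    using that frob_fixed_iff[of 1 g] by (intro mem) (auto simp: trunc_group_def)
  then show ?thesis
    using 1 unfolding group_character_def
    by (auto simp: trunc_group_def add add_char_add[OF \<zeta>])
qed

lemma coeff_mult_small:
  fixes g h :: "'k poly"
  assumes "coeff g 0 = 1" "coeff h 0 = 1"
  shows "coeff (g * h) 1 = coeff g 1 + coeff h 1"
    and "coeff (g * h) 2 = coeff g 2 + coeff g 1 * coeff h 1 + coeff h 2"
    and "coeff (g * h) 3 = coeff g 3 + coeff g 2 * coeff h 1 + coeff g 1 * coeff h 2 + coeff h 3"
    and "coeff (g * h) 4 = coeff g 4 + coeff g 3 * coeff h 1 + coeff g 2 * coeff h 2
      + coeff g 1 * coeff h 3 + coeff h 4"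
  using assms by (simp_all add: coeff_mult eval_nat_numeral)

text \<open>
  Multiplicative characters that come from power sums of the roots, which are additive under
  multiplication of polynomials. By Newton's identities, the following \<open>\<phi>\<close> are \<open>- (p\<^sub>3 + p\<^sub>1)\<close> and \<open>p\<^sub>4\<close>,
  where \<open>p\<^sub>k\<close> is the sum of the \<open>k\<close>-th powers of the \<open>\<alpha>\<^sub>i\<close> in \<open>1 + a\<^sub>1 u + a\<^sub>2 u\<^sup>2 + \<dots> = \<Prod> (1 - \<alpha>\<^sub>i u)\<close>.
  The linear term \<open>p\<^sub>1\<close> is there because \<open>\<Sum> \<zeta> ^ (a ^ 3)\<close> vanishes when \<open>p \<equiv> 2\<close> modulo 3.
\<close>

lemma cubic_character:
  assumes \<zeta>: "\<zeta> ^ p = 1"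
  obtains \<chi> where "group_character (trunc_group p 3) (carrier (trunc_group p 3 :: 'k poly monoid)) \<chi>"
    "\<And>a. \<chi> [:1, of_nat a:] = \<zeta> ^ (a ^ 3 + a)"
proof -
  define \<phi> :: "'k poly \<Rightarrow> 'k" where
    "\<phi> = (\<lambda>g. 3 * coeff g 3 - 3 * coeff g 1 * coeff g 2 + coeff g 1 ^ 3 + coeff g 1)"
  show thesis
  proof (rule that[of "\<lambda>g. add_char \<zeta> (\<phi> g)"])
    show "group_character (trunc_group p 3) (carrier (trunc_group p 3)) (\<lambda>g. add_char \<zeta> (\<phi> g))"
    proof (rule additive_character[OF \<zeta>])
      show "\<phi> g \<in> frob_field p" if "\<And>n. coeff g n \<in> frob_field p" for g
        unfolding \<phi>_def
        by (intro frob_field_add frob_field_diff frob_field_mult frob_field_power frob_field_numeral that)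
      show "\<phi> (poly_cutoff (Suc 3) (g * h)) = \<phi> g + \<phi> h" if "coeff g 0 = 1" "coeff h 0 = 1" for g h
        unfolding \<phi>_def coeff_poly_cutoff
        by (simp add: coeff_mult_small[OF that, simplified] power3_eq_cube algebra_simps)
    qed
    show "add_char \<zeta> (\<phi> [:1, of_nat a:]) = \<zeta> ^ (a ^ 3 + a)" for a
    proof -
      have "\<phi> [:1, of_nat a:] = of_nat (a ^ 3 + a)"
        by (simp add: \<phi>_def coeff_pCons eval_nat_numeral)
      then show ?thesis using add_char_of_nat[OF \<zeta>] by (simp only:)
    qed
  qed
qed

lemma quartic_character:
  assumes \<zeta>: "\<zeta> ^ p = 1"
  obtains \<chi> where "group_character (trunc_group p 4) (carrier (trunc_group p 4 :: 'k poly monoid)) \<chi>"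
    "\<And>a. \<chi> [:1, of_nat a:] = \<zeta> ^ (a ^ 4)"
proof -
  define \<phi> :: "'k poly \<Rightarrow> 'k" where
    "\<phi> = (\<lambda>g. 4 * coeff g 1 * coeff g 3 - 4 * coeff g 4 + 2 * coeff g 2 ^ 2
          - 4 * coeff g 1 ^ 2 * coeff g 2 + coeff g 1 ^ 4)"
  show thesis
  proof (rule that[of "\<lambda>g. add_char \<zeta> (\<phi> g)"])
    show "group_character (trunc_group p 4) (carrier (trunc_group p 4)) (\<lambda>g. add_char \<zeta> (\<phi> g))"
    proof (rule additive_character[OF \<zeta>])
      show "\<phi> g \<in> frob_field p" if "\<And>n. coeff g n \<in> frob_field p" for g
        unfolding \<phi>_def
        by (intro frob_field_add frob_field_diff frob_field_mult frob_field_power frob_field_numeral that)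
      show "\<phi> (poly_cutoff (Suc 4) (g * h)) = \<phi> g + \<phi> h" if "coeff g 0 = 1" "coeff h 0 = 1" for g h
        unfolding \<phi>_def coeff_poly_cutoff
        by (simp add: coeff_mult_small[OF that, simplified] power4_eq_xxxx power2_eq_square algebra_simps)
    qed
    show "add_char \<zeta> (\<phi> [:1, of_nat a:]) = \<zeta> ^ (a ^ 4)" for a
    proof -
      have "\<phi> [:1, of_nat a:] = of_nat (a ^ 4)"
        by (simp add: \<phi>_def coeff_pCons eval_nat_numeral)
      then show ?thesis using add_char_of_nat[OF \<zeta>] by (simp only:)
    qed
  qed
qed

lemma one_plus_X_power: "[:1, 1 :: 'k:] ^ (p ^ n) = 1 + monom 1 (p ^ n)"
proof -
  have "[:1, 1 :: 'k:] = 1 + monom 1 1" by (simp add: poly_eq_iff coeff_pCons one_pCons split: nat.split)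
  moreover have "(1 + monom 1 1 :: 'k poly) ^ (p ^ n) = 1 ^ (p ^ n) + monom 1 1 ^ (p ^ n)"
    by (rule freshmans_dream'[of _ n]) (use p char in auto)
  ultimately show ?thesis by (simp add: monom_power)
qed

text \<open>For every \<open>p\<close> and the least admissible \<open>l\<close>, a character over the prime field whose \<open>L\<close>-function is not
  supersingular. For \<open>p \<in> {2, 3}\<close> the character comes from the extension theorem, with a primitive root
  of unity of order \<open>8\<close> or \<open>9\<close>, the order of \<open>1 + u\<close>, as its value at \<open>1 + u\<close>; for \<open>p = 3\<close> the value at
  \<open>1 - u\<close> is then known up to a cube root of unity. The factor \<open>72\<close> makes room for these roots of unity.\<close>

lemma bad_character:
  assumes l0: "l0 = (if p = 2 \<or> p = 5 then 4 else 3)"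
    and z: "z ^ M = 1" "M > 0" and roots: "\<And>w. w ^ (72 * p) = 1 \<Longrightarrow> w \<in> int_adjoin z"
  shows "\<exists>\<chi> g. group_character (trunc_group p l0) (carrier (trunc_group p l0 :: 'k poly monoid)) \<chi> \<and>
    g \<in> carrier (trunc_group p l0) \<and> \<chi> g \<noteq> 1 \<and>
    (\<forall>\<beta>\<in>int_adjoin z. (char_sum p l0 \<chi> 1)\<^sup>2 \<noteq> of_nat p * \<beta>)"
proof -
  let ?G = "trunc_group p l0 :: 'k poly monoid" and ?g = "[:1, 1 :: 'k:]"
  interpret G: comm_group ?G by (rule trunc_group)
  have l01: "l0 \<ge> 1" using l0 by simp
  have gG: "?g \<in> carrier ?G" using linear_in_trunc_group[OF l01 of_nat_in_frob_field[of 1]] by simp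
  have pow1: "?g [^]\<^bsub>?G\<^esub> (p ^ n) = \<one>\<^bsub>?G\<^esub>" if "p ^ n > l0" for n
    using that unfolding trunc_group_pow[OF gG] one_plus_X_power
    by (auto simp: trunc_group_def poly_eq_iff coeff_poly_cutoff)
  have pow2: "?g [^]\<^bsub>?G\<^esub> (p ^ n) \<noteq> \<one>\<^bsub>?G\<^esub>" if "p ^ n \<le> l0" for n
  proof
    assume "?g [^]\<^bsub>?G\<^esub> (p ^ n) = \<one>\<^bsub>?G\<^esub>"
    then have "coeff (poly_cutoff (Suc l0) (1 + monom (1 :: 'k) (p ^ n))) (p ^ n) = coeff 1 (p ^ n)"
      unfolding trunc_group_pow[OF gG] one_plus_X_power by (simp add: trunc_group_def)
    then show False using that p by (simp add: coeff_poly_cutoff prime_gt_0_nat)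
  qed
  have roots': "w \<in> int_adjoin z" if w: "w ^ k = 1" "k dvd 72 * p" for w k
  proof -
    obtain c where "72 * p = k * c" using w(2) by (elim dvdE)
    then have "w ^ (72 * p) = 1" by (simp only: power_mult w(1) power_one)
    then show ?thesis by (rule roots)
  qed
  have "p \<ge> 2" using prime_ge_2_nat[OF p] .
  have "\<not> prime (4 :: nat)" "\<not> prime (6 :: nat)" by simp_all
  then have "p \<noteq> 4" "p \<noteq> 6" using p by auto
  with \<open>p \<ge> 2\<close> consider "p = 2" | "p = 3" | "p = 5" | "p \<ge> 7" by linarith
  then show ?thesis
  proof cases
    case 1
    obtain w :: complex where w: "w ^ 4 = - 1" using nth_root_exists[of 4 "- 1 :: complex"] by auto
    then have "w ^ (2 ^ Suc 2) = 1" using power_mult[of w 4 2] by simp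
    then obtain \<chi> where \<chi>: "group_character ?G (carrier ?G) \<chi>" "\<chi> ?g = w"
      using G.character_of_prime_power_order[OF finite_card_trunc_group(1) gG p, of 2 w] pow1[of 3] pow2[of 2]
      by (auto simp: l0 1)
    have "\<chi> 1 = 1" using group_character_one[OF \<chi>(1)] by (simp add: trunc_group_def)
    then have "char_sum p l0 \<chi> 1 = 1 + w"
      using \<chi>(2) unfolding char_sum_1[OF l01] by (simp add: 1 numeral_2_eq_2 one_pCons)
    moreover have "w \<in> int_adjoin z" using \<open>w ^ (2 ^ Suc 2) = 1\<close> by (intro roots'[of w 8]) (auto simp: 1)
    ultimately have "(char_sum p l0 \<chi> 1)\<^sup>2 \<noteq> of_nat p * \<beta>" if "\<beta> \<in> int_adjoin z" for \<beta>
      using eighth_root_sum[OF z w _ that] by (simp add: 1)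
    moreover have "\<chi> ?g \<noteq> 1" unfolding \<chi>(2) using w by auto
    ultimately show ?thesis using \<chi>(1) gG by blast
  next
    case 2
    obtain v :: complex where v: "v ^ 3 = 1" "v \<noteq> 1" using nontrivial_root_of_unity[of 3] by auto
    obtain w :: complex where w3: "w ^ 3 = v" using nth_root_exists[of 3 v] by auto
    have w9: "w ^ 9 = 1" using power_mult[of w 3 3] v w3 by simp
    have "(w ^ 3 - 1) * (w ^ 6 + w ^ 3 + 1) = w ^ 9 - 1"
      by (simp add: algebra_simps flip: power_add)
    then have w: "w ^ 6 + w ^ 3 + 1 = 0" using w9 w3 v by simp
    obtain \<chi> where \<chi>: "group_character ?G (carrier ?G) \<chi>" "\<chi> ?g = w"
      using G.character_of_prime_power_order[OF finite_card_trunc_group(1) gG p, of 1 w] pow1[of 2] pow2[of 1] w9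
      by (auto simp: l0 2)
    have \<chi>1: "\<chi> 1 = 1" using group_character_one[OF \<chi>(1)] by (simp add: trunc_group_def)
    let ?h = "[:1, 2 :: 'k:]"
    have hG: "?h \<in> carrier ?G" using linear_in_trunc_group[OF l01 of_nat_in_frob_field[of 2]] by simp
    define u where "u = w * \<chi> ?h"
    \<comment> \<open>\<open>?h\<close> is \<open>1 - u\<close> because the characteristic is 3; the cube of \<open>1 - u\<^sup>2\<close> is trivial modulo \<open>u ^ 4\<close>\<close>
    have three: "(3 :: 'k) = 0" using of_nat_eq_0_iff_char_dvd[of 3, where 'a = 'k] char 2 by simp
    have "u = \<chi> (?g \<otimes>\<^bsub>?G\<^esub> ?h)" using group_character_mult[OF \<chi>(1) gG hG] \<chi>(2) by (simp add: u_def)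
    then have "u ^ 3 = \<chi> ((?g \<otimes>\<^bsub>?G\<^esub> ?h) [^]\<^bsub>?G\<^esub> (3 :: nat))"
      using G.group_character_pow[OF \<chi>(1) G.subgroup_self] gG hG by simp
    also have "(?g \<otimes>\<^bsub>?G\<^esub> ?h) [^]\<^bsub>?G\<^esub> (3 :: nat) = 1"
    proof -
      have gh: "?g * ?h = 1 + monom 2 2"
        using three by (auto simp: poly_eq_iff coeff_pCons one_pCons split: nat.split)
      have "(1 + monom 2 2 :: 'k poly) ^ 3 = 1 ^ 3 + monom 2 2 ^ 3"
        by (rule freshmans_dream) (use p char 2 in auto)
      also have "\<dots> = 1 + monom 8 6" by (simp add: monom_power)
      finally have "(?g * ?h) ^ 3 = 1 + monom 8 6" unfolding gh .
      then have "poly_cutoff (Suc l0) ((?g * ?h) ^ 3) = 1"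
        by (auto simp: l0 2 poly_eq_iff coeff_poly_cutoff)
      then have "poly_cutoff (Suc l0) ((poly_cutoff (Suc l0) (?g * ?h)) ^ 3) = 1"
        by (simp only: poly_cutoff_power)
      moreover have "(?g \<otimes>\<^bsub>?G\<^esub> ?h) [^]\<^bsub>?G\<^esub> (3 :: nat) = poly_cutoff (Suc l0) ((poly_cutoff (Suc l0) (?g * ?h)) ^ 3)"
        using trunc_group_pow[OF G.m_closed[OF gG hG], of 3] by (simp add: trunc_group_def)
      ultimately show ?thesis by (simp only:)
    qed
    finally have u3: "u ^ 3 = 1" using \<chi>1 by simp
    have "char_sum p l0 \<chi> 1 * w = w + w\<^sup>2 + u"
      using \<chi>(2) \<chi>1 unfolding char_sum_1[OF l01]
      by (simp add: 2 numeral_3_eq_3 one_pCons u_def algebra_simps power2_eq_square)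
    then have "(w + w\<^sup>2 + u)\<^sup>2 = (char_sum p l0 \<chi> 1)\<^sup>2 * w\<^sup>2" by (metis power_mult_distrib)
    moreover have wz: "w \<in> int_adjoin z" using w9 by (intro roots'[of w 9]) (auto simp: 2)
    ultimately have "(char_sum p l0 \<chi> 1)\<^sup>2 \<noteq> of_nat p * \<beta>" if "\<beta> \<in> int_adjoin z" for \<beta>
      using ninth_root_sum[OF z w wz u3, of "\<beta> * w\<^sup>2"] int_adjoin_mult[OF that int_adjoin_power[OF wz, of 2]]
      by (auto simp: 2 mult.assoc)
    moreover have "\<chi> ?g \<noteq> 1" unfolding \<chi>(2) using w by auto
    ultimately show ?thesis using \<chi>(1) gG by blast
  next
    case 3
    obtain \<zeta> :: complex where \<zeta>: "\<zeta> ^ 5 = 1" "\<zeta> \<noteq> 1" using nontrivial_root_of_unity[of 5] by auto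
    obtain \<chi> where \<chi>: "group_character ?G (carrier ?G) \<chi>" "\<And>a. \<chi> [:1, of_nat a:] = \<zeta> ^ (a ^ 4)"
      using quartic_character[of \<zeta>] \<zeta> by (auto simp: l0 3)
    have red: "\<zeta> ^ (5 * k + 1) = \<zeta>" for k by (simp add: power_add power_mult \<zeta>)
    have s: "\<zeta> ^ 16 = \<zeta>" "\<zeta> ^ 81 = \<zeta>" "\<zeta> ^ 256 = \<zeta>"
      using red[of 3] red[of 16] red[of 51] by simp_all
    have "{..<5} = {0, 1, 2, 3, 4 :: nat}" by auto
    then have "char_sum p l0 \<chi> 1 = 1 + 4 * \<zeta>"
      unfolding char_sum_1[OF l01] \<chi>(2) by (simp add: 3 s)
    moreover have "\<zeta> \<in> int_adjoin z" using \<zeta> by (intro roots'[of \<zeta> 5]) (auto simp: 3)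
    ultimately have "(char_sum p l0 \<chi> 1)\<^sup>2 \<noteq> of_nat p * \<beta>" if "\<beta> \<in> int_adjoin z" for \<beta>
      using quartic_exponential_sum_5[OF z \<zeta> _ that] by (simp add: 3)
    moreover have "\<chi> ?g \<noteq> 1" using \<chi>(2)[of 1] \<zeta> by simp
    ultimately show ?thesis using \<chi>(1) gG by blast
  next
    case 4
    obtain \<zeta> :: complex where \<zeta>: "\<zeta> ^ p = 1" "\<zeta> \<noteq> 1" using nontrivial_root_of_unity[of p] 4 by auto
    obtain \<chi> where \<chi>: "group_character ?G (carrier ?G) \<chi>" "\<And>a. \<chi> [:1, of_nat a:] = \<zeta> ^ (a ^ 3 + a)"
      using cubic_character[OF \<zeta>(1)] 4 by (auto simp: l0)
    have "\<zeta> ^ 2 \<noteq> 1"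
    proof
      assume sq: "\<zeta> ^ 2 = 1"
      have "odd p" using prime_odd_nat[OF p] 4 by simp
      then obtain k where "p = 2 * k + 1" by (elim oddE)
      then have "\<zeta> ^ p = \<zeta>" by (simp only: power_add power_mult sq) simp
      then show False using \<zeta> by simp
    qed
    then have "\<chi> ?g \<noteq> 1" using \<chi>(2)[of 1] by (simp add: numeral_2_eq_2)
    moreover have "\<zeta> \<in> int_adjoin z" using \<zeta> by (intro roots'[of \<zeta> p]) auto
    then have "(char_sum p l0 \<chi> 1)\<^sup>2 \<noteq> of_nat p * \<beta>" if "\<beta> \<in> int_adjoin z" for \<beta>
      unfolding char_sum_1[OF l01] \<chi>(2) using cubic_exponential_sum[OF z p 4 \<zeta> _ that] by simp
    ultimately show ?thesis using \<chi>(1) gG by blast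
  qed
qed

end

section \<open>Norms to the prime field\<close>

text \<open>
  The norm from the field with \<open>p ^ r\<close> elements down to the prime field, as the product of the Galois
  conjugates, followed by truncation.
\<close>

definition norm_class :: "nat \<Rightarrow> nat \<Rightarrow> nat \<Rightarrow> 'k::field poly \<Rightarrow> 'k poly" where
  "norm_class p r l g = poly_cutoff (Suc l) (\<Prod>i<r. frob_poly (p ^ i) g)"

locale frobenius_tower = base: prime_frobenius p K + top: frobenius p r q K
  for p r q :: nat and K :: "'k::alg_closed_field itself"
begin

lemma q: "q = p ^ r" by (rule top.Q)

lemma norm_class_in_carrier:
  assumes g: "(g :: 'k poly) \<in> carrier (trunc_group q l)"
  shows "norm_class p r l0 g \<in> carrier (trunc_group p l0)"
proof -
  have fq: "frob_poly (p ^ r) g = g" and g0: "coeff g 0 = 1"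
    using g by (simp_all add: trunc_group_def q)
  define F where "F = (\<lambda>i. frob_poly (p ^ i) g)"
  have "frob_poly (p ^ 1) (\<Prod>i<r. F i) = (\<Prod>i<r. F (Suc i))"
    unfolding base.frob_prod F_def base.frob_frob by simp
  moreover have "F 0 * (\<Prod>i<r. F (Suc i)) = (\<Prod>i<Suc r. F i)"
    by (simp only: prod.lessThan_Suc_shift)
  moreover have "(\<Prod>i<Suc r. F i) = F 0 * (\<Prod>i<r. F i)"
    using fq base.frob_frob[of 0 0 g] by (simp add: F_def mult.commute frob_poly_def)
  moreover have "F 0 \<noteq> 0" using g0 by (auto simp: F_def frob_poly_def)
  ultimately have "frob_poly p (\<Prod>i<r. F i) = (\<Prod>i<r. F i)"
    by (metis mult_left_cancel power_one_right)
  moreover have "coeff (\<Prod>i<r. F i) 0 = 1"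
  proof -
    have "coeff (F i) 0 = 1" for i using g0 by (simp add: F_def base.coeff_frob)
    then show ?thesis unfolding poly_0_coeff_0[symmetric] poly_prod by (simp add: poly_0_coeff_0)
  qed
  ultimately show ?thesis
    by (simp add: trunc_group_def norm_class_def F_def coeff_poly_cutoff degree_poly_cutoff base.frob_cutoff1)
qed

lemma norm_class_mult:
  assumes l: "l0 \<le> l"
  shows "norm_class p r l0 (poly_cutoff (Suc l) (g * h))
       = poly_cutoff (Suc l0) (norm_class p r l0 g * norm_class p r l0 (h :: 'k poly))"
proof -
  have "norm_class p r l0 (poly_cutoff (Suc l) (g * h))
      = poly_cutoff (Suc l0) (\<Prod>i<r. frob_poly (p ^ i) g * frob_poly (p ^ i) h)"
    unfolding norm_class_def using l
    by (intro poly_cutoff_prod_cong) (simp add: base.frob_cutoff base.frob_mult poly_cutoff_cutoff)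
  then show ?thesis
    by (simp add: norm_class_def prod.distrib poly_cutoff_mult)
qed

lemma character_norm:
  assumes \<chi>: "group_character (trunc_group p l0) (carrier (trunc_group p l0 :: 'k poly monoid)) \<chi>" and l: "l0 \<le> l"
  shows "group_character (trunc_group q l) (carrier (trunc_group q l)) (\<chi> \<circ> norm_class p r l0)"
proof -
  have "norm_class p r l0 (1 :: 'k poly) = 1"
    by (simp add: norm_class_def base.frob_1)
  then have "(\<chi> \<circ> norm_class p r l0) 1 = 1"
    using group_character_one[OF \<chi>] by (simp add: trunc_group_def)
  moreover have "\<chi> (norm_class p r l0 (poly_cutoff (Suc l) (g * h)))
      = \<chi> (norm_class p r l0 g) * \<chi> (norm_class p r l0 h)"
    if "g \<in> carrier (trunc_group q l)" "h \<in> carrier (trunc_group q l)" for g h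
    using group_character_mult[OF \<chi> norm_class_in_carrier[OF that(1), of l0] norm_class_in_carrier[OF that(2), of l0]]
    by (simp add: norm_class_mult[OF l] trunc_group_def)
  ultimately show ?thesis
    by (simp add: group_character_def trunc_group_def)
qed

text \<open>Transitivity of the norm.\<close>

lemma conj_poly_norm:
  "conj_poly p (r * n) \<alpha> = (\<Prod>j<r. frob_poly (p ^ j) (conj_poly q n (\<alpha> :: 'k)))"
proof -
  have "conj_poly p (r * n) \<alpha> = (\<Prod>i<n. \<Prod>m\<in>{i * r..<i * r + r}. [:- (\<alpha> ^ (p ^ m)), 1:])"
    unfolding conj_poly_def by (simp add: prod.nat_group mult.commute)
  also have "\<dots> = (\<Prod>i<n. \<Prod>j<r. frob_poly (p ^ j) [:- (\<alpha> ^ (q ^ i)), 1:])"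
  proof (rule prod.cong[OF refl])
    fix i
    have "(\<Prod>m\<in>{i * r..<i * r + r}. [:- (\<alpha> ^ (p ^ m)), 1:]) = (\<Prod>j<r. [:- (\<alpha> ^ (p ^ (i * r + j))), 1:])"
      by (rule prod.reindex_bij_witness[of _ "\<lambda>j. i * r + j" "\<lambda>m. m - i * r"]) auto
    also have "\<dots> = (\<Prod>j<r. frob_poly (p ^ j) [:- (\<alpha> ^ (q ^ i)), 1:])"
      unfolding base.frob_linear q
      by (intro prod.cong refl) (simp add: power_add mult.commute flip: power_mult)
    finally show "(\<Prod>m\<in>{i * r..<i * r + r}. [:- (\<alpha> ^ (p ^ m)), 1:])
        = (\<Prod>j<r. frob_poly (p ^ j) [:- (\<alpha> ^ (q ^ i)), 1:])" .
  qed
  also have "\<dots> = (\<Prod>j<r. frob_poly (p ^ j) (conj_poly q n \<alpha>))"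
    unfolding conj_poly_def base.frob_prod by (rule prod.swap)
  finally show ?thesis .
qed

text \<open>The inverse roots of the \<open>L\<close>-function of \<open>\<chi> \<circ> norm_class p r l0\<close> are thus the \<open>r\<close>-th powers of those of \<open>\<chi>\<close>.\<close>

lemma char_sum_norm:
  assumes l: "l0 \<le> l"
  shows "char_sum q l (\<chi> \<circ> norm_class p r l0) n = char_sum p l0 (\<chi> :: 'k poly \<Rightarrow> complex) (r * n)"
proof -
  have "norm_class p r l0 (short_class l f) = short_class l0 (\<Prod>j<r. frob_poly (p ^ j) f)" for f :: "'k poly"
    unfolding norm_class_def short_class_def reflect_poly_prod
    using l by (intro poly_cutoff_prod_cong) (simp add: base.frob_cutoff poly_cutoff_cutoff base.frob_reflect)
  moreover have "q ^ n = p ^ (r * n)" by (simp add: q power_mult)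
  ultimately show ?thesis
    unfolding char_sum_def by (simp add: conj_poly_norm)
qed

end

section \<open>Counting elements with prescribed characteristic polynomial\<close>

lemma finite_field_power_card:
  fixes x :: "'a::{finite,field}"
  shows "x ^ CARD('a) = x"
proof (cases "x = 0")
  case True
  then show ?thesis by (simp add: zero_power)
next
  case False
  let ?U = "UNIV - {0 :: 'a}"
  have "(\<Prod>y\<in>?U. x * y) = \<Prod>?U"
    by (rule prod.reindex_bij_witness[of _ "\<lambda>y. y / x" "\<lambda>y. x * y"]) (use False in auto)
  then have "x ^ card ?U * \<Prod>?U = \<Prod>?U" by (simp add: prod.distrib)
  moreover have "\<Prod>?U \<noteq> 0" by simp
  ultimately have "x ^ card ?U = 1" by simp
  moreover have "CARD('a) = Suc (card ?U)"
    by (simp add: card_Diff_singleton)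
  ultimately show ?thesis by (simp only: power_Suc mult_1_right)
qed

text \<open>The embedding of polynomials over a field into those over its algebraic closure.\<close>

definition base_change :: "'a::field poly \<Rightarrow> 'a alg_closure poly" where
  "base_change = map_poly to_ac"

lemma coeff_base_change [simp]: "coeff (base_change f) n = to_ac (coeff f n)"
  by (simp add: base_change_def coeff_map_poly)

lemma base_change_mult: "base_change (f * g) = base_change f * base_change g"
  by (rule poly_eqI) (simp add: coeff_mult to_ac_sum to_ac_mult)

lemma base_change_1 [simp]: "base_change 1 = 1"
  by (simp add: base_change_def)

lemma base_change_power: "base_change (f ^ n) = base_change f ^ n"
  by (induction n) (simp_all add: base_change_mult)

lemma base_change_eq_iff [simp]: "base_change f = base_change g \<longleftrightarrow> f = g"
  by (simp add: poly_eq_iff)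

lemma base_change_eq_0_iff [simp]: "base_change f = 0 \<longleftrightarrow> f = 0"
  by (simp add: poly_eq_iff)

lemma degree_base_change [simp]: "degree (base_change f) = degree f"
  unfolding base_change_def by (rule degree_map_poly) simp

text \<open>The algebraic closure of a finite field with \<open>q = p ^ r\<close> elements, which is embedded as \<open>frob_field q\<close>.\<close>

locale finite_field_closure = frobenius p r q "TYPE('a::{finite,field} alg_closure)"
  for p r q :: nat and F :: "'a::{finite,field} itself" +
  assumes card: "CARD('a) = q"
begin

lemma range_to_ac: "range (to_ac :: 'a \<Rightarrow> 'a alg_closure) = frob_field q"
proof (rule card_subset_eq)
  show "range (to_ac :: 'a \<Rightarrow> 'a alg_closure) \<subseteq> frob_field q"
    using finite_field_power_card[where 'a = 'a] card
    by (auto simp: frob_field_def simp flip: to_ac_power)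
  show "card (range (to_ac :: 'a \<Rightarrow> 'a alg_closure)) = card (frob_field q :: 'a alg_closure set)"
    using card_frob_field(1)[of 1] card by (simp add: card_image inj_to_ac)
  show "finite (frob_field q :: 'a alg_closure set)"
    using card_frob_field(2)[of 1] by simp
qed

lemma frob_fixed_iff_base_change:
  "frob_poly q f = f \<longleftrightarrow> (\<exists>g :: 'a poly. f = base_change g)"
proof
  assume "frob_poly q f = f"
  then have c: "coeff f n \<in> range (to_ac :: 'a \<Rightarrow> _)" for n
    using frob_fixed_iff[of 1 f] by (simp add: range_to_ac)
  have "f = base_change (map_poly of_ac f)"
    by (rule poly_eqI) (simp add: coeff_map_poly to_ac_of_ac c)
  then show "\<exists>g :: 'a poly. f = base_change g" by blast
next
  assume "\<exists>g :: 'a poly. f = base_change g"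
  then show "frob_poly q f = f"
    using frob_fixed_iff[of 1 f] range_to_ac by auto
qed

lemma frob_monics_eq: "frob_monics q n = base_change ` (monic_polys n :: 'a poly set)"
  by (auto simp: frob_monics_def monic_polys_def frob_fixed_iff_base_change image_iff)

lemma conj_poly_dvd:
  assumes f: "frob_poly q f = f" "f \<noteq> 0" and root: "poly f (\<alpha> :: 'a alg_closure) = 0"
    and inj: "inj_on (\<lambda>i. \<alpha> ^ (q ^ i)) {..<d}"
  shows "conj_poly q d \<alpha> dvd f"
proof -
  have "[:- \<alpha>, 1:] ^ 1 dvd f" using root by (simp add: poly_eq_0_iff_dvd)
  then have "[:- (\<alpha> ^ (q ^ i)), 1:] ^ 1 dvd f" for i
    by (rule frob_linear_power_dvd[OF _ f(1)])
  then have "(\<Prod>i<d. [:- (\<alpha> ^ (q ^ i)), 1:] ^ 1) dvd f"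
    by (intro prod_linear_powers_dvd inj f(2)) auto
  then show ?thesis by (simp add: conj_poly_def)
qed

lemma conj_poly_minimal:
  fixes P :: "'a poly"
  assumes P: "irreducible P" "lead_coeff P = 1" and root: "poly (base_change P) \<alpha> = 0"
    and d: "d \<ge> 1" "\<alpha> \<in> frob_field (q ^ d)" "inj_on (\<lambda>i. \<alpha> ^ (q ^ i)) {..<d}"
  shows "conj_poly q d \<alpha> = base_change P"
proof -
  have PM: "base_change P \<in> frob_monics q (degree P)"
    using P by (auto simp: frob_monics_eq monic_polys_def)
  have fP: "frob_poly q (base_change P) = base_change P" "base_change P \<noteq> 0"
    using PM by (auto simp: frob_monics_def)
  have NM: "conj_poly q d \<alpha> \<in> frob_monics q d"
    by (rule conj_poly_in_frob_monics[OF d(2)])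
  obtain g where g: "g \<in> frob_monics q (degree P - d)" "base_change P = conj_poly q d \<alpha> * g"
    using frob_monics_divide[OF PM NM conj_poly_dvd[OF fP root d(3)]] .
  obtain N G :: "'a poly" where NG: "N \<in> monic_polys d" "conj_poly q d \<alpha> = base_change N"
    "G \<in> monic_polys (degree P - d)" "g = base_change G"
    using NM g(1) unfolding frob_monics_eq by blast
  have PNG: "P = N * G" using g(2) NG by (simp flip: base_change_mult)
  have "N \<noteq> 0" "degree N = d" using NG(1) by (auto simp: monic_polys_def)
  then have "\<not> N dvd 1" using d(1) by (simp add: is_unit_iff_degree)
  then have "G dvd 1" using Factorial_Ring.irreducibleD[OF P(1) PNG] by blast
  then have "degree G = 0" by (auto simp: is_unit_poly_iff)
  then have "G = 1" using NG(3) by (auto simp: monic_polys_def one_pCons elim!: degree_eq_zeroE)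
  then show ?thesis using PNG NG(2) by simp
qed

lemma conj_poly_irreducible:
  fixes N :: "'a poly"
  assumes N: "conj_poly q d \<alpha> = base_change N" and d: "d \<ge> 1" "inj_on (\<lambda>i. \<alpha> ^ (q ^ i)) {..<d}"
  shows "irreducible N"
proof (rule Factorial_Ring.irreducibleI)
  have degN: "degree N = d" using N by (metis degree_base_change degree_conj_poly)
  then show "N \<noteq> 0" "\<not> N dvd 1" using d(1) by (auto simp: is_unit_iff_degree)
  have *: "H dvd 1" if GH: "N = G * H" and root: "poly (base_change G) \<alpha> = 0" for G H
  proof -
    have nz: "G \<noteq> 0" "H \<noteq> 0" using GH \<open>N \<noteq> 0\<close> by auto
    have "base_change G \<noteq> 0" using nz(1) by simp
    moreover have "frob_poly q (base_change G) = base_change G"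
      unfolding frob_fixed_iff_base_change by blast
    ultimately have "conj_poly q d \<alpha> dvd base_change G" "base_change G \<noteq> 0"
      using conj_poly_dvd[OF _ _ root d(2)] by blast+
    then have "d \<le> degree G" using dvd_imp_degree_le[of "conj_poly q d \<alpha>" "base_change G"] by simp
    moreover have "degree N = degree G + degree H" using nz unfolding GH by (rule degree_mult_eq)
    ultimately have "degree H = 0" using degN by simp
    then show ?thesis using nz by (simp add: is_unit_iff_degree)
  qed
  fix G H assume GH: "N = G * H"
  have "poly (base_change N) \<alpha> = 0"
    using conj_poly_root[of d q \<alpha>] d(1) N by simp
  then have "poly (base_change G) \<alpha> = 0 \<or> poly (base_change H) \<alpha> = 0"
    by (simp add: GH base_change_mult)
  then show "G dvd 1 \<or> H dvd 1" using *[of G H] *[of H G] GH by (auto simp: mult.commute)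
qed

text \<open>If \<open>f = P ^ k\<close> with \<open>P\<close> irreducible, the elements counted here are the roots of \<open>P\<close>, which form one Frobenius
  orbit of length \<open>degree P\<close>. Conversely every \<open>conj_poly q n \<alpha>\<close> is a power of an irreducible polynomial.\<close>

lemma card_conj_fibre_eq_mangoldt:
  fixes f :: "'a poly"
  assumes f: "f \<in> monic_polys n" and n: "n \<ge> 1"
  shows "card {\<alpha> \<in> frob_field (q ^ n). conj_poly q n \<alpha> = base_change f} = mangoldt f"
proof -
  let ?S = "{\<alpha> \<in> frob_field (q ^ n). conj_poly q n \<alpha> = base_change f}"
  have fM: "base_change f \<in> frob_monics q n" using f by (simp add: frob_monics_eq)
  have ff: "frob_poly q (base_change f) = base_change f" "base_change f \<noteq> 0"
    using fM by (auto simp: frob_monics_def)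
  have root_S: "poly (base_change f) \<alpha> = 0" if "\<alpha> \<in> ?S" for \<alpha>
    using that conj_poly_root[of n q \<alpha>] n by auto
  show ?thesis
  proof (cases "\<exists>P k. irreducible P \<and> lead_coeff P = 1 \<and> k \<ge> 1 \<and> f = P ^ k")
    case True
    then obtain P k where P: "irreducible P" "lead_coeff P = 1" "k \<ge> 1" "f = P ^ k" by blast
    have rootf: "poly (base_change f) \<alpha> = 0 \<longleftrightarrow> poly (base_change P) \<alpha> = 0" for \<alpha>
      using P(3) by (simp add: P(4) base_change_power)
    have "degree P \<noteq> 0" using P(1) by (auto simp: Factorial_Ring.irreducible_def is_unit_iff_degree)
    then obtain \<alpha> where \<alpha>: "poly (base_change P) \<alpha> = 0"
      using alg_closed_imp_poly_has_root[of "base_change P"] by auto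
    have orb: "conj_poly q (degree P) \<beta> = base_change P \<and> \<beta> \<in> ?S
        \<and> inj_on (\<lambda>i. \<beta> ^ (q ^ i)) {..<degree P}"
      if \<beta>: "poly (base_change P) \<beta> = 0" for \<beta>
    proof -
      have "poly (base_change f) \<beta> = 0" using \<beta> rootf by simp
      then obtain d where d: "d \<ge> 1" "\<And>k. \<beta> \<in> frob_field (q ^ k) \<longleftrightarrow> d dvd k"
        "inj_on (\<lambda>i. \<beta> ^ (q ^ i)) {..<d}" "\<And>j. conj_poly q (d * j) \<beta> = conj_poly q d \<beta> ^ j"
        using orbit[OF ff] by metis
      have 1: "conj_poly q d \<beta> = base_change P"
        using conj_poly_minimal[OF P(1,2) \<beta> d(1) _ d(3)] d(2) by simp
      then have dP: "d = degree P" by (metis degree_base_change degree_conj_poly)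
      have nk: "n = d * k" using f P(2,4) dP
        by (metis (mono_tags, lifting) monic_polys_def degree_power_eq Factorial_Ring.irreducible_def P(1) mem_Collect_eq mult.commute)
      have "\<beta> \<in> ?S" using d(2) d(4)[of k] 1 by (simp add: nk P(4) base_change_power)
      then show ?thesis using 1 d(3) dP by simp
    qed
    have S: "?S = {\<beta>. poly (base_change P) \<beta> = 0}" using orb root_S rootf by blast
    also have "\<dots> = {\<beta>. poly (conj_poly q (degree P) \<alpha>) \<beta> = 0}"
      using orb[OF \<alpha>] by simp
    also have "\<dots> = (\<lambda>i. \<alpha> ^ (q ^ i)) ` {..<degree P}"
      unfolding conj_poly_def poly_prod by auto
    also have "card \<dots> = degree P"
      using orb[OF \<alpha>] by (simp add: card_image)
    also have "\<dots> = mangoldt f" using mangoldt_power[OF P(1-3)] P(4) by simp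
    finally show ?thesis .
  next
    case False
    have "\<alpha> \<notin> ?S" for \<alpha>
    proof
      assume \<alpha>: "\<alpha> \<in> ?S"
      obtain d where d: "d \<ge> 1" "\<And>k. \<alpha> \<in> frob_field (q ^ k) \<longleftrightarrow> d dvd k"
        "inj_on (\<lambda>i. \<alpha> ^ (q ^ i)) {..<d}" "\<And>j. conj_poly q (d * j) \<alpha> = conj_poly q d \<alpha> ^ j"
        using orbit[OF ff root_S[OF \<alpha>]] by metis
      have "d dvd n" using \<alpha> d(2) by simp
      then obtain k where k: "n = d * k" by (elim dvdE)
      have "conj_poly q d \<alpha> \<in> frob_monics q d" using d(2) by (intro conj_poly_in_frob_monics) simp
      then obtain N :: "'a poly" where N: "N \<in> monic_polys d" "conj_poly q d \<alpha> = base_change N"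
        unfolding frob_monics_eq by blast
      have "base_change f = base_change (N ^ k)"
        using \<alpha> d(4)[of k] by (simp add: k N(2) base_change_power)
      then have "f = N ^ k" by simp
      moreover have "irreducible N" by (rule conj_poly_irreducible[OF N(2) d(1,3)])
      moreover have "k \<ge> 1" using k n by (cases k) auto
      ultimately show False using False N(1) by (auto simp: monic_polys_def)
    qed
    then have "?S = {}" by blast
    moreover have "mangoldt f = 0" using False by (simp only: mangoldt_def if_False)
    ultimately show ?thesis by (simp only: card.empty)
  qed
qed

lemma short_class_eq_1_iff:
  fixes f :: "'a poly"
  assumes f: "f \<in> monic_polys n"
  shows "short_class l (base_change f) = 1 \<longleftrightarrow> (\<forall>j\<in>{1..l}. next_to_leading j f = 0)"
proof -
  have df: "degree (base_change f) = n" "degree f = n" "coeff f n = 1"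
    using f by (auto simp: monic_polys_def)
  have "short_class l (base_change f) = 1 \<longleftrightarrow>
      (\<forall>j. (if j \<le> l \<and> j \<le> n then coeff f (n - j) else 0) = (if j = 0 then 1 else 0))"
    by (auto simp: poly_eq_iff coeff_short_class[OF df(1)] split: if_splits)
  also have "\<dots> \<longleftrightarrow> (\<forall>j\<in>{1..l}. next_to_leading j f = 0)"
    using df by (auto simp: next_to_leading_def split: if_splits)
  finally show ?thesis .
qed

lemma psi_eq_card:
  assumes n: "n \<ge> 1"
  shows "psi n (replicate l (0 :: 'a)) = card {\<alpha> :: 'a alg_closure. \<alpha> \<in> frob_field (q ^ n) \<and> short_class l (conj_poly q n \<alpha>) = 1}"
proof -
  let ?P = "{f \<in> monic_polys n. \<forall>j\<in>{1..l}. next_to_leading j f = (0 :: 'a)}"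
  let ?S = "\<lambda>f. {\<alpha> \<in> frob_field (q ^ n). conj_poly q n \<alpha> = base_change f}"
  have fin: "finite (frob_field (q ^ n) :: 'a alg_closure set)" using card_frob_field(2)[OF n] .
  have finP: "finite ?P" by (rule finite_subset[OF _ finite_monic_polys[of n]]) auto
  have "psi n (replicate l (0 :: 'a)) = (\<Sum>f\<in>?P. mangoldt f)"
    unfolding psi_def by (intro sum.cong Collect_cong) auto
  also have "\<dots> = (\<Sum>f\<in>?P. card (?S f))"
    by (intro sum.cong refl card_conj_fibre_eq_mangoldt[symmetric] n) auto
  also have "\<dots> = card (\<Union>f\<in>?P. ?S f)"
    using fin finP by (subst card_UN_disjoint) auto
  also have "(\<Union>f\<in>?P. ?S f) = {\<alpha>. \<alpha> \<in> frob_field (q ^ n) \<and> short_class l (conj_poly q n \<alpha>) = 1}"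
  proof (intro equalityI subsetI)
    fix \<alpha> assume \<alpha>: "\<alpha> \<in> {\<alpha> :: 'a alg_closure. \<alpha> \<in> frob_field (q ^ n) \<and> short_class l (conj_poly q n \<alpha>) = 1}"
    then obtain f :: "'a poly" where "f \<in> monic_polys n" "conj_poly q n \<alpha> = base_change f"
      using conj_poly_in_frob_monics[of \<alpha> n] unfolding frob_monics_eq by blast
    then show "\<alpha> \<in> (\<Union>f\<in>?P. ?S f)" using \<alpha> short_class_eq_1_iff[of f n l] by auto
  qed (auto simp: short_class_eq_1_iff)
  finally show ?thesis .
qed

lemma psi_eq_sum_char_sums:
  assumes n: "n \<ge> 1"
  shows "of_nat (q ^ l) * of_nat (psi n (replicate l (0 :: 'a)))
       = (\<Sum>\<chi>\<in>characters (trunc_group q l :: 'a alg_closure poly monoid). char_sum q l \<chi> n)"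
proof -
  let ?G = "trunc_group q l :: 'a alg_closure poly monoid"
  let ?F = "frob_field (q ^ n) :: 'a alg_closure set"
  interpret G: comm_group ?G by (rule trunc_group)
  have fin: "finite ?F" using card_frob_field(2)[OF n] .
  have "(\<Sum>\<chi>\<in>characters ?G. char_sum q l \<chi> n)
      = (\<Sum>\<alpha>\<in>?F. \<Sum>\<chi>\<in>characters ?G. \<chi> (short_class l (conj_poly q n \<alpha>)))"
    unfolding char_sum_def by (rule sum.swap)
  also have "\<dots> = (\<Sum>\<alpha>\<in>?F. if short_class l (conj_poly q n \<alpha>) = 1 then of_nat (q ^ l) else 0)"
  proof (rule sum.cong[OF refl])
    fix \<alpha> assume "\<alpha> \<in> ?F"
    then have "short_class l (conj_poly q n \<alpha>) \<in> carrier ?G"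
      by (intro short_class_in_carrier[OF conj_poly_in_frob_monics])
    from G.sum_characters[OF finite_card_trunc_group(1) this]
    show "(\<Sum>\<chi>\<in>characters ?G. \<chi> (short_class l (conj_poly q n \<alpha>)))
        = (if short_class l (conj_poly q n \<alpha>) = 1 then of_nat (q ^ l) else 0)"
      by (simp add: Coset.order_def finite_card_trunc_group(2)) (simp add: trunc_group_def)
  qed
  also have "\<dots> = of_nat (q ^ l) * of_nat (psi n (replicate l (0 :: 'a)))"
    unfolding psi_eq_card[OF n] using fin by (simp add: sum.If_cases Int_def)
  finally show ?thesis by simp
qed

end

section \<open>Non-periodicity\<close>

lemma root_of_unity_in_adjoin:
  assumes "w ^ m = 1" "m dvd M" "M > 0"
  shows "w \<in> int_adjoin (cis (2 * pi / real M))"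
proof -
  obtain c where "M = m * c" using assms(2) by (elim dvdE)
  then have "w ^ M = 1" by (simp only: power_mult assms(1) power_one)
  then have "w \<in> (\<lambda>k. cis (2 * pi * real k / real M)) ` {..<M}"
    using bij_betw_roots_unity[OF assms(3)] by (auto simp: bij_betw_def)
  then obtain k where "w = cis (2 * pi * real k / real M)" by blast
  also have "\<dots> = cis (2 * pi / real M) ^ k" by (simp add: DeMoivre mult_ac)
  finally show ?thesis using int_adjoin_power by auto
qed

text \<open>If the \<open>m\<close>-th powers of all nonzero \<open>\<gamma> i\<close> equal \<open>R\<close> with \<open>R\<^sup>2 = p ^ m\<close>, the square of
  their sum is \<open>p\<close> times a sum of \<open>m\<close>-th roots of unity.\<close>

lemma square_of_sum_in_adjoin:
  fixes \<gamma> :: "nat \<Rightarrow> complex"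
  assumes p: "p > 0" and m: "m dvd M" "M > 0"
    and \<gamma>: "\<And>i. i < d \<Longrightarrow> \<gamma> i \<noteq> 0 \<Longrightarrow> \<gamma> i ^ m = R" and R: "R\<^sup>2 = of_nat (p :: nat) ^ m"
  shows "\<exists>\<beta>\<in>int_adjoin (cis (2 * pi / real M)). (\<Sum>i<d. \<gamma> i)\<^sup>2 = of_nat p * \<beta>"
proof
  define \<beta> where "\<beta> = (\<Sum>i<d. \<Sum>j<d. \<gamma> i * \<gamma> j / of_nat p)"
  show "(\<Sum>i<d. \<gamma> i)\<^sup>2 = of_nat p * \<beta>"
  proof -
    have "(\<Sum>i<d. \<gamma> i)\<^sup>2 = (\<Sum>i<d. \<Sum>j<d. \<gamma> i * \<gamma> j)"
      by (simp only: power2_eq_square sum_product)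
    also have "\<dots> = of_nat p * \<beta>"
      unfolding \<beta>_def sum_distrib_left using p by simp
    finally show ?thesis .
  qed
  have "\<gamma> i * \<gamma> j / of_nat p \<in> int_adjoin (cis (2 * pi / real M))" if "i < d" "j < d" for i j
  proof (cases "\<gamma> i = 0 \<or> \<gamma> j = 0")
    case False
    then have "(\<gamma> i * \<gamma> j / of_nat p) ^ m = 1"
      using \<gamma>[OF that(1)] \<gamma>[OF that(2)] R p
      by (simp add: power_mult_distrib power_divide power2_eq_square)
    then show ?thesis using m by (rule root_of_unity_in_adjoin)
  qed auto
  then show "\<beta> \<in> int_adjoin (cis (2 * pi / real M))"
    unfolding \<beta>_def by (intro int_adjoin_sum) auto
qed

lemma normalized_error_eq:
  assumes q: "CARD('a::{finite,field}) = q" and n: "n \<ge> 1"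
  shows "real (q ^ l) * real (psi n (replicate l (0::'a))) - real q ^ n
       = real (q ^ l) * real q powr (real n / 2) * normalized_error TYPE('a) l n"
proof -
  have q0: "q > 0" using q zero_less_card_finite[where 'a = 'a] by simp
  have "real q powi (int n - int l) = real q ^ n / real q ^ l"
    using q0 by (simp add: power_int_diff)
  then show ?thesis
    unfolding normalized_error_def q using q0 by (simp add: field_simps)
qed

theorem theorem1p3:
  fixes p r l :: nat
  assumes "prime p" and "r \<ge> 1" and "CARD('a::{finite,field}) = p ^ r"
    and "l \<ge> 1"
    and "(l = 3 \<and> p \<notin> {2, 5}) \<or> l \<ge> 4"
  shows "\<not> (\<exists>N\<ge>1. \<forall>n\<ge>1.
           normalized_error TYPE('a) l (n + N) = normalized_error TYPE('a) l n)"
proof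
  assume "\<exists>N\<ge>1. \<forall>n\<ge>1. normalized_error TYPE('a) l (n + N) = normalized_error TYPE('a) l n"
  then obtain N where N: "N \<ge> 1"
    and per: "\<And>n. n \<ge> 1 \<Longrightarrow> normalized_error TYPE('a) l (n + N) = normalized_error TYPE('a) l n"
    by blast
  define q where "q = p ^ r"
  have q0: "q > 0" using assms(1) by (simp add: q_def prime_gt_0_nat)
  have "CHAR('a) dvd p ^ r" using CHAR_dvd_CARD[where 'a = 'a] assms(3) by simp
  moreover have "prime CHAR('a)" by (rule prime_CHAR_semidom) (simp add: finite_imp_CHAR_pos)
  ultimately have "CHAR('a) = p" using assms(1) prime_dvd_power primes_dvd_imp_eq by blast
  then have char: "CHAR('a alg_closure) = p" by simp
  interpret finite_field_closure p r q "TYPE('a)"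
    by unfold_locales (use assms char in \<open>auto simp: q_def\<close>)
  interpret frobenius_tower p r q "TYPE('a alg_closure)"
    by unfold_locales (use assms char in \<open>auto simp: q_def\<close>)
  let ?G = "trunc_group q l :: 'a alg_closure poly monoid"
  interpret G: comm_group ?G by (rule trunc_group)
  define \<chi>1 where "\<chi>1 = restrict (\<lambda>_. 1 :: complex) (carrier ?G)"
  define Y where "Y = characters ?G - {\<chi>1}"
  have finY: "finite Y" unfolding Y_def using G.finite_characters finite_card_trunc_group(1) by blast
  define R where "R = complex_of_real (real q powr (real N / 2))"
  \<comment> \<open>by orthogonality, \<open>E n\<close> is \<open>q ^ l * q powr (n / 2)\<close> times the normalized error\<close>
  define E where "E = (\<lambda>n. \<Sum>\<chi>\<in>Y. char_sum q l \<chi> n)"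
  have \<chi>1: "\<chi>1 \<in> characters ?G"
    by (auto simp: \<chi>1_def characters_def group_character_def)
  have \<chi>1_sum: "char_sum q l \<chi>1 n = of_nat q ^ n" if "n \<ge> 1" for n
    by (rule char_sum_trivial[OF that]) (simp add: \<chi>1_def)
  have E_eq: "E n = complex_of_real (real (q ^ l) * real q powr (real n / 2) * normalized_error TYPE('a) l n)"
    if n: "n \<ge> 1" for n
  proof -
    have "of_nat (q ^ l) * of_nat (psi n (replicate l (0 :: 'a))) = E n + of_nat q ^ n"
      unfolding psi_eq_sum_char_sums[OF n] E_def Y_def
      using \<chi>1 G.finite_characters[OF finite_card_trunc_group(1)] by (simp add: sum.remove \<chi>1_sum[OF n])
    then have "E n = complex_of_real (real (q ^ l) * real (psi n (replicate l (0::'a))) - real q ^ n)"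
      by simp
    then show ?thesis unfolding normalized_error_eq[OF card n] .
  qed
  have E_per: "E (n + N) = R * E n" if n: "n \<ge> 1" for n
  proof -
    have "real q powr (real (n + N) / 2) = real q powr (real N / 2) * real q powr (real n / 2)"
      by (simp add: add_divide_distrib flip: powr_add) (simp add: add.commute)
    then show ?thesis using n by (simp add: E_eq per R_def)
  qed
  \<comment> \<open>the nontrivial characters together form one family of inverse roots with power sums \<open>- E n\<close>\<close>
  have "\<exists>d \<gamma>. \<forall>n\<ge>1. char_sum q l \<chi> n = - (\<Sum>i<(d::nat). \<gamma> i ^ n)" if \<chi>: "\<chi> \<in> Y" for \<chi>
  proof -
    have c: "group_character ?G (carrier ?G) \<chi>" "\<chi> \<in> extensional (carrier ?G)" "\<chi> \<noteq> \<chi>1"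
      using \<chi> by (auto simp: Y_def characters_def)
    then obtain g where "g \<in> carrier ?G" "\<chi> g \<noteq> 1"
      by (auto simp: \<chi>1_def fun_eq_iff restrict_def extensional_def split: if_splits)
    then show ?thesis using char_sum_roots[OF c(1)] by metis
  qed
  then obtain d \<gamma> where \<gamma>: "\<And>\<chi> n. \<chi> \<in> Y \<Longrightarrow> n \<ge> 1 \<Longrightarrow> char_sum q l \<chi> n = - (\<Sum>i<(d \<chi> :: nat). \<gamma> \<chi> i ^ n)"
    by metis
  have "(\<gamma> \<chi> i) ^ N = R" if "\<chi> \<in> Y" "i < d \<chi>" "\<gamma> \<chi> i \<noteq> 0" for \<chi> i
  proof -
    have "(case (\<chi>, i) of (\<chi>, i) \<Rightarrow> \<gamma> \<chi> i) ^ N = R"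
    proof (rule power_sums_eigenvalues[of "Sigma Y (\<lambda>\<chi>. {..<d \<chi>})"])
      fix n :: nat assume n: "n \<ge> 1"
      have E: "(\<Sum>x\<in>Sigma Y (\<lambda>\<chi>. {..<d \<chi>}). (case x of (\<chi>, i) \<Rightarrow> \<gamma> \<chi> i) ^ n) = - E n" if "n \<ge> 1" for n
      proof -
        have "(\<Sum>x\<in>Sigma Y (\<lambda>\<chi>. {..<d \<chi>}). (case x of (\<chi>, i) \<Rightarrow> \<gamma> \<chi> i) ^ n)
            = (\<Sum>\<chi>\<in>Y. \<Sum>i<d \<chi>. \<gamma> \<chi> i ^ n)"
          by (subst sum.Sigma) (use finY in \<open>auto simp: split_def\<close>)
        then show ?thesis using that by (simp add: E_def \<gamma> sum_negf)
      qed
      show "(\<Sum>x\<in>Sigma Y (\<lambda>\<chi>. {..<d \<chi>}). (case x of (\<chi>, i) \<Rightarrow> \<gamma> \<chi> i) ^ (n + N))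
          = R * (\<Sum>x\<in>Sigma Y (\<lambda>\<chi>. {..<d \<chi>}). (case x of (\<chi>, i) \<Rightarrow> \<gamma> \<chi> i) ^ n)"
        using E[of n] E[of "n + N"] E_per[OF n] n by simp
    qed (use finY that in auto)
    then show ?thesis by simp
  qed
  then have \<gamma>N: "(\<gamma> \<chi> i) ^ (n + N) = R * \<gamma> \<chi> i ^ n" if "\<chi> \<in> Y" "i < d \<chi>" "n \<ge> 1" for \<chi> i n
    using that N by (cases "\<gamma> \<chi> i = 0") (auto simp: power_add)
  have sum_per: "char_sum q l \<chi> (n + N) = R * char_sum q l \<chi> n" if "\<chi> \<in> Y" "n \<ge> 1" for \<chi> n
    using that by (simp add: \<gamma> \<gamma>N sum_distrib_left)
  \<comment> \<open>\<open>z\<close> generates all the roots of unity needed: those in the values of \<open>\<chi>0\<close> and those of order \<open>r * N\<close>\<close>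
  define M where "M = 72 * p * (r * N)"
  define z where "z = cis (2 * pi / real M)"
  have M0: "M > 0" using assms(2) N prime_gt_0_nat[OF assms(1)] by (simp add: M_def)
  have z: "z ^ M = 1" using M0 by (simp add: z_def DeMoivre)
  define l0 :: nat where "l0 = (if p = 2 \<or> p = 5 then 4 else 3)"
  have l0: "l0 \<le> l" using assms(5) by (auto simp: l0_def)
  obtain \<chi>0 g0 where \<chi>0: "group_character (trunc_group p l0) (carrier (trunc_group p l0 :: 'a alg_closure poly monoid)) \<chi>0"
    "g0 \<in> carrier (trunc_group p l0)" "\<chi>0 g0 \<noteq> 1"
    "\<And>\<beta>. \<beta> \<in> int_adjoin z \<Longrightarrow> (char_sum p l0 \<chi>0 1)\<^sup>2 \<noteq> of_nat p * \<beta>"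
    using base.bad_character[OF l0_def z M0] root_of_unity_in_adjoin[of _ "72 * p" M] M0
    by (auto simp: z_def M_def) 
  obtain d0 \<gamma>0 where \<gamma>0: "\<And>n. n \<ge> 1 \<Longrightarrow> char_sum p l0 \<chi>0 n = - (\<Sum>i<(d0::nat). \<gamma>0 i ^ n)"
    using base.char_sum_roots[OF \<chi>0(1-3)] by metis
  define \<chi> where "\<chi> = restrict (\<chi>0 \<circ> norm_class p r l0) (carrier ?G)"
  have \<chi>_sum: "char_sum q l \<chi> n = - (\<Sum>i<d0. (\<gamma>0 i ^ r) ^ n)" if n: "n \<ge> 1" for n
  proof -
    have "char_sum q l \<chi> n = char_sum q l (\<chi>0 \<circ> norm_class p r l0) n"
      by (rule char_sum_cong) (simp add: \<chi>_def)
    also have "\<dots> = char_sum p l0 \<chi>0 (r * n)" by (rule char_sum_norm[OF l0])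
    also have "\<dots> = - (\<Sum>i<d0. (\<gamma>0 i ^ r) ^ n)"
      using n assms(2) by (subst \<gamma>0) (simp_all add: power_mult)
    finally show ?thesis .
  qed
  have "\<chi> \<in> characters ?G"
    unfolding \<chi>_def by (rule G.restrict_character[OF character_norm[OF \<chi>0(1) l0]])
  moreover have "\<chi> \<noteq> \<chi>1"
  proof
    assume "\<chi> = \<chi>1"
    \<comment> \<open>otherwise the power sums of the \<open>\<gamma>0 i ^ r\<close> together with \<open>q\<close> would vanish identically\<close>
    define \<delta> where "\<delta> = (\<lambda>i. if i < d0 then \<gamma>0 i ^ r else of_nat q)"
    have "\<delta> d0 ^ 1 = 0"
    proof (rule power_sums_eigenvalues[of "{..<Suc d0}"])
      fix n :: nat assume "n \<ge> 1"
      have zero: "(\<Sum>i<Suc d0. \<delta> i ^ n) = 0" if "n \<ge> 1" for n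
        using \<chi>_sum[OF that] \<chi>1_sum[OF that] \<open>\<chi> = \<chi>1\<close> by (simp add: \<delta>_def)
      show "(\<Sum>i<Suc d0. \<delta> i ^ (n + 1)) = 0 * (\<Sum>i<Suc d0. \<delta> i ^ n)"
        by (simp only: zero[OF le_add2] mult_zero_left)
    qed (use q0 in \<open>auto simp: \<delta>_def\<close>)
    then show False using q0 by (simp add: \<delta>_def)
  qed
  ultimately have \<chi>Y: "\<chi> \<in> Y" by (simp add: Y_def)
  have "\<gamma>0 i ^ (r * N) = R" if i: "i < d0" "\<gamma>0 i \<noteq> 0" for i
  proof -
    have "(\<lambda>i. \<gamma>0 i ^ r) i ^ N = R"
    proof (rule power_sums_eigenvalues[where I = "{..<d0}" and \<gamma> = "\<lambda>i. \<gamma>0 i ^ r"])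
      fix n :: nat assume n: "n \<ge> 1"
      show "(\<Sum>i<d0. (\<gamma>0 i ^ r) ^ (n + N)) = R * (\<Sum>i<d0. (\<gamma>0 i ^ r) ^ n)"
        using sum_per[OF \<chi>Y n] \<chi>_sum[of n] \<chi>_sum[of "n + N"] n by simp
    qed (use i in auto)
    then show ?thesis by (simp add: power_mult)
  qed
  moreover have "R\<^sup>2 = of_nat p ^ (r * N)"
  proof -
    have "(real q powr (real N / 2))\<^sup>2 = real q ^ N"
      using q0 by (simp add: power2_eq_square flip: powr_add powr_realpow)
    then have "R\<^sup>2 = of_nat q ^ N" unfolding R_def by (metis of_real_of_nat_eq of_real_power)
    then show ?thesis by (simp add: q_def power_mult)
  qed
  ultimately obtain \<beta> where \<beta>: "\<beta> \<in> int_adjoin z" "(\<Sum>i<d0. \<gamma>0 i)\<^sup>2 = of_nat p * \<beta>"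
    using square_of_sum_in_adjoin[of p "r * N" M d0 \<gamma>0 R] M0 prime_gt_0_nat[OF assms(1)]
    by (auto simp: z_def M_def)
  have "char_sum p l0 \<chi>0 1 = - (\<Sum>i<d0. \<gamma>0 i)" using \<gamma>0[of 1] by simp
  then have "(char_sum p l0 \<chi>0 1)\<^sup>2 = of_nat p * \<beta>" using \<beta>(2) by (simp only: power2_minus)
  with \<chi>0(4)[OF \<beta>(1)] show False by contradiction
qed

end
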